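(* Let $(\boldsymbol\gamma,\mathbf{A},\rho)$ be a multiplicative Lévy triplet on $\mathbb{T}^d$. Given an infinitesimal triangular array $\{\nu_{nk}\}_{n\geq1,1\leq k\leq k_n}\subset\mathscr{P}_{\mathbb{T}^d}$ and a sequence $\{\boldsymbol\xi_n\}\subset\mathbb{T}^d$, let $\rho_n=\sum_{k=1}^{k_n}\mathring\nu_{nk}$ and $$\boldsymbol\gamma_n=\boldsymbol\xi_n\exp\Big[i\sum_{k=1}^{k_n}\Big(\arg\boldsymbol b_{nk}+\int_{\mathbb{T}^d}(\Im\boldsymbol s)\,d\mathring\nu_{nk}(\boldsymbol s)\Big)\Big].$$ Then the sequence $\delta_{\boldsymbol\xi_n}\circledast\nu_{n1}\circledast\cdots\circledast\nu_{nk_n}$ converges weakly to $\nu_{\circledast}^{(\boldsymbol\gamma,\mathbf{A},\rho)}$ if and only if: (1) $\lim_{n\to\infty}\boldsymbol\gamma_n=\boldsymbol\gamma$; (2) for all $j,\ell$, the limit $\lim_{\epsilon\to0}\limsup_{n\to\infty}\int_{\mathscr{U}_\epsilon}(\Im s_j)(\Im s_\ell)\,d\rho_n=\lim_{\epsilon\to0}\liminf_{n\to\infty}\int_{\mathscr{U}_\epsilon}(\Im s_j)(\Im s_\ell)\,d\rho_n$ exists and equals the $(j,\ell)$-entry of $\mathbf{A}$; (3) $\{1_{\mathbb{T}^d\setminus\{\mathbf1\}}\rho_n\}$ is relatively compact in $\tilde{\mathscr{M}}_{\mathbb{T}^d}^{\mathbf1}$ and all its limit points belong to $\mathcal{L}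(\rho)$.
   Context: A multiplicative Lévy triplet $(\boldsymbol\gamma,\mathbf{A},\rho)$ consists of $\boldsymbol\gamma\in\mathbb{T}^d$, a positive semi-definite symmetric $d\times d$ real matrix $\mathbf{A}$, and a positive measure $\rho$ on $\mathbb{T}^d$ with $\rho(\{\mathbf{1}\})=0$ and $\|\mathbf{1}-\Re\boldsymbol s\|\in L^1(\rho)$; $\nu_{\circledast}^{(\boldsymbol\gamma,\mathbf{A},\rho)}$ is the probability measure on $\mathbb{T}^d$ with characteristic function $\widehat{\nu}(\boldsymbol p)=\boldsymbol\gamma^{\boldsymbol p}\exp\big(-\frac12\langle\mathbf{A}\boldsymbol p,\boldsymbol p\rangle+\int_{\mathbb{T}^d}(\boldsymbol s^{\boldsymbol p}-1-i\langle\boldsymbol p,\Im\boldsymbol s\rangle)\,d\rho(\boldsymbol s)\big)$, $\boldsymbol p\in\mathbb{Z}^d$; $\circledast$ is the classical convolution on $\mathbb{T}^d$. $\mathcal{L}(\rho)$ is the set of Lévy measures $\widetilde\rho$ with $\nu_{\circledast}^{(\mathbf1,\mathbf0,\rho)}=\nu_{\circledast}^{(\mathbf1,\mathbf0,\widetilde\rho)}$. Infinitesimal means $k_1<k_2<\cdots$ and $\lim_n\max_k\nu_{nk}(\{\|\arg\boldsymbol s\|\geq\epsilon\})=0$ for every $\epsilon>0$. Fix $\theta\in(0,1)$; $\mathscr{U}_\epsilon=\{\boldsymbol s\in\mathbb{T}^d:\|\arg\boldsymbol s\|<\epsilon\}$ with $\arg\in(-\pi,\pi]$ componentwise; $\boldsymbol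 b_{nk}=\exp[i\int_{\mathscr{U}_\theta}(\arg\boldsymbol s)\,d\nu_{nk}(\boldsymbol s)]$ and $d\mathring\nu_{nk}(\boldsymbol s)=d\nu_{nk}(\boldsymbol b_{nk}\boldsymbol s)$. $\tilde{\mathscr{M}}_{\mathbb{T}^d}^{\mathbf1}$ is the (complete separable metrizable) space of positive Borel measures on $\mathbb{T}^d$ not charging $\mathbf1$ and finite on Borel sets bounded away from $\mathbf1$, with the topology of convergence $\int f\,d\tau_n\to\int f\,d\tau$ for all bounded continuous $f$ with support bounded away from $\mathbf1$. *)

theory Defs
  imports "HOL-Probability.Probability"
begin

definition torus :: "(complex ^ 'd) set" where
  "torus = {s. \<forall>j. cmod (s $ j) = 1}"

definition Tb :: "(complex ^ 'd) measure" where
  "Tb = restrict_space borel torus"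

definition argv :: "complex ^ 'd \<Rightarrow> real ^ 'd" where
  "argv s = (\<chi> j. Arg (s $ j))"

definition rev :: "complex ^ 'd \<Rightarrow> real ^ 'd" where
  "rev s = (\<chi> j. Re (s $ j))"

definition imv :: "complex ^ 'd \<Rightarrow> real ^ 'd" where
  "imv s = (\<chi> j. Im (s $ j))"

definition ones :: "complex ^ 'd" where
  "ones = (\<chi> j. 1)"

definition monom_T :: "complex ^ 'd \<Rightarrow> int ^ 'd \<Rightarrow> complex" where
  "monom_T s p = (\<Prod>j\<in>UNIV. (s $ j) powi (p $ j))"

definition ivec :: "int ^ 'd \<Rightarrow> real ^ 'd" where
  "ivec p = (\<chi> j. real_of_int (p $ j))"

definition charT :: "(complex ^ 'd) measure \<Rightarrow> int ^ 'd \<Rightarrow> complex" where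
  "charT \<nu> p = (\<integral>s. monom_T s p \<partial>\<nu>)"

definition levy_measure_T :: "(complex ^ 'd) measure \<Rightarrow> bool" where
  "levy_measure_T \<rho> \<longleftrightarrow> sets \<rho> = sets (Tb :: (complex ^ 'd) measure) \<and>
     emeasure \<rho> {ones} = 0 \<and> integrable \<rho> (\<lambda>s. norm ((\<chi> j. 1) - rev s))"

definition levy_triplet_T :: "complex ^ 'd \<Rightarrow> real ^ 'd ^ 'd \<Rightarrow> (complex ^ 'd) measure \<Rightarrow> bool" where
  "levy_triplet_T \<gamma> A \<rho> \<longleftrightarrow> \<gamma> \<in> torus \<and> transpose A = A \<and>
     (\<forall>x. 0 \<le> (A *v x) \<bullet> x) \<and> levy_measure_T \<rho>"

definition levy_exponent_T :: "complex ^ 'd \<Rightarrow> real ^ 'd ^ 'd \<Rightarrow> (complex ^ 'd) measure \<Rightarrow> int ^ 'd \<Rightarrow> complex" where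
  "levy_exponent_T \<gamma> A \<rho> p = monom_T \<gamma> p *
     exp (- (1/2) * complex_of_real ((A *v ivec p) \<bullet> ivec p)
          + (\<integral>s. monom_T s p - 1 - \<i> * complex_of_real (ivec p \<bullet> imv s) \<partial>\<rho>))"

definition mult_ID :: "complex ^ 'd \<Rightarrow> real ^ 'd ^ 'd \<Rightarrow> (complex ^ 'd) measure \<Rightarrow> (complex ^ 'd) measure" where
  "mult_ID \<gamma> A \<rho> = (THE \<nu>. sets \<nu> = sets Tb \<and> prob_space \<nu> \<and>
      (\<forall>p. charT \<nu> p = levy_exponent_T \<gamma> A \<rho> p))"

definition levy_class :: "(complex ^ 'd) measure \<Rightarrow> (complex ^ 'd) measure set" where
  "levy_class \<rho> = {\<rho>'. levy_measure_T \<rho>' \<and> mult_ID ones 0 \<rho> = mult_ID ones 0 \<rho>'}"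

definition prob_T :: "(complex ^ 'd) measure \<Rightarrow> bool" where
  "prob_T \<nu> \<longleftrightarrow> sets \<nu> = sets (Tb :: (complex ^ 'd) measure) \<and> prob_space \<nu>"

definition weak_conv_T :: "(nat \<Rightarrow> (complex ^ 'd) measure) \<Rightarrow> (complex ^ 'd) measure \<Rightarrow> bool" where
  "weak_conv_T \<mu>s \<mu> \<longleftrightarrow> (\<forall>f :: complex ^ 'd \<Rightarrow> real. continuous_on torus f \<longrightarrow>
      (\<lambda>n. \<integral>s. f s \<partial>(\<mu>s n)) \<longlonglongrightarrow> (\<integral>s. f s \<partial>\<mu>))"

text \<open>delta_xi convolved with nu_1, ..., nu_k (classical convolution on T^d = image of the
  product measure under componentwise multiplication).\<close>
definition conv_T :: "complex ^ 'd \<Rightarrow> (nat \<Rightarrow> (complex ^ 'd) measure) \<Rightarrow> nat \<Rightarrow> (complex ^ 'd) measure" where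
  "conv_T \<xi> \<nu> k = distr (PiM {1..k} \<nu>) Tb (\<lambda>\<omega>. \<xi> * (\<Prod>i\<in>{1..k}. \<omega> i))"

definition U_T :: "real \<Rightarrow> (complex ^ 'd) set" where
  "U_T \<epsilon> = {s \<in> torus. norm (argv s) < \<epsilon>}"

definition infinitesimal_T :: "(nat \<Rightarrow> nat \<Rightarrow> (complex ^ 'd) measure) \<Rightarrow> (nat \<Rightarrow> nat) \<Rightarrow> bool" where
  "infinitesimal_T \<nu> kn \<longleftrightarrow> strict_mono kn \<and>
     (\<forall>n. \<forall>k\<in>{1..kn n}. prob_T (\<nu> n k)) \<and>
     (\<forall>\<epsilon>>0. (\<lambda>n. Max ((\<lambda>k. measure (\<nu> n k) {s \<in> torus. norm (argv s) \<ge> \<epsilon>}) ` {1..kn n}))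
               \<longlonglongrightarrow> 0)"

definition bvec :: "real \<Rightarrow> (complex ^ 'd) measure \<Rightarrow> complex ^ 'd" where
  "bvec \<theta> \<nu> = (\<chi> j. cis (\<integral>s. indicator (U_T \<theta>) s * Arg (s $ j) \<partial>\<nu>))"

text \<open>d nu_ring(s) = d nu(b s), i.e. nu_ring(B) = nu(b B): image of nu under s |-> b^{-1} s.\<close>
definition centered :: "real \<Rightarrow> (complex ^ 'd) measure \<Rightarrow> (complex ^ 'd) measure" where
  "centered \<theta> \<nu> = distr \<nu> Tb (\<lambda>s. \<chi> j. s $ j / bvec \<theta> \<nu> $ j)"

definition rho_n :: "real \<Rightarrow> (nat \<Rightarrow> nat \<Rightarrow> (complex ^ 'd) measure) \<Rightarrow> (nat \<Rightarrow> nat) \<Rightarrow> nat \<Rightarrow> (complex ^ 'd) measure" where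
  "rho_n \<theta> \<nu> kn n = measure_of torus (sets Tb)
      (\<lambda>B. \<Sum>k\<in>{1..kn n}. emeasure (centered \<theta> (\<nu> n k)) B)"

definition gamma_n :: "real \<Rightarrow> (nat \<Rightarrow> nat \<Rightarrow> (complex ^ 'd) measure) \<Rightarrow> (nat \<Rightarrow> nat) \<Rightarrow> (nat \<Rightarrow> complex ^ 'd) \<Rightarrow> nat \<Rightarrow> complex ^ 'd" where
  "gamma_n \<theta> \<nu> kn \<xi> n = (\<chi> j. \<xi> n $ j * cis (\<Sum>k\<in>{1..kn n}.
       Arg (bvec \<theta> (\<nu> n k) $ j) + (\<integral>s. Im (s $ j) \<partial>(centered \<theta> (\<nu> n k)))))"

definition Mtilde :: "(complex ^ 'd) measure set" where
  "Mtilde = {\<tau>. sets \<tau> = sets Tb \<and> emeasure \<tau> {ones} = 0 \<and>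
      (\<forall>B\<in>sets Tb. (\<exists>\<delta>>0. \<forall>s\<in>B. \<delta> \<le> dist s ones) \<longrightarrow> emeasure \<tau> B < \<infinity>)}"

definition Mtilde_conv :: "(nat \<Rightarrow> (complex ^ 'd) measure) \<Rightarrow> (complex ^ 'd) measure \<Rightarrow> bool" where
  "Mtilde_conv \<tau>s \<tau> \<longleftrightarrow> (\<forall>f :: complex ^ 'd \<Rightarrow> real.
      continuous_on torus f \<and> bounded (f ` torus) \<and>
      (\<exists>\<delta>>0. \<forall>s\<in>torus. dist s ones < \<delta> \<longrightarrow> f s = 0) \<longrightarrow>
      (\<lambda>n. \<integral>s. f s \<partial>(\<tau>s n)) \<longlonglongrightarrow> (\<integral>s. f s \<partial>\<tau>))"

text \<open>Relative compactness of a sequence in the (metrizable) space M-tilde: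
  every subsequence has a further subsequence converging in M-tilde.\<close>
definition Mtilde_rel_compact :: "(nat \<Rightarrow> (complex ^ 'd) measure) \<Rightarrow> bool" where
  "Mtilde_rel_compact \<tau>s \<longleftrightarrow> (\<forall>r :: nat \<Rightarrow> nat. strict_mono r \<longrightarrow>
      (\<exists>(r' :: nat \<Rightarrow> nat) \<tau>. strict_mono r' \<and> \<tau> \<in> Mtilde \<and> Mtilde_conv (\<tau>s \<circ> r \<circ> r') \<tau>))"

definition Mtilde_limit_points :: "(nat \<Rightarrow> (complex ^ 'd) measure) \<Rightarrow> (complex ^ 'd) measure set" where
  "Mtilde_limit_points \<tau>s = {\<tau> \<in> Mtilde. \<exists>r :: nat \<Rightarrow> nat. strict_mono r \<and> Mtilde_conv (\<tau>s \<circ> r) \<tau>}"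

end

theory Submission
  imports Defs
begin

text \<open>
  Centering by truncated means bounds the first moments of the array by the integrals of
  \<open>qT s = (\<Sum>j. 1 - Re s\<^sub>j)\<close>, so that as soon as \<open>\<integral> qT\<close> over \<open>\<rho>\<^sub>n\<close> stays bounded the
  convolutions have the same characteristic-function limits as the accompanying laws with triplet
  \<open>(\<gamma>\<^sub>n, 0, \<rho>\<^sub>n)\<close>. For sufficiency one splits the Levy exponent of \<open>\<rho>\<^sub>n\<close> with a cutoff at the
  neutral element, the inner part being a quadratic form up to third order, and passes to
  subsequences. For necessity, the nonvanishing of the limit at the coordinate characters bounds
  \<open>\<integral> qT\<close>; at these characters the integrand of the Levy exponent is real, which isolates
  \<open>\<gamma>\<^sub>n\<close>; and the moduli determine the limits of the integrals of \<open>1 - Re s\<^sup>p\<close>, whose second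
  differences in \<open>p\<close> are the integrals of \<open>Re s\<^sup>p Im s\<^sub>j Im s\<^sub>l\<close>, so the Gaussian condition
  follows by approximating even cutoff functions by trigonometric polynomials.
\<close>

section \<open>The torus\<close>

text \<open>Characters are indexed by the discrete group Z^d, so no continuous branch of the
  logarithm is available and a Levy exponent is known only modulo \<open>2 * pi * \<i>\<close>.
  Hence different subsequences of \<open>rho_n\<close> may have different limit points, all in
  \<open>levy_class\<close>. Necessity therefore extracts only what is free of this ambiguity:
  moduli, and the directions of the values at coordinate characters, where s_j - 1 - i Im s_j = Re
  s_j - 1. Moduli see only integrals of even functions, so the cutoff must be invariant under
  conjugation. It is built from \<open>qT\<close>, because the angle jumps at -1; comparing it with
  \<open>U_T\<close> costs a factor 5 in the radius, harmless in an iterated limit. The masses of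
  \<open>rho_n\<close> near \<open>ones\<close> may be unbounded, so everything there is measured in
  units of \<open>qT\<close>, half the squared distance to \<open>ones\<close>. The products Im s_j
  Im s_l are of that order, so a uniform error in a test function that multiplies them costs only a
  multiple of the bounded integral of \<open>qT\<close>.\<close>

lemma torusD: "s \<in> torus \<Longrightarrow> cmod (s $ j) = 1"
  by (simp add: torus_def)

lemma ones_in_torus [simp]: "ones \<in> torus"
  by (simp add: torus_def ones_def)

lemma ones_nth [simp]: "ones $ j = 1"
  by (simp add: ones_def)

lemma torus_mult: "s \<in> torus \<Longrightarrow> t \<in> torus \<Longrightarrow> s * t \<in> torus"
  by (simp add: torus_def norm_mult)

lemma torus_prod: "(\<And>i. i \<in> I \<Longrightarrow> f i \<in> torus) \<Longrightarrow> (\<Prod>i\<in>I. f i) \<in> torus"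
proof (induction I rule: infinite_finite_induct)
  case (insert x F)
  then show ?case by (simp add: torus_mult)
qed (simp_all add: torus_def)

lemma closed_torus: "closed (torus :: (complex ^ 'd) set)"
proof -
  have "torus = (\<Inter>j. {s :: complex ^ 'd. cmod (s $ j) = 1})"
    by (auto simp: torus_def)
  moreover have "closed (\<Inter>j. {s :: complex ^ 'd. cmod (s $ j) = 1})"
    by (intro closed_INT ballI closed_Collect_eq continuous_intros)
  ultimately show ?thesis by simp
qed

lemma compact_torus: "compact (torus :: (complex ^ 'd) set)"
proof -
  have "bounded (torus :: (complex ^ 'd) set)"
    unfolding bounded_iff
  proof (intro exI ballI)
    fix s :: "complex ^ 'd" assume s: "s \<in> torus"
    have "norm s \<le> (\<Sum>j\<in>UNIV. norm (s $ j))"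
      by (simp add: norm_vec_def L2_set_le_sum)
    then show "norm s \<le> real CARD('d)"
      using s by (simp add: torus_def)
  qed
  then show ?thesis
    using closed_torus compact_eq_bounded_closed by blast
qed

lemma space_Tb [simp]: "space Tb = torus"
  by (simp add: Tb_def space_restrict_space)

lemma sets_Tb_iff: "B \<in> sets Tb \<longleftrightarrow> B \<in> sets borel \<and> B \<subseteq> torus"
proof -
  have "torus \<inter> space borel \<in> sets (borel :: (complex ^ 'a) measure)"
    using borel_closed[OF closed_torus] by auto
  then show ?thesis
    unfolding Tb_def by (subst sets_restrict_space_iff) auto
qed

lemma space_T: "sets M = sets Tb \<Longrightarrow> space M = torus"
  using sets_eq_imp_space_eq[of M Tb] by simp

lemma measurable_T: "sets M = sets Tb \<Longrightarrow> f \<in> measurable Tb N \<Longrightarrow> f \<in> measurable M N"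
  using measurable_cong_sets[of M Tb N N] by simp

lemma borel_measurable_Tb:
  "continuous_on torus f \<Longrightarrow> f \<in> borel_measurable Tb"
  unfolding Tb_def by (rule borel_measurable_continuous_on_restrict)

lemma borel_measurable_T:
  "sets M = sets Tb \<Longrightarrow> continuous_on torus f \<Longrightarrow> f \<in> borel_measurable M"
  by (rule measurable_T[OF _ borel_measurable_Tb])

lemma singleton_Tb [simp]: "s \<in> torus \<Longrightarrow> {s} \<in> sets Tb"
  by (simp add: sets_Tb_iff)

lemma integral_T_cong:
  assumes "sets M = sets Tb" "\<And>s. s \<in> torus \<Longrightarrow> f s = g s"
  shows "(\<integral>s. f s \<partial>M) = (\<integral>s. g s \<partial>M)"
  using assms by (intro Bochner_Integration.integral_cong) (auto simp: space_T)

lemma prob_T_sets: "prob_T \<nu> \<Longrightarrow> sets \<nu> = sets Tb"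
  and prob_T_prob: "prob_T \<nu> \<Longrightarrow> prob_space \<nu>"
  and prob_T_finite: "prob_T \<nu> \<Longrightarrow> finite_measure \<nu>"
  unfolding prob_T_def using prob_space.finite_measure by blast+

lemma continuous_on_torus_bounded:
  fixes f :: "complex ^ 'd \<Rightarrow> 'b::real_normed_vector"
  assumes "continuous_on torus f"
  obtains B where "B > 0" "\<And>s. s \<in> torus \<Longrightarrow> norm (f s) \<le> B"
proof -
  have "bounded (f ` torus)"
    using assms compact_torus by (intro compact_imp_bounded compact_continuous_image)
  then show ?thesis
    using that by (auto simp: bounded_pos)
qed

lemma integrable_T_bounded:
  fixes f :: "complex ^ 'd \<Rightarrow> 'b::{banach, second_countable_topology}"
  assumes "finite_measure M" "sets M = sets Tb" "f \<in> borel_measurable Tb"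
    and "\<And>s. s \<in> torus \<Longrightarrow> norm (f s) \<le> B"
  shows "integrable M f"
  using assms(4) measurable_T[OF assms(2,3)]
  by (intro finite_measure.integrable_const_bound[OF assms(1), of f B]) (auto simp: space_T[OF assms(2)])

lemma integrable_T_continuous:
  fixes f :: "complex ^ 'd \<Rightarrow> 'b::{banach, second_countable_topology}"
  assumes "finite_measure M" "sets M = sets Tb" "continuous_on torus f"
  shows "integrable M f"
proof -
  obtain B where "B > 0" "\<And>s. s \<in> torus \<Longrightarrow> norm (f s) \<le> B"
    using continuous_on_torus_bounded[OF assms(3)] by blast
  then show ?thesis
    using assms borel_measurable_Tb by (intro integrable_T_bounded[where B = B]) auto
qed

section \<open>Characters\<close>

lemma cis_Arg_torus: "s \<in> torus \<Longrightarrow> cis (Arg (s $ j)) = s $ j"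
  using cis_Arg[of "s $ j"] torusD[of s j] by (cases "s $ j = 0") (auto simp: sgn_eq)

lemma monom_T_cis:
  assumes "s \<in> torus"
  shows "monom_T s p = cis (ivec p \<bullet> argv s)"
proof -
  have *: "s $ j = cis (Arg (s $ j))" for j
    by (simp add: cis_Arg_torus assms)
  have "(s $ j) powi (p $ j) = cis (real_of_int (p $ j) * Arg (s $ j))" for j
    using *[of j] cis_power_int[of "Arg (s $ j)" "p $ j"] by simp
  then have "monom_T s p = (\<Prod>j\<in>UNIV. cis (real_of_int (p $ j) * Arg (s $ j)))"
    by (simp add: monom_T_def)
  also have "\<dots> = cis (\<Sum>j\<in>UNIV. real_of_int (p $ j) * Arg (s $ j))"
    by (simp add: cis_conv_exp sum_distrib_left exp_sum)
  finally show ?thesis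
    by (simp add: inner_vec_def ivec_def argv_def)
qed

lemma norm_monom_T: "s \<in> torus \<Longrightarrow> cmod (monom_T s p) = 1"
  by (simp add: monom_T_cis)

lemma monom_T_0 [simp]: "monom_T s 0 = 1"
  by (simp add: monom_T_def)

lemma monom_T_ones [simp]: "monom_T ones p = 1"
  by (simp add: monom_T_def)

lemma monom_T_axis [simp]: "monom_T s (axis j 1) = s $ j"
proof -
  have "monom_T s (axis j 1) = (\<Prod>i\<in>UNIV. if i = j then s $ j else 1)"
    unfolding monom_T_def by (rule prod.cong) (auto simp: axis_def)
  then show ?thesis by simp
qed

lemma ivec_add: "ivec (p + q) = ivec p + ivec q"
  and ivec_diff: "ivec (p - q) = ivec p - ivec q"
  and ivec_minus: "ivec (- p) = - ivec p"
  and ivec_axis: "ivec (axis j 1) = axis j 1"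
  by (simp_all add: ivec_def vec_eq_iff axis_def)

lemma monom_T_add: "s \<in> torus \<Longrightarrow> monom_T s (p + q) = monom_T s p * monom_T s q"
  by (simp add: monom_T_cis ivec_add inner_add_left cis_mult)

lemma monom_T_minus: "s \<in> torus \<Longrightarrow> monom_T s (- p) = cnj (monom_T s p)"
  by (simp add: monom_T_cis ivec_minus cis_cnj)

lemma monom_T_diff: "s \<in> torus \<Longrightarrow> monom_T s (p - q) = monom_T s p * cnj (monom_T s q)"
  using monom_T_add[of s p "- q"] by (simp add: monom_T_minus)

lemma monom_T_mult: "monom_T (s * t) p = monom_T s p * monom_T t p"
  by (simp add: monom_T_def power_int_mult_distrib prod.distrib)

lemma monom_T_prod: "monom_T (\<Prod>i\<in>I. f i) p = (\<Prod>i\<in>I. monom_T (f i) p)"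
proof (induction I rule: infinite_finite_induct)
  case (insert x F)
  then show ?case by (simp add: monom_T_mult)
qed (simp_all add: monom_T_def)

lemma continuous_on_monom_T: "continuous_on torus (\<lambda>s. monom_T s p)"
proof -
  have "s $ j \<noteq> 0" if "s \<in> torus" for s :: "complex ^ 'a" and j
    using torusD[OF that, of j] by auto
  then show ?thesis
    unfolding monom_T_def by (intro continuous_intros) auto
qed

lemma Re_mult_Re: "Re z * Re w = Re (z * w) / 2 + Re (cnj z * w) / 2"
  by (simp add: field_simps)

section \<open>Density of trigonometric polynomials\<close>

text \<open>Equality is asked on the torus only, where the exponent laws for \<open>monom_T\<close>
  hold. Products are a derived closure property rather than a constructor, so an induction over
  \<open>trig\<close> has only linear cases, which pass through integrals.\<close>

inductive trig :: "(complex ^ 'd \<Rightarrow> real) \<Rightarrow> bool" where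
  trig_base: "(\<And>s. s \<in> torus \<Longrightarrow> f s = Re (c * monom_T s p)) \<Longrightarrow> trig f"
| trig_add: "trig f \<Longrightarrow> trig g \<Longrightarrow> (\<And>s. s \<in> torus \<Longrightarrow> h s = f s + g s) \<Longrightarrow> trig h"

lemma trig_cong: "trig f \<Longrightarrow> (\<And>s. s \<in> torus \<Longrightarrow> g s = f s) \<Longrightarrow> trig g"
  by (rule trig_add[OF _ trig_base[where c = 0 and f = "\<lambda>_. 0"], of f]) auto

lemma trig_continuous: "trig f \<Longrightarrow> continuous_on torus f"
proof (induction rule: trig.induct)
  case (trig_base f c p)
  have "continuous_on torus (\<lambda>s. Re (c * monom_T s p))"
    by (intro continuous_intros continuous_on_monom_T)
  then show ?case
    using trig_base by (simp cong: continuous_on_cong)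
next
  case (trig_add f g h)
  have "continuous_on torus (\<lambda>s. f s + g s)"
    by (intro continuous_intros trig_add)
  then show ?case
    using trig_add by (simp cong: continuous_on_cong)
qed

lemma trig_mult_base: 
  assumes "trig g"
  shows "trig (\<lambda>s. Re (c * monom_T s p) * g s)"
  using assms
proof (induction rule: trig.induct)
  case (trig_base f c' q)
  \<comment> \<open>Product-to-sum formula: the product of frequencies p and q splits into p + q and
    q - p.\<close>
  let ?g1 = "\<lambda>s. Re ((c * c' / 2) * monom_T s (p + q))"
  let ?g2 = "\<lambda>s. Re ((cnj c * c' / 2) * monom_T s (q - p))"
  show ?case
  proof (rule trig_add)
    show "trig ?g1" "trig ?g2" by (rule trig.trig_base, rule refl)+
    fix s :: "complex ^ 'a" assume s: "s \<in> torus"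
    show "Re (c * monom_T s p) * f s = ?g1 s + ?g2 s"
      by (simp only: trig_base[OF s] Re_mult_Re monom_T_add[OF s] monom_T_diff[OF s])
        (simp add: algebra_simps)
  qed
next
  case (trig_add f g h)
  show ?case
    by (rule trig.trig_add[OF trig_add.IH]) (simp add: trig_add algebra_simps)
qed

lemma trig_mult:
  assumes "trig f" "trig g"
  shows "trig (\<lambda>s. f s * g s)"
  using assms(1)
proof (induction rule: trig.induct)
  case (trig_base f c p)
  show ?case
    by (rule trig_cong[OF trig_mult_base[OF assms(2), of c p]]) (simp add: trig_base)
next
  case (trig_add f f' h)
  show ?case
    by (rule trig.trig_add[OF trig_add.IH]) (simp add: trig_add.hyps algebra_simps)
qed

lemma trig_approx:
  assumes "continuous_on torus (f :: complex ^ 'd \<Rightarrow> real)" "0 < e"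
  shows "\<exists>g. trig g \<and> (\<forall>s\<in>torus. \<bar>f s - g s\<bar> < e)"
proof (rule Stone_Weierstrass_HOL[OF compact_torus, where P = trig])
  show "trig (\<lambda>x. c)" for c
    by (rule trig_base[where c = "of_real c" and p = 0]) simp
  show "trig f \<Longrightarrow> continuous_on torus f" for f :: "complex ^ 'd \<Rightarrow> real"
    by (rule trig_continuous)
  show "trig f \<and> trig g \<Longrightarrow> trig (\<lambda>x. f x + g x)" for f g :: "complex ^ 'd \<Rightarrow> real"
    by (blast intro: trig_add)
  show "trig f \<and> trig g \<Longrightarrow> trig (\<lambda>x. f x * g x)" for f g :: "complex ^ 'd \<Rightarrow> real"
    by (blast intro: trig_mult)
  fix x y :: "complex ^ 'd" assume "x \<in> torus \<and> y \<in> torus \<and> x \<noteq> y"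
  then obtain j where j: "x $ j \<noteq> y $ j" by (auto simp: vec_eq_iff)
  \<comment> \<open>The second function is \<open>Im (s $ j)\<close>, since
    \<open>- \<i> * z\<close> has real part \<open>Im z\<close>; together the two see the whole
    coordinate.\<close>
  have "trig (\<lambda>s. Re (1 * monom_T s (axis j 1)))" "trig (\<lambda>s. Re (- \<i> * monom_T s (axis j 1)))"
    by (rule trig_base, rule refl)+
  moreover have "Re (x $ j) \<noteq> Re (y $ j) \<or> Im (x $ j) \<noteq> Im (y $ j)"
    using j by (auto simp: complex_eq_iff)
  ultimately show "\<exists>f. trig f \<and> f x \<noteq> f y"
    by (auto intro: exI[of _ "\<lambda>s. Re (1 * monom_T s (axis j 1))"] exI[of _ "\<lambda>s. Re (- \<i> * monom_T s (axis j 1))"])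
qed (use assms in auto)

text \<open>The three-epsilon argument in the form needed for approximation: comparison sequence and
  comparison limit may both depend on e.\<close>

lemma tendsto_approx:
  fixes In :: "nat \<Rightarrow> 'a::real_normed_vector"
  assumes "\<And>e. e > 0 \<Longrightarrow> \<exists>J Jn. Jn \<longlonglongrightarrow> J \<and> (\<forall>\<^sub>F n in sequentially. norm (In n - Jn n) \<le> e) \<and> norm (I - J) \<le> e"
  shows "In \<longlonglongrightarrow> I"
proof (rule tendstoI)
  fix e :: real assume e: "e > 0"
  then have "e / 4 > 0" by simp
  from assms[OF this] obtain J Jn where J: "Jn \<longlonglongrightarrow> J"
      "\<forall>\<^sub>F n in sequentially. norm (In n - Jn n) \<le> e / 4" "norm (I - J) \<le> e / 4" by blast
  have "\<forall>\<^sub>F n in sequentially. dist (Jn n) J < e / 4"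
    using J(1) e by (intro tendstoD) auto
  with J(2) show "\<forall>\<^sub>F n in sequentially. dist (In n) I < e"
  proof eventually_elim
    case (elim n)
    have "dist (In n) I \<le> dist (In n) (Jn n) + dist (Jn n) J + dist J I"
      using dist_triangle[of "In n" I "Jn n"] dist_triangle[of "Jn n" I J] by linarith
    moreover have "dist J I \<le> e / 4" using J(3) by (simp add: dist_norm norm_minus_commute)
    moreover have "dist (In n) (Jn n) \<le> e / 4" using elim by (simp add: dist_norm)
    ultimately show ?case using elim e by linarith
  qed
qed

lemma tendsto_integral_trig:
  assumes "trig g"
    and "\<And>p. (\<lambda>n. charT (\<mu>s n) p) \<longlonglongrightarrow> charT \<mu> p"
    and ps: "\<And>n. prob_T (\<mu>s n)" and p: "prob_T \<mu>"
  shows "(\<lambda>n. \<integral>s. g s \<partial>\<mu>s n) \<longlonglongrightarrow> (\<integral>s. g s \<partial>\<mu>)"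
  using assms(1)
proof (induction rule: trig.induct)
  case (trig_base f c p)
  have *: "(\<integral>s. f s \<partial>M) = Re (c * charT M p)" if "prob_T M" for M
  proof -
    have M: "sets M = sets Tb" "finite_measure M"
      using that by (rule prob_T_sets, rule prob_T_finite)
    have i: "integrable M (\<lambda>s. monom_T s p)"
      by (rule integrable_T_continuous[OF M(2,1) continuous_on_monom_T])
    have "(\<integral>s. f s \<partial>M) = (\<integral>s. Re (c * monom_T s p) \<partial>M)"
      using trig_base M by (intro integral_T_cong) auto
    also have "\<dots> = Re (\<integral>s. c * monom_T s p \<partial>M)"
      by (rule integral_Re) (use i in auto)
    finally show ?thesis by (simp add: charT_def)
  qed
  show ?case
    unfolding *[OF ps] *[OF p] by (intro tendsto_intros assms)
next
  case (trig_add f g h)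
  have *: "(\<integral>s. h s \<partial>M) = (\<integral>s. f s \<partial>M) + (\<integral>s. g s \<partial>M)" if "prob_T M" for M
  proof -
    have M: "sets M = sets Tb" "finite_measure M"
      using that by (rule prob_T_sets, rule prob_T_finite)
    have i: "integrable M f" "integrable M g"
      using trig_add trig_continuous by (auto intro!: integrable_T_continuous M)
    have "(\<integral>s. h s \<partial>M) = (\<integral>s. f s + g s \<partial>M)"
      using trig_add M by (intro integral_T_cong) auto
    then show ?thesis using i by simp
  qed
  show ?case
    unfolding *[OF ps] *[OF p] by (intro tendsto_intros trig_add)
qed

lemma prob_T_integral_diff_le:
  fixes f g :: "complex ^ 'd \<Rightarrow> real"
  assumes "prob_T M" "continuous_on torus f" "continuous_on torus g"
    "\<And>s. s \<in> torus \<Longrightarrow> \<bar>f s - g s\<bar> \<le> e"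
  shows "\<bar>(\<integral>s. f s \<partial>M) - (\<integral>s. g s \<partial>M)\<bar> \<le> e"
proof -
  interpret prob_space M using assms(1) by (rule prob_T_prob)
  have M: "sets M = sets Tb" "finite_measure M"
    using assms(1) by (rule prob_T_sets, rule prob_T_finite)
  have i: "integrable M f" "integrable M g"
    using assms by (auto intro!: integrable_T_continuous M)
  have "\<bar>(\<integral>s. f s \<partial>M) - (\<integral>s. g s \<partial>M)\<bar> = \<bar>\<integral>s. f s - g s \<partial>M\<bar>"
    using i by simp
  also have "\<dots> \<le> (\<integral>s. \<bar>f s - g s\<bar> \<partial>M)"
    by (rule integral_abs_bound)
  also have "\<dots> \<le> (\<integral>s. e \<partial>M)"
    using i assms(4) by (intro integral_mono) (auto simp: space_T[OF M(1)])
  finally show ?thesis by (simp add: prob_space)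
qed

section \<open>Weak convergence and uniqueness through characteristic functions\<close>

text \<open>One trigonometric polynomial uniformly close to f serves all n at once, since every
  measure involved has mass 1. Compactness of the torus takes the place of tightness.\<close>

lemma weak_conv_T_of_charT:
  assumes "\<And>p. (\<lambda>n. charT (\<mu>s n) p) \<longlonglongrightarrow> charT \<mu> p"
    and ps: "\<And>n. prob_T (\<mu>s n)" and p: "prob_T \<mu>"
  shows "weak_conv_T \<mu>s \<mu>"
  unfolding weak_conv_T_def
proof (intro allI impI)
  fix f :: "complex ^ 'a \<Rightarrow> real" assume f: "continuous_on torus f"
  show "(\<lambda>n. \<integral>s. f s \<partial>\<mu>s n) \<longlonglongrightarrow> (\<integral>s. f s \<partial>\<mu>)"
  proof (rule tendsto_approx)
    fix e :: real assume e: "0 < e"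
    then obtain g where g: "trig g" "\<forall>s\<in>torus. \<bar>f s - g s\<bar> < e"
      using trig_approx[OF f] by blast
    then have "\<bar>(\<integral>s. f s \<partial>M) - (\<integral>s. g s \<partial>M)\<bar> \<le> e" if "prob_T M" for M
      using prob_T_integral_diff_le[OF that f trig_continuous[OF g(1)]] by force
    with tendsto_integral_trig[OF g(1) assms]
    show "\<exists>J Jn. Jn \<longlonglongrightarrow> J \<and> (\<forall>\<^sub>F n in sequentially. norm ((\<integral>s. f s \<partial>\<mu>s n) - Jn n) \<le> e) \<and>
       norm ((\<integral>s. f s \<partial>\<mu>) - J) \<le> e"
      using ps p by (intro exI conjI always_eventually allI) auto
  qed
qed

lemma charT_of_weak_conv_T:
  assumes "weak_conv_T \<mu>s \<mu>"
    and ps: "\<And>n. prob_T (\<mu>s n)" and p: "prob_T \<mu>"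
  shows "(\<lambda>n. charT (\<mu>s n) q) \<longlonglongrightarrow> charT \<mu> q"
proof -
  have *: "charT M q = Complex (\<integral>s. Re (monom_T s q) \<partial>M) (\<integral>s. Im (monom_T s q) \<partial>M)" if "prob_T M" for M
  proof -
    have M: "sets M = sets Tb" "finite_measure M"
      using that by (rule prob_T_sets, rule prob_T_finite)
    have i: "integrable M (\<lambda>s. monom_T s q)"
      by (rule integrable_T_continuous[OF M(2,1) continuous_on_monom_T])
    then show ?thesis
      by (simp add: charT_def complex_eq_iff)
  qed
  have "(\<lambda>n. \<integral>s. Re (monom_T s q) \<partial>\<mu>s n) \<longlonglongrightarrow> (\<integral>s. Re (monom_T s q) \<partial>\<mu>)"
    "(\<lambda>n. \<integral>s. Im (monom_T s q) \<partial>\<mu>s n) \<longlonglongrightarrow> (\<integral>s. Im (monom_T s q) \<partial>\<mu>)"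
    using assms(1) unfolding weak_conv_T_def
    by (auto intro!: continuous_intros continuous_on_monom_T)
  then show ?thesis
    unfolding *[OF ps] *[OF p] by (intro tendsto_Complex)
qed

text \<open>Closed sets form an intersection-stable generator of the Borel sets, and the indicator
  of a closed set is the bounded limit of the continuous functions \<open>f n\<close>.\<close>

lemma measure_eqI_continuous:
  assumes M: "prob_T M" and N: "prob_T (N :: (complex ^ 'd) measure)"
    and eq: "\<And>f :: complex ^ 'd \<Rightarrow> real. continuous_on torus f \<Longrightarrow> (\<integral>s. f s \<partial>M) = (\<integral>s. f s \<partial>N)"
  shows "M = N"
proof -
  have meas: "(\<lambda>s. s) \<in> measurable L borel" if "prob_T L" for L :: "(complex ^ 'd) measure"
    using that by (intro borel_measurable_T[OF prob_T_sets] continuous_intros)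
  have closed_eq: "emeasure M (C \<inter> torus) = emeasure N (C \<inter> torus)" if C: "closed C" for C
  \<comment> \<open>The empty set is treated apart, as \<open>infdist\<close> to it is 0 by
    convention.\<close>
  proof (cases "C = {}")
    case False
    define f where "f n s = max 0 (1 - real n * infdist s C)" for n and s :: "complex ^ 'd"
    have cf: "continuous_on torus (f n)" for n
      unfolding f_def by (intro continuous_intros)
    have lim: "(\<lambda>n. f n s) \<longlonglongrightarrow> indicator C s" for s
    proof (cases "s \<in> C")
      case True
      then show ?thesis by (simp add: f_def)
    next
      case nC: False
      then have pos: "infdist s C > 0"
        using C False by (simp add: infdist_pos_not_in_closed)
      obtain N where N: "real N * infdist s C > 1"
        using reals_Archimedean3[OF pos] by blast
      have "f n s = 0" if "n \<ge> N" for n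
      proof -
        have "real N * infdist s C \<le> real n * infdist s C"
          using that pos by (intro mult_right_mono) auto
        then show ?thesis using N by (simp add: f_def)
      qed
      then have "\<forall>\<^sub>F n in sequentially. f n s = indicator C s"
        using nC by (auto simp: eventually_sequentially)
      then show ?thesis by (rule tendsto_eventually)
    qed
    have *: "(\<lambda>n. \<integral>s. f n s \<partial>L) \<longlonglongrightarrow> measure L (C \<inter> torus)" if L: "prob_T L" for L
    proof -
      interpret prob_space L using L by (rule prob_T_prob)
      have sL: "sets L = sets Tb" using L by (rule prob_T_sets)
      have "(\<lambda>n. \<integral>s. f n s \<partial>L) \<longlonglongrightarrow> (\<integral>s. indicator C s \<partial>L)"
      proof (rule integral_dominated_convergence[where w = "\<lambda>_. 1"])
        show "indicator C \<in> borel_measurable L"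
          using measurable_compose[OF meas[OF L] borel_measurable_indicator[OF borel_closed[OF C]]] by simp
        show "f n \<in> borel_measurable L" for n
          by (rule borel_measurable_T[OF sL cf])
        show "AE x in L. (\<lambda>n. f n x) \<longlonglongrightarrow> indicator C x" using lim by simp
        show "AE x in L. norm (f n x) \<le> 1" for n
          by (simp add: f_def infdist_nonneg)
      qed simp
      then show ?thesis
        using C by (simp add: space_T[OF sL])
    qed
    have "measure M (C \<inter> torus) = measure N (C \<inter> torus)"
      using LIMSEQ_unique[OF *[OF M]] *[OF N] eq[OF cf] by simp
    then show ?thesis
      using prob_T_finite[OF M] prob_T_finite[OF N] by (simp add: finite_measure.emeasure_eq_measure)
  qed simp
  \<comment> \<open>Pushed forward to the whole space, the measures can be compared on a generator
    over \<open>UNIV\<close>; the sets of \<open>Tb\<close> come back as traces on the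
    torus.\<close>
  have e: "emeasure (distr L borel (\<lambda>s. s)) B = emeasure L (B \<inter> torus)" if "prob_T L" "B \<in> sets borel" for L :: "(complex ^ 'd) measure" and B
    using emeasure_distr[OF meas[OF that(1)] that(2)] space_T[OF prob_T_sets[OF that(1)]] by simp
  have "distr M borel (\<lambda>s. s) = distr N borel (\<lambda>s. s)"
  proof (rule measure_eqI_generator_eq[where E = "Collect closed" and \<Omega> = UNIV and A = "\<lambda>_. UNIV"])
    show "emeasure (distr M borel (\<lambda>s. s)) X = emeasure (distr N borel (\<lambda>s. s)) X" if "X \<in> Collect closed" for X
      using that by (simp add: e M N closed_eq)
    show "emeasure (distr M borel (\<lambda>s. s)) UNIV \<noteq> \<infinity>"
      using prob_T_finite[OF M] by (simp add: e[OF M] finite_measure.emeasure_eq_measure)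
    show "sets (distr M borel (\<lambda>s. s)) = sigma_sets UNIV (Collect closed)"
      "sets (distr N borel (\<lambda>s. s)) = sigma_sets UNIV (Collect closed)"
      by (simp_all add: borel_eq_closed)
  qed (auto simp: Int_stable_def)
  then have "emeasure M (B \<inter> torus) = emeasure N (B \<inter> torus)" if "B \<in> sets borel" for B
    using e[OF M that] e[OF N that] by metis
  then show ?thesis
    using prob_T_sets[OF M] prob_T_sets[OF N]
    by (intro measure_eqI) (metis, metis sets_Tb_iff Int_absorb2)
qed

text \<open>Uniqueness is the continuity criterion applied to the constant sequence \<open>M\<close>
  with limit \<open>N\<close>.\<close>

lemma charT_inj:
  assumes "prob_T M" "prob_T N" "\<And>p. charT M p = charT N p"
  shows "M = N"
proof (rule measure_eqI_continuous[OF assms(1,2)])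
  fix f :: "complex ^ 'a \<Rightarrow> real" assume f: "continuous_on torus f"
  have "weak_conv_T (\<lambda>_. M) N"
    using assms by (intro weak_conv_T_of_charT) auto
  then show "(\<integral>s. f s \<partial>M) = (\<integral>s. f s \<partial>N)"
    using f LIMSEQ_unique[OF tendsto_const] by (fastforce simp: weak_conv_T_def)
qed

section \<open>Compactness of the probability measures on the torus\<close>

lemma borel_measurable_Arg [measurable]: "Arg \<in> borel_measurable borel"
proof -
  \<comment> \<open>\<open>Arg\<close> is continuous off the nonpositive reals and constantly pi on
    the negative ones; its value 0 at the origin is patched in afterwards.\<close>
  define f where "f z = (if z \<in> - \<real>\<^sub>\<le>\<^sub>0 then Arg z else pi)" for z
  have [measurable]: "f \<in> borel_measurable borel"
    unfolding f_def
    by (rule borel_measurable_continuous_on_if)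
      (auto intro!: continuous_at_imp_continuous_on continuous_at_Arg)
  have *: "Arg = (\<lambda>z. if z = 0 then 0 else f z)"
  proof
    fix z show "Arg z = (if z = 0 then 0 else f z)"
      using Arg_eq_pi[of z]
      by (cases "z = 0") (simp_all add: Arg_zero, auto simp: f_def complex_nonpos_Reals_iff complex_eq_iff)
  qed
  show ?thesis by (subst *) measurable
qed

lemma borel_measurable_nth [measurable]: "(\<lambda>s :: complex ^ 'd. s $ j) \<in> borel_measurable borel"
  by (intro borel_measurable_continuous_onI continuous_intros)

section \<open>Schoenberg's space-filling curve\<close>

text \<open>Digits written as differences of floors are visibly Borel in y, and they make the
  expansion telescope: its partial sums are
  \<open>\<lfloor>2 ^ k * y\<rfloor> / 2 ^ k\<close>.\<close>

lemma binary_digits_sums: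
  fixes y :: real
  assumes "0 \<le> y" "y < 1"
  defines "b \<equiv> \<lambda>k. real_of_int (\<lfloor>2 ^ Suc k * y\<rfloor> - 2 * \<lfloor>2 ^ k * y\<rfloor>)"
  shows "(\<lambda>k. b k / 2 ^ Suc k) sums y" and "b k \<in> {0, 1}"
proof -
  define F where "F k = real_of_int \<lfloor>2 ^ k * y\<rfloor> / 2 ^ k" for k
  have "(\<lambda>k. F (Suc k) - F k) sums (y - F 0)"
  proof (rule telescope_sums)
    have "F k \<le> y" for k
      by (simp add: F_def field_split_simps mult.commute)
    moreover have "y - (1/2) ^ k \<le> F k" for k
    proof -
      have "2 ^ k * y - 1 \<le> real_of_int \<lfloor>2 ^ k * y\<rfloor>" by linarith
      then have "(2 ^ k * y - 1) / 2 ^ k \<le> F k"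
        unfolding F_def by (rule divide_right_mono) simp
      then show ?thesis by (simp add: field_simps power_one_over)
    qed
    moreover have "(\<lambda>k. y - (1/2) ^ k) \<longlonglongrightarrow> y - 0"
      by (intro tendsto_intros LIMSEQ_power_zero) simp
    ultimately show "F \<longlonglongrightarrow> y"
      by (intro tendsto_sandwich[of "\<lambda>k. y - (1/2) ^ k" F sequentially "\<lambda>_. y"]) auto
  qed
  moreover have "F 0 = 0"
    using assms floor_unique[of 0 y] by (simp add: F_def)
  moreover have "F (Suc k) - F k = b k / 2 ^ Suc k" for k
    by (simp add: F_def b_def field_simps)
  ultimately show "(\<lambda>k. b k / 2 ^ Suc k) sums y"
    by simp
  define z where "z = 2 ^ k * y"
  have "\<lfloor>2 * z\<rfloor> = 2 * \<lfloor>z\<rfloor> \<or> \<lfloor>2 * z\<rfloor> = 2 * \<lfloor>z\<rfloor> + 1"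
    by linarith
  then show "b k \<in> {0, 1}"
    by (auto simp: b_def z_def mult.assoc)
qed

text \<open>A clipped cosine in place of Schoenberg's piecewise linear function: it has period 2,
  vanishes on [0, 1/3] and equals 1 on [2/3, 1].\<close>

definition schoenberg :: "real \<Rightarrow> real" where
  "schoenberg x = max 0 (min 1 (1 / 2 - cos (pi * x)))"

lemma continuous_schoenberg: "continuous_on UNIV schoenberg"
  unfolding schoenberg_def by (intro continuous_intros)

lemma schoenberg_bounds: "0 \<le> schoenberg x" "schoenberg x \<le> 1"
  by (auto simp: schoenberg_def)

lemma schoenberg_periodic: "schoenberg (2 * of_int n + y) = schoenberg y"
proof -
  have "cos (pi * (2 * of_int n + y)) = cos (pi * y + 2 * pi * of_int n)"
    by (simp add: algebra_simps)
  also have "\<dots> = cos (pi * y)"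
    by (simp add: cos_add cos_integer_2pi sin_integer_2pi)
  finally show ?thesis by (simp add: schoenberg_def)
qed

lemma schoenberg_digit:
  assumes "c = 0 \<or> c = 1" "0 \<le> y" "y \<le> 1 / 3"
  shows "schoenberg (2 * c / 3 + y) = c"
  using assms(1)
proof
  assume c: "c = 0"
  have "cos (pi / 3) \<le> cos (pi * y)"
    using assms by (intro cos_monotone_0_pi_le) (auto intro: mult_left_mono simp: field_simps)
  then show ?thesis by (simp add: c schoenberg_def cos_60)
next
  assume c: "c = 1"
  have "cos (pi * (2 / 3 + y)) \<le> cos (pi * (2 / 3))"
    using assms by (intro cos_monotone_0_pi_le mult_left_mono) (auto simp: field_simps)
  also have "\<dots> = - (1 / 2)"
    using cos_120 by (simp add: field_simps)
  finally show ?thesis by (simp add: c schoenberg_def)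
qed

text \<open>Scaling the series by \<open>3 ^ m\<close> turns the terms below m into even integers,
  which periodicity removes, leaves \<open>2 * c m / 3\<close> from the term m, and puts the tail
  into [0, 1/3]; so the digit \<open>c m\<close> is read off.\<close>

lemma schoenberg_cantor:
  fixes c :: "nat \<Rightarrow> real"
  assumes c: "\<And>i. c i = 0 \<or> c i = 1"
  shows "schoenberg (3 ^ m * (\<Sum>i. 2 * c i / 3 ^ Suc i)) = c m"
proof -
  let ?f = "\<lambda>i. 2 * c i / 3 ^ Suc i"
  have g: "(\<lambda>i. 2 / 3 ^ Suc (i + n)) sums (1 / 3 ^ n :: real)" for n
  proof -
    have "(\<lambda>i. (2 / 3 ^ Suc n) * (1/3) ^ i) sums ((2 / 3 ^ Suc n) * (1 / (1 - 1/3)) :: real)"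
      by (intro sums_mult geometric_sums) simp
    then show ?thesis by (simp add: power_add power_one_over field_simps)
  qed
  have c01: "0 \<le> c i" "c i \<le> 1" for i using c[of i] by auto
  have sf: "summable (\<lambda>i. ?f (i + n))" for n
  proof (rule summable_comparison_test'[OF sums_summable[OF g[of n]]])
    show "norm (?f (i + n)) \<le> 2 / 3 ^ Suc (i + n)" for i
      using c01 by (simp add: field_simps)
  qed
  define R where "R = (\<Sum>i. ?f (i + Suc m))"
  have R: "0 \<le> R" "R \<le> 1 / 3 ^ Suc m"
  proof -
    show "0 \<le> R" unfolding R_def using c01 by (intro suminf_nonneg sf) simp
    have "R \<le> (\<Sum>i. 2 / 3 ^ Suc (i + Suc m))"
      unfolding R_def using c01 by (intro suminf_le sf sums_summable[OF g]) (simp add: field_simps)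
    then show "R \<le> 1 / 3 ^ Suc m" using sums_unique[OF g[of "Suc m"]] by simp
  qed
  have "\<exists>n :: int. 3 ^ m * (\<Sum>i<m. ?f i) = 2 * of_int n"
  proof -
    have "3 ^ m * ?f i = 2 * of_int ((if c i = 0 then 0 else 1) * 3 ^ (m - Suc i))" if "i < m" for i
    proof -
      have "(3::real) ^ m = 3 ^ (m - Suc i) * 3 ^ Suc i"
        using that by (subst power_add[symmetric]) simp
      then show ?thesis using c[of i] by auto
    qed
    then have "3 ^ m * (\<Sum>i<m. ?f i) = (\<Sum>i<m. 2 * of_int ((if c i = 0 then 0 else 1) * 3 ^ (m - Suc i)))"
      by (simp add: sum_distrib_left)
    also have "\<dots> = 2 * of_int (\<Sum>i<m. (if c i = 0 then 0 else 1) * 3 ^ (m - Suc i))"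
      by (simp add: sum_distrib_left)
    finally show ?thesis by blast
  qed
  then obtain n :: int where n: "3 ^ m * (\<Sum>i<m. ?f i) = 2 * of_int n" by blast
  have "suminf ?f = R + (\<Sum>i<Suc m. ?f i)"
    using suminf_split_initial_segment[OF sf[of 0, simplified add_0_right], of "Suc m"] by (simp add: R_def)
  then have "3 ^ m * suminf ?f = 3 ^ m * (\<Sum>i<m. ?f i) + (2 * c m / 3 + 3 ^ m * R)"
    by (simp add: algebra_simps)
  then have "3 ^ m * suminf ?f = 2 * of_int n + (2 * c m / 3 + 3 ^ m * R)"
    by (simp only: n)
  moreover have "0 \<le> 3 ^ m * R" "3 ^ m * R \<le> 1 / 3"
    using R by (auto simp: field_simps)
  ultimately show ?thesis
    using c by (simp only: schoenberg_periodic schoenberg_digit)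
qed

text \<open>The coordinates of Schoenberg's space-filling curve, wound around the torus. The curve is
  surjective, and interleaving binary digits gives a Borel right inverse; this transports Helly's
  selection theorem from the line to the torus.\<close>

lemma torus_curve:
  obtains H :: "real \<Rightarrow> complex ^ 'd" and G :: "complex ^ 'd \<Rightarrow> real"
  where "continuous_on UNIV H" "\<And>t. H t \<in> torus" "G \<in> borel_measurable borel"
    "\<And>s. G s \<in> {0..1}" "\<And>s. s \<in> torus \<Longrightarrow> H (G s) = s"
proof -
  obtain idx :: "'d \<Rightarrow> nat" where idx: "inj idx"
    using finite_imp_inj_to_nat_seg[of "UNIV :: 'd set"] by auto
  \<comment> \<open>The ternary position that will carry the k-th binary digit of coordinate
    j.\<close>
  define m where "m j k = prod_encode (idx j, k)" for j k
  define x where "x j t = (\<Sum>k. schoenberg (3 ^ m j k * t) / 2 ^ Suc k)" for j t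
  define H :: "real \<Rightarrow> complex ^ 'd" where "H t = (\<chi> j. cis (2 * pi * x j t))" for t
  \<comment> \<open>The angle in turns, reduced to [0, 1) so that it has binary digits;
    \<open>cis\<close> does not see the reduction.\<close>
  define y :: "complex ^ 'd \<Rightarrow> 'd \<Rightarrow> real" where
    "y s j = frac (Arg (s $ j) / (2 * pi))" for s j
  define b where "b s j k = real_of_int (\<lfloor>2 ^ Suc k * y s j\<rfloor> - 2 * \<lfloor>2 ^ k * y s j\<rfloor>)" for s j k
  \<comment> \<open>\<open>inv idx\<close> is arbitrary outside the range of \<open>idx\<close>; the
    positions concerned still carry some digit 0 or 1, which is all that the series \<open>G\<close>
    asks of them.\<close>
  define c where "c s i = b s (inv idx (fst (prod_decode i))) (snd (prod_decode i))" for s i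
  define G where "G s = (\<Sum>i. 2 * c s i / 3 ^ Suc i)" for s
  have y01: "0 \<le> y s j" "y s j < 1" for s j
    by (auto simp: y_def frac_lt_1)
  have b: "b s j k = 0 \<or> b s j k = 1" for s j k
    using binary_digits_sums(2)[OF y01[of s j], of k] by (auto simp: b_def)
  then have c: "c s i = 0 \<or> c s i = 1" for s i
    by (auto simp: c_def)
  have c01: "0 \<le> c s i" "c s i \<le> 1" for s i using c[of s i] by auto
  have g: "(\<lambda>i. 2 / 3 ^ Suc i) sums (1 :: real)"
  proof -
    have "(\<lambda>i. (2 / 3) * (1/3) ^ i) sums ((2 / 3) * (1 / (1 - 1/3)) :: real)"
      by (intro sums_mult geometric_sums) simp
    then show ?thesis by (simp add: power_one_over field_simps)
  qed
  show thesis
  proof (rule that)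
    have xc: "continuous_on UNIV (x j)" for j
    proof -
      have "uniform_limit UNIV (\<lambda>n t. \<Sum>k<n. schoenberg (3 ^ m j k * t) / 2 ^ Suc k) (x j) sequentially"
        unfolding x_def
      proof (rule Weierstrass_m_test)
        show "norm (schoenberg (3 ^ m j k * t) / 2 ^ Suc k) \<le> (1/2) ^ Suc k" for k t
          using schoenberg_bounds by (simp add: field_simps power_one_over)
        show "summable (\<lambda>k. (1/2) ^ Suc k :: real)"
          by (simp add: summable_Suc_iff summable_geometric)
      qed
      then show ?thesis
      proof (rule uniform_limit_theorem[rotated])
        show "\<forall>\<^sub>F n in sequentially. continuous_on UNIV (\<lambda>t. \<Sum>k<n. schoenberg (3 ^ m j k * t) / 2 ^ Suc k)"
          by (intro always_eventually allI continuous_intros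
              continuous_on_compose2[OF continuous_schoenberg]) auto
      qed simp
    qed
    show "continuous_on UNIV H"
      unfolding H_def by (intro continuous_intros xc)
    show "H t \<in> torus" for t
      by (simp add: H_def torus_def)
    show "G \<in> borel_measurable borel"
      unfolding G_def c_def b_def y_def frac_def by measurable
    show "G s \<in> {0..1}" for s
    proof -
      have "summable (\<lambda>i. 2 * c s i / 3 ^ Suc i)"
      proof (rule summable_comparison_test'[OF sums_summable[OF g]])
        show "norm (2 * c s i / 3 ^ Suc i) \<le> 2 / 3 ^ Suc i" for i
          using c01 by (simp add: field_simps)
      qed
      moreover from this have "G s \<le> (\<Sum>i. 2 / 3 ^ Suc i)"
        unfolding G_def using c01
        by (intro suminf_le sums_summable[OF g]) (simp_all add: field_simps)
      ultimately show ?thesis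
        using c01 sums_unique[OF g] by (auto simp: G_def intro!: suminf_nonneg)
    qed
    show "H (G s) = s" if "s \<in> torus" for s
    proof -
      have "schoenberg (3 ^ m j k * G s) = b s j k" for j k
        using schoenberg_cantor[of "c s", OF c] idx by (simp add: G_def c_def m_def)
      then have "x j (G s) = y s j" for j
        unfolding x_def using binary_digits_sums(1)[OF y01[of s j]]
        by (auto simp: b_def intro!: sums_unique[symmetric])
      moreover have "cis (2 * pi * y s j) = s $ j" for j
      proof -
        have "cis (2 * pi * y s j) = cis (Arg (s $ j) - 2 * pi * of_int \<lfloor>Arg (s $ j) / (2 * pi)\<rfloor>)"
          by (simp add: y_def frac_def right_diff_distrib)
        also have "\<dots> = s $ j"
          using that by (simp add: cis_divide[symmetric] cis_Arg_torus)
        finally show ?thesis .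
      qed
      ultimately show ?thesis
        by (simp add: H_def vec_eq_iff)
    qed
  qed
qed

section \<open>Sequential compactness of the laws on the torus\<close>

lemma prob_T_distr:
  assumes "prob_space M" "f \<in> measurable M Tb"
  shows "prob_T (distr M Tb f)"
  unfolding prob_T_def using assms by (auto intro: prob_space.prob_space_distr)

text \<open>\<open>G\<close> is only Borel, but \<open>H \<circ> G\<close> is the identity on the
  torus, so integrating f against \<open>\<nu> n\<close> is integrating the bounded continuous
  \<open>f \<circ> H\<close> against the image law on the line. Those image laws live on [0, 1],
  hence are tight; the limit law is carried back by the continuous \<open>H\<close>.\<close>

theorem prob_T_compact:
  fixes \<nu> :: "nat \<Rightarrow> (complex ^ 'd) measure"
  assumes "\<And>n. prob_T (\<nu> n)"
  shows "\<exists>r \<mu>. strict_mono (r :: nat \<Rightarrow> nat) \<and> prob_T \<mu> \<and> weak_conv_T (\<nu> \<circ> r) \<mu>"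
proof -
  obtain H :: "real \<Rightarrow> complex ^ 'd" and G where HG: "continuous_on UNIV H" "\<And>t. H t \<in> torus"
    "G \<in> borel_measurable borel" "\<And>s. G s \<in> {0..1}" "\<And>s. s \<in> torus \<Longrightarrow> H (G s) = s"
    using torus_curve[where 'd = 'd] by metis
  define \<mu> where "\<mu> n = distr (\<nu> n) borel G" for n
  have G: "G \<in> borel_measurable (\<nu> n)" for n
    using HG(3) by (intro measurable_T[OF prob_T_sets[OF assms]]) (simp add: Tb_def measurable_restrict_space1)
  have rd: "real_distribution (\<mu> n)" for n
    unfolding \<mu>_def by (intro prob_space.real_distribution_distr prob_T_prob assms G)
  have "tight \<mu>"
    unfolding tight_def
  proof (intro conjI allI impI rd)
    fix \<epsilon> :: real assume "\<epsilon> > 0"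
    have "measure (\<mu> n) {-1<..1} = 1" for n
    proof -
      have "measure (\<mu> n) {-1<..1} = measure (\<nu> n) (G -` {-1<..1} \<inter> space (\<nu> n))"
        unfolding \<mu>_def using G by (intro measure_distr) auto
      also have "G -` {-1<..1} \<inter> space (\<nu> n) = space (\<nu> n)"
        using HG(4) by force
      finally show ?thesis
        by (simp add: prob_space.prob_space[OF prob_T_prob[OF assms]])
    qed
    then show "\<exists>a b. a < b \<and> (\<forall>n. 1 - \<epsilon> < measure (\<mu> n) {a<..b})"
      using \<open>\<epsilon> > 0\<close> by (intro exI[of _ "-1"] exI[of _ 1]) auto
  qed
  from tight_imp_convergent_subsubsequence[OF this strict_mono_id]
  obtain r M where r: "strict_mono r" "real_distribution M" "weak_conv_m (\<mu> \<circ> r) M"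
    by auto
  interpret M: real_distribution M by (rule r)
  have H: "H \<in> measurable M Tb"
    unfolding Tb_def using HG(1,2)
    by (intro measurable_restrict_space2) (auto simp: borel_measurable_continuous_onI)
  show ?thesis
  proof (intro exI conjI)
    show "strict_mono r" by (rule r)
    show "prob_T (distr M Tb H)"
      by (rule prob_T_distr[OF M.prob_space_axioms H])
    show "weak_conv_T (\<nu> \<circ> r) (distr M Tb H)"
      unfolding weak_conv_T_def
    proof (intro allI impI)
      fix f :: "complex ^ 'd \<Rightarrow> real" assume f: "continuous_on torus f"
      obtain B where B: "\<And>s. s \<in> torus \<Longrightarrow> norm (f s) \<le> B"
        using continuous_on_torus_bounded[OF f] by metis
      have fH: "continuous_on UNIV (\<lambda>t. f (H t))"
        using HG(1,2) by (intro continuous_on_compose2[OF f]) auto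
      have "(\<lambda>n. integral\<^sup>L ((\<mu> \<circ> r) n) (\<lambda>t. f (H t))) \<longlonglongrightarrow> integral\<^sup>L M (\<lambda>t. f (H t))"
      proof (rule weak_conv_imp_integral_bdd_continuous_conv)
        show "weak_conv_m (\<mu> \<circ> r) M" "real_distribution M" "real_distribution ((\<mu> \<circ> r) n)" for n
          using r rd by auto
        show "isCont (\<lambda>t. f (H t)) t" for t
          using fH by (simp add: continuous_on_eq_continuous_at)
        show "norm (f (H t)) \<le> B" for t using B HG(2) by blast
      qed
      moreover have "integral\<^sup>L ((\<mu> \<circ> r) n) (\<lambda>t. f (H t)) = (\<integral>s. f s \<partial>(\<nu> \<circ> r) n)" for n
      proof -
        have "integral\<^sup>L ((\<mu> \<circ> r) n) (\<lambda>t. f (H t)) = (\<integral>s. f (H (G s)) \<partial>\<nu> (r n))"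
          unfolding o_def \<mu>_def using G borel_measurable_continuous_onI[OF fH]
          by (intro integral_distr)
        also have "\<dots> = (\<integral>s. f s \<partial>\<nu> (r n))"
          using HG(5) by (intro integral_T_cong prob_T_sets assms) simp
        finally show ?thesis by simp
      qed
      moreover have "integral\<^sup>L M (\<lambda>t. f (H t)) = (\<integral>s. f s \<partial>distr M Tb H)"
        by (rule integral_distr[OF H borel_measurable_Tb[OF f], symmetric])
      ultimately show "(\<lambda>n. \<integral>s. f s \<partial>(\<nu> \<circ> r) n) \<longlonglongrightarrow> (\<integral>s. f s \<partial>distr M Tb H)"
        by simp
    qed
  qed
qed

text \<open>No mass can escape on a compact space, so a weakly convergent subsequence produces the
  measure behind any pointwise limit.\<close>

lemma charT_limit_exists:
  assumes "\<And>n. prob_T (\<nu> n)" "\<And>p. (\<lambda>n. charT (\<nu> n) p) \<longlonglongrightarrow> \<phi> p"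
  shows "\<exists>\<mu>. prob_T \<mu> \<and> (\<forall>p. charT \<mu> p = \<phi> p)"
proof -
  obtain r \<mu> where r: "strict_mono (r :: nat \<Rightarrow> nat)" "prob_T \<mu>" "weak_conv_T (\<nu> \<circ> r) \<mu>"
    using prob_T_compact assms(1) by blast
  have "charT \<mu> p = \<phi> p" for p
  proof (rule LIMSEQ_unique)
    show "(\<lambda>n. charT ((\<nu> \<circ> r) n) p) \<longlonglongrightarrow> charT \<mu> p"
      using charT_of_weak_conv_T[OF r(3) _ r(2)] assms(1) by simp
    show "(\<lambda>n. charT ((\<nu> \<circ> r) n) p) \<longlonglongrightarrow> \<phi> p"
      using LIMSEQ_subseq_LIMSEQ[OF assms(2)[of p] r(1)] by (simp add: o_def)
  qed
  then show ?thesis using r by blast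
qed

section \<open>Finite sums of measures\<close>

text \<open>Common form of \<open>rho_n\<close>, with \<open>I\<close> the row
  \<open>{1..kn n}\<close>, and of filling up mass by an atom, with \<open>I\<close> the two
  Booleans.\<close>

definition sum_T :: "'i set \<Rightarrow> ('i \<Rightarrow> (complex ^ 'd) measure) \<Rightarrow> (complex ^ 'd) measure" where
  "sum_T I M = measure_of torus (sets Tb) (\<lambda>B. \<Sum>i\<in>I. emeasure (M i) B)"

lemma sigma_algebra_Tb: "sigma_algebra torus (sets (Tb :: (complex ^ 'd) measure))"
  using sets.sigma_algebra_axioms[of "Tb :: (complex ^ 'd) measure"] by simp

lemma sets_sum_T [simp]: "sets (sum_T I M) = sets Tb"
  unfolding sum_T_def using sigma_algebra.sets_measure_of_eq[OF sigma_algebra_Tb] by blast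

lemma emeasure_sum_T:
  fixes M :: "'i \<Rightarrow> (complex ^ 'd) measure"
  assumes "finite I" "\<And>i. i \<in> I \<Longrightarrow> sets (M i) = sets Tb" "B \<in> sets Tb"
  shows "emeasure (sum_T I M) B = (\<Sum>i\<in>I. emeasure (M i) B)"
  unfolding sum_T_def
proof (rule emeasure_measure_of_sigma[OF sigma_algebra_Tb _ _ assms(3)])
  show "countably_additive (sets Tb) (\<lambda>B. \<Sum>i\<in>I. emeasure (M i) B)"
  proof (rule countably_additiveI)
    fix A :: "nat \<Rightarrow> (complex ^ 'd) set"
    assume A: "range A \<subseteq> sets Tb" "disjoint_family A"
    have "(\<Sum>k. \<Sum>i\<in>I. emeasure (M i) (A k)) = (\<Sum>i\<in>I. \<Sum>k. emeasure (M i) (A k))"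
      by (rule suminf_sum) simp
    also have "\<dots> = (\<Sum>i\<in>I. emeasure (M i) (\<Union>k. A k))"
      using assms A by (intro sum.cong suminf_emeasure) auto
    finally show "(\<Sum>k. \<Sum>i\<in>I. emeasure (M i) (A k)) = (\<Sum>i\<in>I. emeasure (M i) (\<Union>k. A k))" .
  qed
qed (simp add: positive_def)

lemma nn_integral_sum_T:
  assumes I: "finite I" "\<And>i. i \<in> I \<Longrightarrow> sets (M i) = sets Tb"
    and f: "f \<in> borel_measurable Tb"
  shows "(\<integral>\<^sup>+s. f s \<partial>sum_T I M) = (\<Sum>i\<in>I. \<integral>\<^sup>+s. f s \<partial>M i)"
  using f
proof (induction rule: borel_measurable_induct)
  case (cong f g)
  have "nn_integral N f = nn_integral N g" if "sets N = sets Tb" for N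
    using cong(3) by (intro nn_integral_cong) (simp add: space_T[OF that])
  then show ?case
    using cong(4) I(2) by simp
next
  case (set A)
  then show ?case
    using I by (subst nn_integral_indicator) (auto simp: emeasure_sum_T intro!: sum.cong)
next
  case (mult u c)
  have "(\<integral>\<^sup>+s. c * u s \<partial>N) = c * nn_integral N u" if "sets N = sets Tb" for N
    using mult measurable_T[OF that] by (intro nn_integral_cmult) blast
  then show ?case
    using mult.IH I(2) by (simp add: sum_distrib_left)
next
  case (add u v)
  have "(\<integral>\<^sup>+s. v s + u s \<partial>N) = nn_integral N v + nn_integral N u" if "sets N = sets Tb" for N
    using add measurable_T[OF that] by (intro nn_integral_add) blast+
  then show ?case
    using add.IH I(2) by (simp add: sum.distrib)
next
  case (seq U)
  have U: "(\<integral>\<^sup>+s. (SUP k. U k) s \<partial>N) = (SUP k. nn_integral N (U k))" if "sets N = sets Tb" for N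
  proof -
    have "(\<integral>\<^sup>+s. (SUP k. U k) s \<partial>N) = (\<integral>\<^sup>+s. (SUP k. U k s) \<partial>N)"
      by (simp add: image_comp)
    also have "\<dots> = (SUP k. nn_integral N (U k))"
      using seq measurable_T[OF that] by (intro nn_integral_monotone_convergence_SUP) blast+
    finally show ?thesis .
  qed
  have "(\<integral>\<^sup>+s. (SUP k. U k) s \<partial>sum_T I M) = (SUP k. \<Sum>i\<in>I. nn_integral (M i) (U k))"
    by (subst U) (simp_all only: sets_sum_T seq.IH)
  also have "\<dots> = (\<Sum>i\<in>I. SUP k. nn_integral (M i) (U k))"
  proof (rule ennreal_SUP_sum)
    show "incseq (\<lambda>k. nn_integral (M i) (U k))" for i
      using seq by (auto simp: incseq_def le_fun_def intro!: nn_integral_mono)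
  qed
  also have "\<dots> = (\<Sum>i\<in>I. \<integral>\<^sup>+s. (SUP k. U k) s \<partial>M i)"
    by (intro sum.cong refl U[symmetric] I)
  finally show ?case .
qed

lemma integrable_sum_T:
  fixes f :: "complex ^ 'd \<Rightarrow> 'b::{banach, second_countable_topology}"
  assumes I: "finite I" "\<And>i. i \<in> I \<Longrightarrow> sets (M i) = sets Tb"
    and f: "f \<in> borel_measurable Tb" "\<And>i. i \<in> I \<Longrightarrow> integrable (M i) f"
  shows "integrable (sum_T I M) f"
proof -
  have "(\<integral>\<^sup>+s. ennreal (norm (f s)) \<partial>sum_T I M) = (\<Sum>i\<in>I. \<integral>\<^sup>+s. ennreal (norm (f s)) \<partial>M i)"
    using I f(1) by (intro nn_integral_sum_T) auto
  also have "\<dots> < \<infinity>"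
    using f(2) I by (auto simp: integrable_iff_bounded)
  finally show ?thesis
    using measurable_T[OF sets_sum_T f(1)] by (simp add: integrable_iff_bounded)
qed

lemma integral_sum_T_real:
  fixes f :: "complex ^ 'd \<Rightarrow> real"
  assumes I: "finite I" "\<And>i. i \<in> I \<Longrightarrow> sets (M i) = sets Tb"
    and f: "f \<in> borel_measurable Tb" "\<And>i. i \<in> I \<Longrightarrow> integrable (M i) f"
  shows "(\<integral>s. f s \<partial>sum_T I M) = (\<Sum>i\<in>I. \<integral>s. f s \<partial>M i)"
proof -
  have fin: "(\<integral>\<^sup>+s. ennreal (f s) \<partial>M i) < \<infinity>" "(\<integral>\<^sup>+s. ennreal (- f s) \<partial>M i) < \<infinity>" if "i \<in> I" for i
    using f(2)[OF that] by (auto simp: real_integrable_def top.not_eq_extremum)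
  have *: "enn2real (\<integral>\<^sup>+s. ennreal (g s) \<partial>sum_T I M) = (\<Sum>i\<in>I. enn2real (\<integral>\<^sup>+s. ennreal (g s) \<partial>M i))"
    if "g \<in> borel_measurable Tb" "\<And>i. i \<in> I \<Longrightarrow> (\<integral>\<^sup>+s. ennreal (g s) \<partial>M i) < \<infinity>" for g
    using that I by (subst nn_integral_sum_T) (auto simp: enn2real_sum)
  have "(\<integral>s. f s \<partial>sum_T I M) = (\<Sum>i\<in>I. enn2real (\<integral>\<^sup>+s. ennreal (f s) \<partial>M i)) -
      (\<Sum>i\<in>I. enn2real (\<integral>\<^sup>+s. ennreal (- f s) \<partial>M i))"
    using fin f by (subst real_lebesgue_integral_def) (auto intro: integrable_sum_T[OF I] simp: *)
  also have "\<dots> = (\<Sum>i\<in>I. \<integral>s. f s \<partial>M i)"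
    using f(2) by (simp add: sum_subtractf[symmetric] real_lebesgue_integral_def)
  finally show ?thesis .
qed

lemma integral_sum_T:
  fixes f :: "complex ^ 'd \<Rightarrow> complex"
  assumes I: "finite I" "\<And>i. i \<in> I \<Longrightarrow> sets (M i) = sets Tb"
    and f: "f \<in> borel_measurable Tb" "\<And>i. i \<in> I \<Longrightarrow> integrable (M i) f"
  shows "(\<integral>s. f s \<partial>sum_T I M) = (\<Sum>i\<in>I. \<integral>s. f s \<partial>M i)"
proof (rule complex_eqI)
  have i: "integrable (sum_T I M) f"
    by (rule integrable_sum_T[OF assms])
  show "Re (\<integral>s. f s \<partial>sum_T I M) = Re (\<Sum>i\<in>I. \<integral>s. f s \<partial>M i)"
    using f by (simp add: integral_Re[OF i, symmetric] integral_sum_T_real[OF I] integral_Re)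
  show "Im (\<integral>s. f s \<partial>sum_T I M) = Im (\<Sum>i\<in>I. \<integral>s. f s \<partial>M i)"
    using f by (simp add: integral_Im[OF i, symmetric] integral_sum_T_real[OF I] integral_Im)
qed

lemma finite_measure_sum_T:
  assumes I: "finite I" "\<And>i. i \<in> I \<Longrightarrow> sets (M i) = sets Tb" "\<And>i. i \<in> I \<Longrightarrow> finite_measure (M i)"
  shows "finite_measure (sum_T I M)"
proof (rule finite_measureI)
  have "emeasure (sum_T I M) (space (sum_T I M)) = (\<Sum>i\<in>I. emeasure (M i) torus)"
    using I by (subst space_T) (auto intro!: emeasure_sum_T simp: sets_Tb_iff closed_torus)
  also have "\<dots> < \<infinity>"
    using I(3)[THEN finite_measure.emeasure_eq_measure] by simp
  finally show "emeasure (sum_T I M) (space (sum_T I M)) \<noteq> \<infinity>" by simp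
qed

lemma torus_in_sets_Tb [simp]: "torus \<in> sets Tb"
  by (simp add: sets_Tb_iff closed_torus)

text \<open>Filling up the missing mass at the neutral element makes Prokhorov-type arguments for finite
  measures reduce to probability measures; test functions vanishing at the neutral element do not
  see the difference.\<close>

lemma pad_to_prob_T:
  fixes \<rho> :: "(complex ^ 'd) measure"
  assumes "finite_measure \<rho>" "sets \<rho> = sets Tb" "measure \<rho> torus \<le> 1"
  obtains \<mu> where "prob_T \<mu>"
    "\<And>f :: complex ^ 'd \<Rightarrow> real. continuous_on torus f \<Longrightarrow>
      (\<integral>s. f s \<partial>\<mu>) = (\<integral>s. f s \<partial>\<rho>) + (1 - measure \<rho> torus) * f ones"
    "\<And>p. charT \<mu> p = 1 + (\<integral>s. monom_T s p - 1 \<partial>\<rho>)"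
proof -
  define c where "c = 1 - measure \<rho> torus"
  have c: "c \<ge> 0" using assms by (simp add: c_def)
  \<comment> \<open>Indexing by \<open>bool\<close> makes the sum of \<rho> and an atom of mass c at
    the neutral element an instance of \<open>sum_T\<close>.\<close>
  define M where "M b = (if b then \<rho> else density (return Tb ones) (\<lambda>_. ennreal c))" for b
  define \<mu> where "\<mu> = sum_T UNIV M"
  have sM: "sets (M b) = sets Tb" for b
    using assms by (simp add: M_def)
  have fR: "finite_measure (return Tb (ones :: complex ^ 'd))"
    by (intro prob_space.finite_measure prob_space_return) simp
  have fM: "finite_measure (M b)" for b
    using assms c
    by (auto simp: M_def emeasure_density_const space_return intro!: finite_measureI)
  have int: "(\<integral>s. f s \<partial>density (return Tb ones) (\<lambda>_. ennreal c)) = c *\<^sub>R f ones"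
    if "continuous_on torus f" for f :: "complex ^ 'd \<Rightarrow> 'b::{banach, second_countable_topology}"
  proof -
    have f: "f \<in> borel_measurable Tb" "(\<lambda>s. c *\<^sub>R f s) \<in> borel_measurable Tb"
      using borel_measurable_Tb[OF that] by auto
    have "(\<integral>s. f s \<partial>density (return Tb ones) (\<lambda>_. ennreal c)) = (\<integral>s. c *\<^sub>R f s \<partial>return Tb ones)"
      using f c by (intro integral_density) auto
    also have "\<dots> = c *\<^sub>R f ones"
      using f by (intro integral_return) auto
    finally show ?thesis .
  qed
  have "emeasure \<mu> torus = emeasure \<rho> torus + ennreal c"
    unfolding \<mu>_def using sM
    by (subst emeasure_sum_T) (auto simp: M_def UNIV_bool emeasure_density_const space_return)
  also have "\<dots> = 1"
    using assms(3) c by (simp add: finite_measure.emeasure_eq_measure[OF assms(1)] c_def flip: ennreal_plus)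
  finally have P: "prob_T \<mu>"
    unfolding prob_T_def
    by (intro conjI prob_spaceI) (simp_all add: \<mu>_def space_T)
  show thesis
  proof (rule that[OF P])
    fix f :: "complex ^ 'd \<Rightarrow> real" assume f: "continuous_on torus f"
    have "(\<integral>s. f s \<partial>\<mu>) = (\<Sum>b\<in>UNIV. \<integral>s. f s \<partial>M b)"
      unfolding \<mu>_def using sM fM f
      by (intro integral_sum_T_real borel_measurable_Tb integrable_T_continuous) auto
    then show "(\<integral>s. f s \<partial>\<mu>) = (\<integral>s. f s \<partial>\<rho>) + (1 - measure \<rho> torus) * f ones"
      using int[OF f] by (simp add: UNIV_bool M_def c_def)
  next
    fix p
    have i: "integrable \<rho> (\<lambda>s. monom_T s p)" "integrable \<rho> (\<lambda>s. 1 :: complex)"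
      using assms by (auto intro!: integrable_T_continuous continuous_on_monom_T)
    have "(\<integral>s. monom_T s p \<partial>\<mu>) = (\<Sum>b\<in>UNIV. \<integral>s. monom_T s p \<partial>M b)"
      unfolding \<mu>_def using sM fM
      by (intro integral_sum_T borel_measurable_Tb integrable_T_continuous continuous_on_monom_T) auto
    also have "\<dots> = (\<integral>s. monom_T s p \<partial>\<rho>) + of_real c"
      using int[OF continuous_on_monom_T, of p] by (simp add: UNIV_bool M_def of_real_def)
    also have "\<dots> = 1 + (\<integral>s. monom_T s p - 1 \<partial>\<rho>)"
      using i by (simp add: c_def space_T[OF assms(2)] of_real_def scaleR_left_diff_distrib)
    finally show "charT \<mu> p = 1 + (\<integral>s. monom_T s p - 1 \<partial>\<rho>)"
      by (simp add: charT_def)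
  qed
qed

section \<open>Characteristic functions of convolutions\<close>

lemma borel_measurable_vec_complex:
  fixes f :: "'a \<Rightarrow> complex ^ 'd"
  assumes "\<And>j. (\<lambda>x. f x $ j) \<in> borel_measurable M"
  shows "f \<in> borel_measurable M"
proof (subst borel_measurable_euclidean_space, intro ballI)
  fix i :: "complex ^ 'd" assume "i \<in> Basis"
  then obtain j u where "i = axis j u" by (auto simp: Basis_vec_def)
  then show "(\<lambda>x. f x \<bullet> i) \<in> borel_measurable M"
    using assms[of j] by (simp add: inner_axis)
qed

lemma measurable_to_Tb:
  fixes f :: "'a \<Rightarrow> complex ^ 'd"
  assumes "\<And>j. (\<lambda>x. f x $ j) \<in> borel_measurable M" "\<And>x. x \<in> space M \<Longrightarrow> f x \<in> torus"
  shows "f \<in> measurable M Tb"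
  unfolding Tb_def using assms
  by (intro measurable_restrict_space2 borel_measurable_vec_complex) auto

lemma prod_vec_nth: "(\<Prod>i\<in>I. f i) $ j = (\<Prod>i\<in>I. f i $ j)"
  for f :: "_ \<Rightarrow> 'a::comm_ring_1 ^ _"
  by (induction I rule: infinite_finite_induct) (simp_all add: one_vec_def)

lemma charT_distr:
  assumes "f \<in> measurable M Tb"
  shows "charT (distr M Tb f) p = (\<integral>x. monom_T (f x) p \<partial>M)"
  unfolding charT_def by (rule integral_distr[OF assms borel_measurable_Tb[OF continuous_on_monom_T]])

lemma
  fixes \<nu> :: "nat \<Rightarrow> (complex ^ 'd) measure"
  assumes \<xi>: "\<xi> \<in> torus" and \<nu>: "\<And>k. k \<in> {1..n} \<Longrightarrow> prob_T (\<nu> k)"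
  shows prob_T_conv_T: "prob_T (conv_T \<xi> \<nu> n)"
    and charT_conv_T: "charT (conv_T \<xi> \<nu> n) p = monom_T \<xi> p * (\<Prod>k\<in>{1..n}. charT (\<nu> k) p)"
proof -
  \<comment> \<open>\<open>product_prob_space\<close> asks for a probability measure at every index;
    point masses outside \<open>{1..n}\<close> supply them without changing the product.\<close>
  define N where "N k = (if k \<in> {1..n} then \<nu> k else return Tb ones)" for k
  have pR: "prob_T (return Tb (ones :: complex ^ 'd))"
    unfolding prob_T_def by (simp add: prob_space_return)
  have pN: "prob_T (N k)" for k
    using \<nu> pR by (simp add: N_def)
  note sN = prob_T_sets[OF pN]
  have PiM: "PiM {1..n} \<nu> = PiM {1..n} N"
    by (rule PiM_cong) (auto simp: N_def)
  interpret product_prob_space N "{1..n}"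
    using prob_T_prob[OF pN]
    by (simp add: product_prob_space_def product_prob_space_axioms_def product_sigma_finite_def
        prob_space_imp_sigma_finite)
  let ?g = "\<lambda>\<omega>. \<xi> * (\<Prod>i\<in>{1..n}. \<omega> i)"
  have sp: "\<omega> i \<in> torus" if "\<omega> \<in> space (PiM {1..n} N)" "i \<in> {1..n}" for \<omega> i
    using that space_T[OF sN] by (auto simp: space_PiM PiE_def Pi_def)
  have comp: "(\<lambda>\<omega>. \<omega> i $ j) \<in> borel_measurable (PiM {1..n} N)" if "i \<in> {1..n}" for i j
    using measurable_compose[OF measurable_component_singleton[OF that]
        borel_measurable_T[OF sN continuous_on_component[OF continuous_on_id]]] by simp
  have g: "?g \<in> measurable (PiM {1..n} N) Tb"
  proof (rule measurable_to_Tb)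
    show "(\<lambda>\<omega>. ?g \<omega> $ j) \<in> borel_measurable (PiM {1..n} N)" for j
      using comp by (simp add: prod_vec_nth) measurable
    show "?g \<omega> \<in> torus" if "\<omega> \<in> space (PiM {1..n} N)" for \<omega>
      using sp[OF that] \<xi> by (intro torus_mult torus_prod) auto
  qed
  show "prob_T (conv_T \<xi> \<nu> n)"
    unfolding conv_T_def PiM by (intro prob_T_distr g) unfold_locales
  have "charT (conv_T \<xi> \<nu> n) p = (\<integral>\<omega>. monom_T \<xi> p * (\<Prod>i\<in>{1..n}. monom_T (\<omega> i) p) \<partial>PiM {1..n} N)"
    unfolding conv_T_def PiM charT_distr[OF g] by (simp add: monom_T_mult monom_T_prod)
  also have "\<dots> = monom_T \<xi> p * (\<integral>\<omega>. (\<Prod>i\<in>{1..n}. monom_T (\<omega> i) p) \<partial>PiM {1..n} N)"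
    by simp
  also have "(\<integral>\<omega>. (\<Prod>i\<in>{1..n}. monom_T (\<omega> i) p) \<partial>PiM {1..n} N) = (\<Prod>i\<in>{1..n}. \<integral>s. monom_T s p \<partial>N i)"
    by (intro product_integral_prod integrable_T_continuous prob_T_finite pN sN continuous_on_monom_T) simp
  also have "\<dots> = (\<Prod>k\<in>{1..n}. charT (\<nu> k) p)"
    by (rule prod.cong) (auto simp: N_def charT_def)
  finally show "charT (conv_T \<xi> \<nu> n) p = monom_T \<xi> p * (\<Prod>k\<in>{1..n}. charT (\<nu> k) p)" .
qed

lemma norm_charT_le:
  assumes "prob_T \<nu>"
  shows "cmod (charT \<nu> p) \<le> 1"
proof -
  interpret prob_space \<nu> by (rule prob_T_prob[OF assms])
  have "cmod (charT \<nu> p) \<le> (\<integral>s. cmod (monom_T s p) \<partial>\<nu>)"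
    unfolding charT_def by (rule integral_norm_bound)
  also have "\<dots> = (\<integral>s. 1 \<partial>\<nu>)"
    by (intro integral_T_cong prob_T_sets assms norm_monom_T)
  finally show ?thesis by (simp add: prob_space)
qed

section \<open>Estimates for the Levy integrand\<close>

text \<open>The scale for second-order smallness at the neutral element: on the torus it is half the
  squared distance to \<open>ones\<close>, and also the l1 norm of the vector 1 - Re s. Unlike the
  squared angle it is continuous.\<close>

definition qT :: "complex ^ 'd \<Rightarrow> real" where
  "qT s = (\<Sum>j\<in>UNIV. 1 - Re (s $ j))"

definition levy_D :: "int ^ 'd \<Rightarrow> complex ^ 'd \<Rightarrow> complex" where
  "levy_D p s = monom_T s p - 1 - \<i> * complex_of_real (ivec p \<bullet> imv s)"

lemma torus_Re_Im:
  assumes "s \<in> torus"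
  shows "Re (s $ j) = cos (Arg (s $ j))" "Im (s $ j) = sin (Arg (s $ j))"
  using cis_Arg_torus[OF assms, of j] by (metis cis.sel)+

lemma Re_le_1_torus: "s \<in> torus \<Longrightarrow> Re (s $ j) \<le> 1"
  by (simp add: torus_Re_Im)

lemma qT_nonneg: "s \<in> torus \<Longrightarrow> 0 \<le> qT s"
  unfolding qT_def by (intro sum_nonneg) (simp add: Re_le_1_torus)

lemma component_le_qT: "s \<in> torus \<Longrightarrow> 1 - Re (s $ j) \<le> qT s"
  unfolding qT_def
  by (rule member_le_sum[where f = "\<lambda>j. 1 - Re (s $ j)"]) (auto simp: Re_le_1_torus)

lemma qT_ones [simp]: "qT ones = 0"
  by (simp add: qT_def)

lemma continuous_on_qT [continuous_intros]: "continuous_on A f \<Longrightarrow> continuous_on A (\<lambda>x. qT (f x))"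
  unfolding qT_def by (intro continuous_intros)

lemma continuous_on_imv [continuous_intros]: "continuous_on A f \<Longrightarrow> continuous_on A (\<lambda>x. imv (f x))"
  unfolding imv_def by (intro continuous_intros)

lemma continuous_on_levy_D: "continuous_on torus (levy_D p)"
  unfolding levy_D_def by (intro continuous_intros continuous_on_monom_T)

lemma qT_eq_0:
  assumes "s \<in> torus" "qT s = 0"
  shows "s = ones"
proof -
  have "s $ j = 1" for j
  proof -
    have "1 - Re (s $ j) = 0"
      using component_le_qT[OF assms(1), of j] Re_le_1_torus[OF assms(1), of j] assms(2) by linarith
    then show ?thesis
      using torusD[OF assms(1), of j] cmod_power2[of "s $ j"] by (simp add: complex_eq_iff)
  qed
  then show ?thesis by (simp add: vec_eq_iff)
qed

lemma qT_pos: "s \<in> torus \<Longrightarrow> s \<noteq> ones \<Longrightarrow> qT s > 0"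
  using qT_eq_0 qT_nonneg by (metis order_le_less)

section \<open>Elementary inequalities for angles\<close>

text \<open>Taylor gives the lower bound \<open>x\<^sup>2 / 2 - x ^ 4 / 24\<close>; as pi is below
  3.15, \<open>x\<^sup>2 \<le> 10\<close> there, and 1/2 - 10/24 = 1/12.\<close>

lemma one_minus_cos_ge:
  assumes "\<bar>x\<bar> \<le> pi"
  shows "x\<^sup>2 / 12 \<le> 1 - cos x"
proof -
  have "\<bar>Re (iexp x - (\<Sum>k\<le>3. (\<i> * x) ^ k / fact k))\<bar> \<le> \<bar>x\<bar> ^ 4 / fact 4"
    using order_trans[OF abs_Re_le_cmod iexp_approx1[of x 3]] by simp
  then have "\<bar>cos x - (1 - x\<^sup>2 / 2)\<bar> \<le> x ^ 4 / 24"
    by (simp add: eval_nat_numeral Re_exp fact_numeral algebra_simps power2_eq_square)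
  moreover have "x ^ 4 \<le> 10 * x\<^sup>2"
  proof -
    have "x\<^sup>2 \<le> 3.15\<^sup>2"
      using assms pi_less_4 pi_approx by (intro power2_le_iff_abs_le[THEN iffD2]) auto
    then have "x\<^sup>2 \<le> 10" by (simp add: power2_eq_square)
    then have "x\<^sup>2 * x\<^sup>2 \<le> 10 * x\<^sup>2" by (intro mult_right_mono) auto
    then show ?thesis by (simp add: power2_eq_square eval_nat_numeral)
  qed
  ultimately show ?thesis by linarith
qed

lemma abs_sin_diff_le: "\<bar>sin x - x\<bar> \<le> \<bar>x\<bar> ^ 3 / 6" for x :: real
proof -
  have "\<bar>Im (iexp x - (\<Sum>k\<le>2. (\<i> * x) ^ k / fact k))\<bar> \<le> \<bar>x\<bar> ^ 3 / fact 3"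
    using order_trans[OF abs_Im_le_cmod iexp_approx1[of x 2]] by simp
  then show ?thesis
    by (simp add: eval_nat_numeral Im_exp fact_numeral power2_eq_square)
qed

lemma cis_approx1: "cmod (cis y - 1 - \<i> * y) \<le> y\<^sup>2 / 2"
  using iexp_approx1[of y 1] by (simp add: cis_conv_exp power2_eq_square diff_diff_eq)

lemma cis_approx2: "cmod (cis y - 1 - \<i> * y + y\<^sup>2 / 2) \<le> \<bar>y\<bar> ^ 3 / 6"
  using iexp_approx1[of y 2]
  by (simp add: cis_conv_exp power2_eq_square eval_nat_numeral fact_numeral algebra_simps)

lemma norm_argv_sq: "(norm (argv s))\<^sup>2 = (\<Sum>j\<in>UNIV. (Arg (s $ j))\<^sup>2)"
  unfolding power2_norm_eq_inner by (simp add: inner_vec_def argv_def power2_eq_square)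

lemma norm_argv_le:
  assumes "s \<in> torus"
  shows "(norm (argv s))\<^sup>2 \<le> 12 * qT s"
proof -
  have "(norm (argv s))\<^sup>2 \<le> (\<Sum>j\<in>UNIV. 12 * (1 - Re (s $ j)))"
  unfolding norm_argv_sq
  proof (rule sum_mono)
    fix j
    show "(Arg (s $ j))\<^sup>2 \<le> 12 * (1 - Re (s $ j))"
    proof -
      have "\<bar>Arg (s $ j)\<bar> \<le> pi" using Arg_bounded[of "s $ j"] by linarith
      from one_minus_cos_ge[OF this] show ?thesis by (simp add: torus_Re_Im[OF assms])
    qed
  qed
  then show ?thesis by (simp add: qT_def sum_distrib_left)
qed

lemma one_minus_cos_le: "1 - cos x \<le> x\<^sup>2 / 2" for x :: real
proof -
  have "\<bar>Re (cis x - 1 - \<i> * x)\<bar> \<le> x\<^sup>2 / 2"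
    using abs_Re_le_cmod cis_approx1 by (rule order_trans)
  then show ?thesis by simp
qed

lemma qT_le_norm_argv:
  assumes "s \<in> torus"
  shows "qT s \<le> (norm (argv s))\<^sup>2 / 2"
proof -
  have "qT s \<le> (\<Sum>j\<in>UNIV. (Arg (s $ j))\<^sup>2 / 2)"
    unfolding qT_def using one_minus_cos_le by (intro sum_mono) (simp add: torus_Re_Im[OF assms])
  also have "\<dots> = (norm (argv s))\<^sup>2 / 2"
    by (simp add: norm_argv_sq sum_divide_distrib)
  finally show ?thesis .
qed

text \<open>An angle and its sine differ only at third order, so the compensator may use Im in place
  of the angle without touching the second-order term.\<close>

lemma norm_argv_diff_imv:
  assumes "s \<in> torus"
  shows "\<bar>ivec p \<bullet> argv s - ivec p \<bullet> imv s\<bar> \<le> norm (ivec p) * (\<Sum>j\<in>UNIV. \<bar>Arg (s $ j)\<bar> ^ 3 / 6)"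
proof -
  have "ivec p \<bullet> argv s - ivec p \<bullet> imv s = (\<Sum>j\<in>UNIV. ivec p $ j * (Arg (s $ j) - sin (Arg (s $ j))))"
    by (simp add: inner_vec_def argv_def imv_def torus_Re_Im[OF assms] sum_subtractf right_diff_distrib)
  also have "\<bar>\<dots>\<bar> \<le> (\<Sum>j\<in>UNIV. \<bar>ivec p $ j\<bar> * \<bar>Arg (s $ j) - sin (Arg (s $ j))\<bar>)"
    by (rule order_trans[OF sum_abs]) (simp add: abs_mult)
  also have "\<dots> \<le> (\<Sum>j\<in>UNIV. norm (ivec p) * (\<bar>Arg (s $ j)\<bar> ^ 3 / 6))"
    using abs_sin_diff_le
    by (intro sum_mono mult_mono component_le_norm_cart) (auto simp: abs_minus_commute)
  finally show ?thesis by (simp add: sum_distrib_left)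
qed

text \<open>Two readings of the cubic sum: globally one factor is discarded, as angle / 6 is below
  1; near \<open>ones\<close> that factor is kept as the small quantity
  \<open>norm (argv s)\<close>.\<close>

lemma sum_abs_Arg_cube:
  shows "(\<Sum>j\<in>UNIV. \<bar>Arg (s $ j)\<bar> ^ 3 / 6) \<le> (norm (argv s))\<^sup>2"
    and "(\<Sum>j\<in>UNIV. \<bar>Arg (s $ j)\<bar> ^ 3 / 6) \<le> norm (argv s) * (norm (argv s))\<^sup>2"
proof -
  note n = norm_argv_sq[of s]
  have c: "\<bar>Arg (s $ j)\<bar> ^ 3 / 6 = (\<bar>Arg (s $ j)\<bar> / 6) * (Arg (s $ j))\<^sup>2" for j
    by (simp add: power2_eq_square eval_nat_numeral abs_mult_self_eq mult.assoc)
  show "(\<Sum>j\<in>UNIV. \<bar>Arg (s $ j)\<bar> ^ 3 / 6) \<le> (norm (argv s))\<^sup>2"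
    unfolding n
  proof (rule sum_mono)
    fix j
    have "\<bar>Arg (s $ j)\<bar> / 6 \<le> 1" using Arg_bounded[of "s $ j"] pi_less_4 by auto
    then show "\<bar>Arg (s $ j)\<bar> ^ 3 / 6 \<le> (Arg (s $ j))\<^sup>2"
      unfolding c by (intro mult_left_le_one_le) auto
  qed
  show "(\<Sum>j\<in>UNIV. \<bar>Arg (s $ j)\<bar> ^ 3 / 6) \<le> norm (argv s) * (norm (argv s))\<^sup>2"
    unfolding n sum_distrib_left
  proof (rule sum_mono)
    fix j
    have "\<bar>Arg (s $ j)\<bar> \<le> norm (argv s)"
      using component_le_norm_cart[of "argv s" j] by (simp add: argv_def)
    then show "\<bar>Arg (s $ j)\<bar> ^ 3 / 6 \<le> norm (argv s) * (Arg (s $ j))\<^sup>2"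
      unfolding c by (intro mult_right_mono) auto
  qed
qed

text \<open>Separates the Taylor remainder of \<open>cis\<close> from the third-order error made by
  the compensator.\<close>

lemma levy_D_cis:
  assumes "s \<in> torus"
  shows "levy_D p s = (cis (ivec p \<bullet> argv s) - 1 - \<i> * (ivec p \<bullet> argv s)) +
    \<i> * of_real (ivec p \<bullet> argv s - ivec p \<bullet> imv s)"
  by (simp add: levy_D_def monom_T_cis[OF assms] algebra_simps)

text \<open>Both pieces of \<open>levy_D_cis\<close> are at most quadratic in the angle, and the
  squared angle is at most 12 times \<open>qT\<close>. This makes the exponent of a Levy measure
  absolutely convergent.\<close>

lemma levy_D_bound:
  assumes "s \<in> torus"
  shows "cmod (levy_D p s) \<le> 12 * ((norm (ivec p))\<^sup>2 + norm (ivec p)) * qT s"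
proof -
  let ?y = "ivec p \<bullet> argv s" and ?N = "norm (ivec p)" and ?X = "norm (argv s)"
  have y: "?y\<^sup>2 \<le> ?N\<^sup>2 * ?X\<^sup>2"
    using Cauchy_Schwarz_ineq2[of "ivec p" "argv s"]
    by (simp add: power_mult_distrib[symmetric] abs_le_square_iff[symmetric])
  have "cmod (levy_D p s) \<le> cmod (cis ?y - 1 - \<i> * ?y) + \<bar>?y - ivec p \<bullet> imv s\<bar>"
    unfolding levy_D_cis[OF assms] by (rule order_trans[OF norm_triangle_ineq]) (simp add: norm_mult)
  also have "\<dots> \<le> ?N\<^sup>2 * ?X\<^sup>2 + ?N * ?X\<^sup>2"
  proof (rule add_mono)
    show "cmod (cis ?y - 1 - \<i> * ?y) \<le> ?N\<^sup>2 * ?X\<^sup>2"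
      using cis_approx1[of ?y] y zero_le_power2[of ?y] by linarith
    show "\<bar>?y - ivec p \<bullet> imv s\<bar> \<le> ?N * ?X\<^sup>2"
      by (rule order_trans[OF norm_argv_diff_imv[OF assms] mult_left_mono[OF sum_abs_Arg_cube(1) norm_ge_zero]])
  qed
  also have "\<dots> = (?N\<^sup>2 + ?N) * ?X\<^sup>2" by (simp add: algebra_simps)
  also have "\<dots> \<le> (?N\<^sup>2 + ?N) * (12 * qT s)"
    using norm_argv_le[OF assms] by (intro mult_left_mono) auto
  finally show ?thesis by (simp add: algebra_simps)
qed

text \<open>The second-order term is expressed through Im rather than the angle, to match the
  Gaussian condition of the theorem. The remainder gains a factor \<open>norm (argv s)\<close> over
  \<open>qT\<close>, small on the support of a narrow cutoff.\<close>

lemma levy_D_quadratic: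
  assumes "s \<in> torus" "norm (argv s) \<le> 1"
  shows "cmod (levy_D p s + of_real ((ivec p \<bullet> imv s)\<^sup>2) / 2)
    \<le> 12 * (norm (ivec p) ^ 3 + (norm (ivec p))\<^sup>2 + norm (ivec p)) * norm (argv s) * qT s"
proof -
  let ?y = "ivec p \<bullet> argv s" and ?z = "ivec p \<bullet> imv s" and ?N = "norm (ivec p)" and ?X = "norm (argv s)"
  have y: "\<bar>?y\<bar> \<le> ?N * ?X"
    by (rule Cauchy_Schwarz_ineq2)
  have yz: "\<bar>?y - ?z\<bar> \<le> ?N * (?X * ?X\<^sup>2)"
    by (rule order_trans[OF norm_argv_diff_imv[OF assms(1)] mult_left_mono[OF sum_abs_Arg_cube(2) norm_ge_zero]])
  have z: "\<bar>?z\<bar> \<le> ?N * ?X"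
  proof -
    have "norm (imv s) \<le> ?X"
    proof (rule norm_le_componentwise_cart)
      show "norm (imv s $ j) \<le> norm (argv s $ j)" for j
        using abs_sin_x_le_abs_x by (simp add: imv_def argv_def torus_Re_Im[OF assms(1)])
    qed
    then show ?thesis
      using Cauchy_Schwarz_ineq2[of "ivec p" "imv s"] by (meson mult_left_mono norm_ge_zero order_trans)
  qed
  have sq: "\<bar>?z\<^sup>2 - ?y\<^sup>2\<bar> \<le> 2 * (?N\<^sup>2 * (?X * ?X\<^sup>2))"
  proof -
    have "\<bar>?z\<^sup>2 - ?y\<^sup>2\<bar> = \<bar>?y - ?z\<bar> * \<bar>?y + ?z\<bar>"
      by (simp add: power2_eq_square abs_mult[symmetric] algebra_simps abs_minus_commute)
    also have "\<dots> \<le> (?N * (?X * ?X\<^sup>2)) * (2 * (?N * ?X))"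
      using y z yz by (intro mult_mono) auto
    also have "\<dots> = (2 * (?N\<^sup>2 * (?X * ?X\<^sup>2))) * ?X"
      by (simp add: power2_eq_square algebra_simps)
    \<comment> \<open>The difference of squares is of fourth order; since
      \<open>norm (argv s) \<le> 1\<close>, one factor is given away to match the third-order
      errors.\<close>
    also have "\<dots> \<le> 2 * (?N\<^sup>2 * (?X * ?X\<^sup>2))"
      using assms(2) by (intro mult_left_le) auto
    finally show ?thesis .
  qed
  have cube: "\<bar>?y\<bar> ^ 3 \<le> ?N ^ 3 * (?X * ?X\<^sup>2)"
    using power_mono[OF y, of 3] by (simp add: power_mult_distrib power2_eq_square eval_nat_numeral algebra_simps)
  have "levy_D p s + of_real (?z\<^sup>2) / 2 =
     (cis ?y - 1 - \<i> * ?y + of_real (?y\<^sup>2) / 2) + (\<i> * of_real (?y - ?z) + of_real (?z\<^sup>2 - ?y\<^sup>2) / 2)"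
    unfolding levy_D_cis[OF assms(1)] by (simp add: field_simps)
  also have "cmod \<dots> \<le> cmod (cis ?y - 1 - \<i> * ?y + of_real (?y\<^sup>2) / 2) +
      (cmod (\<i> * of_real (?y - ?z)) + cmod (of_real (?z\<^sup>2 - ?y\<^sup>2) / 2))"
    by (intro norm_triangle_mono norm_triangle_ineq order_refl)
  also have "\<dots> \<le> \<bar>?y\<bar> ^ 3 / 6 + (\<bar>?y - ?z\<bar> + \<bar>?z\<^sup>2 - ?y\<^sup>2\<bar> / 2)"
    using cis_approx2[of ?y] by (simp add: norm_mult norm_divide del: of_real_diff)
  also have "\<dots> \<le> ?N ^ 3 * (?X * ?X\<^sup>2) + ?N * (?X * ?X\<^sup>2) + ?N\<^sup>2 * (?X * ?X\<^sup>2)"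
  proof -
    have le: "a / 6 + (b + c / 2) \<le> A + B + C"
      if "0 \<le> a" "a \<le> A" "b \<le> B" "c \<le> 2 * C" for a b c A B C :: real
      using that by linarith
    show ?thesis by (rule le[OF _ cube yz sq]) simp
  qed
  also have "\<dots> = ((?N ^ 3 + ?N\<^sup>2 + ?N) * ?X) * ?X\<^sup>2" by (simp add: algebra_simps)
  also have "\<dots> \<le> ((?N ^ 3 + ?N\<^sup>2 + ?N) * ?X) * (12 * qT s)"
    using norm_argv_le[OF assms(1)] by (intro mult_left_mono) auto
  finally show ?thesis by (simp add: algebra_simps)
qed

text \<open>The constant 3 bounds \<open>exp 1\<close>, the factor in Taylor's remainder on the unit
  disc.\<close>

lemma norm_exp_minus_1_minus:
  assumes "cmod z \<le> 1"
  shows "cmod (exp z - 1 - z) \<le> 3 * (cmod z)\<^sup>2"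
proof -
  have "cmod (exp z - 1 - z) \<le> exp \<bar>Re z\<bar> * (cmod z)\<^sup>2"
    using Taylor_exp[of z 1] by (simp add: power2_eq_square diff_diff_eq)
  also have "\<dots> \<le> 3 * (cmod z)\<^sup>2"
  proof (rule mult_right_mono)
    have "exp \<bar>Re z\<bar> \<le> exp (1::real)"
      using abs_Re_le_cmod[of z] assms by simp
    also have "\<dots> \<le> 3" using exp_le by simp
    finally show "exp \<bar>Re z\<bar> \<le> 3" .
  qed simp
  finally show ?thesis .
qed

section \<open>Levy measures\<close>

text \<open>The entries of 1 - Re s are nonnegative on the torus, so this compares their l1 and l2
  norms; it lets \<open>qT\<close> replace the norm in the definition of a Levy measure.\<close>

lemma norm_one_minus_rev:
  assumes "s \<in> torus"
  shows "norm ((\<chi> j. 1) - rev s) \<le> qT s" "qT s \<le> real CARD('d) * norm ((\<chi> j. 1) - rev (s :: complex ^ 'd))"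
proof -
  show "norm ((\<chi> j. 1) - rev s) \<le> qT s"
    using norm_le_l1_cart[of "(\<chi> j. 1) - rev s"] by (simp add: qT_def rev_def Re_le_1_torus[OF assms])
  have "qT s \<le> (\<Sum>j\<in>(UNIV :: 'd set). norm ((\<chi> j. 1) - rev s))"
    unfolding qT_def
  proof (rule sum_mono)
    show "1 - Re (s $ j) \<le> norm ((\<chi> j. 1) - rev s)" for j
      using component_le_norm_cart[of "(\<chi> j. 1) - rev s" j] by (simp add: rev_def)
  qed
  then show "qT s \<le> real CARD('d) * norm ((\<chi> j. 1) - rev s)" by simp
qed

lemma integrable_levy_iff:
  fixes \<rho> :: "(complex ^ 'd) measure"
  assumes "sets \<rho> = sets Tb"
  shows "integrable \<rho> (\<lambda>s. norm ((\<chi> j. 1) - rev s)) \<longleftrightarrow> integrable \<rho> qT"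
proof
  have m: "qT \<in> borel_measurable \<rho>" "(\<lambda>s. norm ((\<chi> j. 1) - rev s)) \<in> borel_measurable \<rho>"
    unfolding rev_def by (intro borel_measurable_T assms continuous_intros)+
  show "integrable \<rho> qT" if i: "integrable \<rho> (\<lambda>s. norm ((\<chi> j. 1) - rev s))"
  proof (rule Bochner_Integration.integrable_bound[OF integrable_mult_right[OF i, of "real CARD('d)"] m(1)])
    show "AE s in \<rho>. norm (qT s) \<le> norm (real CARD('d) * norm ((\<chi> j. 1) - rev s))"
      by (intro AE_I2) (simp add: space_T[OF assms] norm_one_minus_rev(2) qT_nonneg)
  qed
  show "integrable \<rho> (\<lambda>s. norm ((\<chi> j. 1) - rev s))" if i: "integrable \<rho> qT"
  proof (rule Bochner_Integration.integrable_bound[OF i m(2)])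
    show "AE s in \<rho>. norm (norm ((\<chi> j. 1) - rev s)) \<le> norm (qT s)"
      by (intro AE_I2) (simp add: space_T[OF assms] norm_one_minus_rev(1) qT_nonneg)
  qed
qed

lemma levy_measure_T_iff:
  "levy_measure_T \<rho> \<longleftrightarrow> sets \<rho> = sets Tb \<and> emeasure \<rho> {ones} = 0 \<and> integrable \<rho> qT"
  unfolding levy_measure_T_def using integrable_levy_iff by blast

lemma integrable_qT_bound:
  fixes f :: "complex ^ 'd \<Rightarrow> 'b::{banach, second_countable_topology}"
  assumes \<rho>: "sets \<rho> = sets Tb" "integrable \<rho> qT"
    and f: "f \<in> borel_measurable Tb" "\<And>s. s \<in> torus \<Longrightarrow> norm (f s) \<le> C * qT s"
  shows "integrable \<rho> f"
proof (rule Bochner_Integration.integrable_bound[OF integrable_mult_right[OF \<rho>(2), of C]])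
  show "f \<in> borel_measurable \<rho>" by (rule measurable_T[OF \<rho>(1) f(1)])
  show "AE s in \<rho>. norm (f s) \<le> norm (C * qT s)"
    using f(2) by (intro AE_I2) (force simp: space_T[OF \<rho>(1)])
qed

lemma integrable_levy_D:
  assumes "sets \<rho> = sets Tb" "integrable \<rho> qT"
  shows "integrable \<rho> (levy_D p)"
  using levy_D_bound by (intro integrable_qT_bound[OF assms] borel_measurable_Tb continuous_on_levy_D) blast

section \<open>Existence of the multiplicative infinitely divisible laws\<close>

text \<open>Existence of the infinitely divisible laws is obtained from closure of this class under
  products, powers and pointwise limits.\<close>

definition is_charT :: "(int ^ 'd \<Rightarrow> complex) \<Rightarrow> bool" where
  "is_charT \<phi> \<longleftrightarrow> (\<exists>\<nu>. prob_T \<nu> \<and> (\<forall>p. charT \<nu> p = \<phi> p))"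

lemma is_charT_limit:
  assumes "\<And>n. is_charT (\<phi>s n)" "\<And>p. (\<lambda>n. \<phi>s n p) \<longlonglongrightarrow> \<phi> p"
  shows "is_charT \<phi>"
proof -
  obtain \<nu> where \<nu>: "\<And>n. prob_T (\<nu> n)" "\<And>n p. charT (\<nu> n) p = \<phi>s n p"
    using assms(1) unfolding is_charT_def by metis
  then show ?thesis
    using charT_limit_exists[of \<nu> \<phi>] assms(2) by (simp add: is_charT_def)
qed

lemma is_charT_mult:
  assumes "is_charT \<phi>" "is_charT \<psi>"
  shows "is_charT (\<lambda>p. \<phi> p * \<psi> p)"
proof -
  obtain \<mu> \<nu> where *: "prob_T \<mu>" "\<And>p. charT \<mu> p = \<phi> p" "prob_T \<nu>" "\<And>p. charT \<nu> p = \<psi> p"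
    using assms unfolding is_charT_def by metis
  let ?N = "\<lambda>k :: nat. if k = 1 then \<mu> else \<nu>"
  have "prob_T (?N k)" for k using * by simp
  then have "prob_T (conv_T ones ?N 2)" "charT (conv_T ones ?N 2) p = \<phi> p * \<psi> p" for p
    using prob_T_conv_T[OF ones_in_torus, of 2 ?N] charT_conv_T[OF ones_in_torus, of 2 ?N p] *
    by (simp_all add: numeral_2_eq_2)
  then show ?thesis unfolding is_charT_def by blast
qed

lemma is_charT_power:
  assumes "is_charT \<phi>"
  shows "is_charT (\<lambda>p. \<phi> p ^ n)"
proof -
  obtain \<mu> where *: "prob_T \<mu>" "\<And>p. charT \<mu> p = \<phi> p"
    using assms unfolding is_charT_def by metis
  have "prob_T (conv_T ones (\<lambda>_. \<mu>) n)" "charT (conv_T ones (\<lambda>_. \<mu>) n) p = \<phi> p ^ n" for p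
    using prob_T_conv_T[OF ones_in_torus, of n "\<lambda>_. \<mu>"] charT_conv_T[OF ones_in_torus, of n "\<lambda>_. \<mu>" p] *
    by simp_all
  then show ?thesis unfolding is_charT_def by blast
qed

lemma is_charT_dirac:
  assumes "\<gamma> \<in> torus"
  shows "is_charT (monom_T \<gamma>)"
proof -
  have "prob_T (return Tb \<gamma>)" "charT (return Tb \<gamma>) p = monom_T \<gamma> p" for p
    using assms unfolding prob_T_def charT_def
    by (auto intro!: prob_space_return integral_return borel_measurable_Tb continuous_on_monom_T)
  then show ?thesis unfolding is_charT_def by blast
qed

lemma cis_vec_torus [simp]: "(\<chi> j. cis (x j)) \<in> torus"
  by (simp add: torus_def)

lemma monom_T_cis_vec: "monom_T (\<chi> j. cis (x $ j)) p = cis (ivec p \<bullet> x)"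
  by (simp add: monom_T_def cis_power_int)
    (simp add: cis_conv_exp inner_vec_def ivec_def sum_distrib_left exp_sum)

section \<open>The Gaussian factor\<close>

text \<open>The standard normal law, laid along the line through v and wrapped around the torus; at
  integer frequencies wrapping does not change the characteristic function.\<close>

lemma is_charT_gauss: "is_charT (\<lambda>p. of_real (exp (- (v \<bullet> ivec p)\<^sup>2 / 2)))"
proof -
  interpret N: real_distribution std_normal_distribution by (rule real_dist_normal_dist)
  define f :: "real \<Rightarrow> complex ^ 'a" where "f x = (\<chi> j. cis ((x *\<^sub>R v) $ j))" for x
  have f: "f \<in> measurable std_normal_distribution Tb"
    unfolding f_def
    by (rule measurable_to_Tb) (auto intro!: borel_measurable_continuous_onI continuous_intros)
  have "charT (distr std_normal_distribution Tb f) p = of_real (exp (- (v \<bullet> ivec p)\<^sup>2 / 2))" for p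
  proof -
    have "charT (distr std_normal_distribution Tb f) p = char std_normal_distribution (v \<bullet> ivec p)"
      unfolding charT_distr[OF f] char_def f_def monom_T_cis_vec
      by (simp add: cis_conv_exp inner_commute mult_ac)
    then show ?thesis by (simp add: char_std_normal_distribution)
  qed
  then show ?thesis
    unfolding is_charT_def using prob_T_distr[OF N.prob_space_axioms f] by blast
qed

text \<open>Lagrange's completion of squares: subtracting the square of \<open>w \<bullet> x\<close> with
  \<open>w = f e\<^sub>j\<close> kills the basis vector \<open>e\<^sub>j\<close> and keeps the ones already killed.\<close>

lemma psd_sum_of_squares:
  fixes f :: "real ^ 'd \<Rightarrow> real ^ 'd"
  assumes "linear f" "\<And>x y. f x \<bullet> y = x \<bullet> f y" "\<And>x. 0 \<le> f x \<bullet> x"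
  shows "\<exists>vs. \<forall>x. f x \<bullet> x = (\<Sum>v\<leftarrow>vs. (v \<bullet> x)\<^sup>2)"
  using assms
proof (induction "card {j. f (axis j 1) \<noteq> 0}" arbitrary: f rule: less_induct)
  case less
  note lin = less.prems(1) and sym = less.prems(2) and psd = less.prems(3)
  show ?case
  proof (cases "\<forall>j. f (axis j 1) = 0")
    case True
    have "f x = 0" for x
    proof -
      have "f x = f (\<Sum>j\<in>UNIV. x $ j *\<^sub>R axis j 1)"
        using basis_expansion[of x] by (simp add: scalar_mult_eq_scaleR)
      also have "\<dots> = (\<Sum>j\<in>UNIV. x $ j *\<^sub>R f (axis j 1))"
        by (simp add: linear_sum[OF lin] linear_cmul[OF lin])
      finally show ?thesis using True by simp
    qed
    then show ?thesis by (intro exI[of _ "[]"]) simp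
  next
    case False
    then obtain j where j: "f (axis j 1) \<noteq> 0" by blast
    define e :: "real ^ 'd" where "e = axis j 1"
    define w where "w = f e"
    define a where "a = w \<bullet> e"
    have w: "w \<noteq> 0" using j by (simp add: w_def e_def)
    have expand: "f (y + t *\<^sub>R e) \<bullet> (y + t *\<^sub>R e) = f y \<bullet> y + 2 * t * (w \<bullet> y) + t\<^sup>2 * a" for y t
      using sym[of y e] by (simp add: linear_add[OF lin] linear_cmul[OF lin] inner_add_left inner_add_right
          w_def a_def power2_eq_square inner_commute algebra_simps)
    \<comment> \<open>If a were 0, the form at \<open>w + t *\<^sub>R e\<close> would be affine in t
      with slope \<open>2 * (w \<bullet> w)\<close>, and a suitable t would give it the value
      -1.\<close>
    have "a > 0"
    proof (rule ccontr)
      assume "\<not> a > 0"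
      then have a: "a = 0" using psd[of e] by (simp add: a_def w_def)
      define t where "t = - (f w \<bullet> w + 1) / (2 * (w \<bullet> w))"
      have "2 * t * (w \<bullet> w) = - (f w \<bullet> w + 1)"
        using w by (simp add: t_def field_simps)
      then have "f (w + t *\<^sub>R e) \<bullet> (w + t *\<^sub>R e) = - 1"
        unfolding expand a by simp
      then show False using psd[of "w + t *\<^sub>R e"] by simp
    qed
    define g where "g x = f x - ((w \<bullet> x) / a) *\<^sub>R w" for x
    have "\<exists>vs. \<forall>x. g x \<bullet> x = (\<Sum>v\<leftarrow>vs. (v \<bullet> x)\<^sup>2)"
    proof (rule less.hyps)
      have ge: "g e = 0" using \<open>a > 0\<close> by (simp add: g_def a_def w_def)
      have gi: "g (axis i 1) = 0" if "f (axis i 1) = 0" for i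
        using sym[of e "axis i 1"] that by (simp add: g_def w_def)
      have "{i. g (axis i 1) \<noteq> 0} \<subset> {i. f (axis i 1) \<noteq> 0}"
        using gi ge j by (auto simp: e_def)
      then show "card {i. g (axis i 1) \<noteq> 0} < card {i. f (axis i 1) \<noteq> 0}"
        by (intro psubset_card_mono) auto
      show "linear g"
        unfolding g_def
        by (rule linearI) (simp_all add: linear_add[OF lin] linear_cmul[OF lin] inner_add_right
            add_divide_distrib scaleR_left_distrib algebra_simps)
      show "g x \<bullet> y = x \<bullet> g y" for x y
        using sym[of x y] by (simp add: g_def inner_diff_left inner_diff_right inner_commute)
      show "0 \<le> g x \<bullet> x" for x
      proof -
        \<comment> \<open>The form of f at x moved along e to the point where the quadratic in t is
          minimal; this minimum is the form of g at x.\<close>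
        have "0 \<le> f x \<bullet> x + 2 * (- (w \<bullet> x) / a) * (w \<bullet> x) + (- (w \<bullet> x) / a)\<^sup>2 * a"
          using psd[of "x + (- (w \<bullet> x) / a) *\<^sub>R e"] unfolding expand .
        also have "\<dots> = g x \<bullet> x"
          using \<open>a > 0\<close> by (simp add: g_def inner_diff_left power2_eq_square field_simps)
        finally show ?thesis .
      qed
    qed
    then obtain vs where vs: "\<And>x. g x \<bullet> x = (\<Sum>v\<leftarrow>vs. (v \<bullet> x)\<^sup>2)" by blast
    have "f x \<bullet> x = (\<Sum>v\<leftarrow>((1 / sqrt a) *\<^sub>R w) # vs. (v \<bullet> x)\<^sup>2)" for x
      using vs[of x] \<open>a > 0\<close>
      by (simp add: g_def inner_diff_left power_mult_distrib power_divide power2_eq_square)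
    then show ?thesis by blast
  qed
qed

text \<open>A sum of squares in the exponent is a product of wrapped one-dimensional Gaussian
  factors.\<close>

lemma is_charT_normal:
  fixes A :: "real ^ 'd ^ 'd"
  assumes "transpose A = A" "\<forall>x. 0 \<le> (A *v x) \<bullet> x"
  shows "is_charT (\<lambda>p. exp (- (1/2) * complex_of_real ((A *v ivec p) \<bullet> ivec p)))"
proof -
  have "\<exists>vs. \<forall>x. (A *v x) \<bullet> x = (\<Sum>v\<leftarrow>vs. (v \<bullet> x)\<^sup>2)"
  proof (rule psd_sum_of_squares)
    show "(A *v x) \<bullet> y = x \<bullet> (A *v y)" for x y
      using dot_lmul_matrix[of x A y] assms(1) by (metis transpose_matrix_vector)
  qed (use assms in auto)
  then obtain vs where vs: "\<And>x. (A *v x) \<bullet> x = (\<Sum>v\<leftarrow>vs. (v \<bullet> x)\<^sup>2)" by blast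
  have "is_charT (\<lambda>p. exp (- (1/2) * complex_of_real (\<Sum>v\<leftarrow>vs. (v \<bullet> ivec p)\<^sup>2)))" for vs :: "(real ^ 'd) list"
  proof (induction vs)
    case Nil
    have "is_charT (monom_T (ones :: complex ^ 'd))" by (rule is_charT_dirac) simp
    moreover have "monom_T (ones :: complex ^ 'd) = (\<lambda>_. 1)" by (rule ext) simp
    ultimately show ?case by simp
  next
    case (Cons v vs)
    have "(\<lambda>p. exp (- (1/2) * complex_of_real (\<Sum>v\<leftarrow>v # vs. (v \<bullet> ivec p)\<^sup>2))) =
      (\<lambda>p. of_real (exp (- (v \<bullet> ivec p)\<^sup>2 / 2)) * exp (- (1/2) * complex_of_real (\<Sum>v\<leftarrow>vs. (v \<bullet> ivec p)\<^sup>2)))"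
      by (simp add: exp_of_real[symmetric] exp_add[symmetric] algebra_simps add_divide_distrib)
    then show ?case
      using is_charT_mult[OF is_charT_gauss[of v] Cons.IH] by simp
  qed
  then show ?thesis by (simp only: vs)
qed

section \<open>The Poissonian factor\<close>

text \<open>The compound Poisson law as a limit of convolution powers: \<open>1 + z p / N\<close>
  belongs to \<open>\<rho> / N\<close> filled up by an atom at \<open>ones\<close>, and its N-th
  power tends to \<open>exp (z p)\<close>.\<close>

lemma is_charT_poisson:
  assumes \<rho>: "finite_measure \<rho>" "sets \<rho> = sets Tb"
  shows "is_charT (\<lambda>p. exp (\<integral>s. monom_T s p - 1 \<partial>\<rho>))"
proof -
  interpret finite_measure \<rho> by (rule \<rho>)
  define z where "z p = (\<integral>s. monom_T s p - 1 \<partial>\<rho>)" for p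
  \<comment> \<open>The ceiling keeps the mass of \<open>\<rho> / N n\<close> at most 1;
    \<open>Suc n\<close> makes \<open>N n\<close> positive and lets it tend to infinity.\<close>
  define N where "N n = Suc n + nat \<lceil>measure \<rho> torus\<rceil>" for n
  have N: "0 < N n" "measure \<rho> torus \<le> N n" for n
    unfolding N_def by (auto intro: order_trans[OF of_nat_ceiling])
  have i: "integrable \<rho> (\<lambda>s. monom_T s p - 1)" for p
    by (intro integrable_T_continuous \<rho> continuous_intros continuous_on_monom_T)
  have ch: "is_charT (\<lambda>p. 1 + z p / N n)" for n
  proof -
    let ?\<rho> = "density \<rho> (\<lambda>_. ennreal (1 / N n))"
    have fin: "finite_measure ?\<rho>"
      by (rule finite_measureI) (simp add: emeasure_density_const emeasure_eq_measure ennreal_mult'[symmetric])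
    have "measure ?\<rho> torus = measure \<rho> torus / N n"
      using \<rho> by (simp add: measure_def emeasure_density_const enn2real_mult)
    then have "measure ?\<rho> torus \<le> 1" using N[of n] by simp
    moreover have "sets ?\<rho> = sets Tb" using \<rho> by simp
    ultimately obtain \<mu> where "prob_T \<mu>" "\<And>p. charT \<mu> p = 1 + (\<integral>s. monom_T s p - 1 \<partial>?\<rho>)"
      using pad_to_prob_T[OF fin] by metis
    moreover have "(\<integral>s. monom_T s p - 1 \<partial>?\<rho>) = z p / N n" for p
    proof -
      have "(\<integral>s. monom_T s p - 1 \<partial>?\<rho>) = (\<integral>s. (1 / N n) *\<^sub>R (monom_T s p - 1) \<partial>\<rho>)"
        using i by (intro integral_density) auto
      then show ?thesis using i by (simp add: z_def scaleR_conv_of_real)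
    qed
    ultimately show ?thesis unfolding is_charT_def by auto
  qed
  \<comment> \<open>This puts \<open>exp (z p / N n)\<close> into the unit disc, as the telescoping
    bound \<open>norm_power_diff\<close> requires of both bases.\<close>
  have Re_z: "Re (z p) \<le> 0" for p
  proof -
    have "Re (z p) = (\<integral>s. Re (monom_T s p - 1) \<partial>\<rho>)"
      unfolding z_def using i by (rule integral_Re[symmetric])
    also have "\<dots> \<le> 0"
    proof -
      have "Re (monom_T s p - 1) \<le> 0" if "s \<in> space \<rho>" for s
        using that complex_Re_le_cmod[of "monom_T s p"] by (simp add: space_T[OF \<rho>(2)] norm_monom_T)
      then have "(\<integral>s. Re (monom_T s p - 1) \<partial>\<rho>) \<le> (\<integral>s. 0 \<partial>\<rho>)"
        using integrable_Re[OF i] by (intro integral_mono) auto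
      then show ?thesis by simp
    qed
    finally show ?thesis .
  qed
  show ?thesis
    unfolding z_def[symmetric]
  proof (rule is_charT_limit[where \<phi>s = "\<lambda>n p. (1 + z p / N n) ^ N n"])
    show "is_charT (\<lambda>p. (1 + z p / N n) ^ N n)" for n
      by (rule is_charT_power[OF ch])
    fix p
    have bound: "cmod ((1 + z p / N n) ^ N n - exp (z p)) \<le> 3 * (cmod (z p))\<^sup>2 / N n" if "cmod (z p) \<le> N n" for n
    proof -
      have "exp (z p) = exp (z p / N n) ^ N n"
        using N(1)[of n] exp_of_nat_mult[of "N n" "z p / N n"] by simp
      then have "cmod ((1 + z p / N n) ^ N n - exp (z p)) \<le> N n * cmod (1 + z p / N n - exp (z p / N n))"
      proof -
        have "cmod (1 + z p / N n) \<le> 1"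
          using ch[of n] norm_charT_le unfolding is_charT_def by metis
        moreover have "cmod (exp (z p / N n)) \<le> 1"
          using Re_z[of p] N(1)[of n] by (simp add: divide_nonpos_pos)
        ultimately show ?thesis
          using norm_power_diff[of "1 + z p / N n" "exp (z p / N n)" "N n"] \<open>exp (z p) = _\<close> by simp
      qed
      also have "cmod (1 + z p / N n - exp (z p / N n)) \<le> 3 * (cmod (z p / N n))\<^sup>2"
        using norm_exp_minus_1_minus[of "z p / N n"] that N(1)[of n]
        by (simp add: norm_minus_commute norm_divide diff_diff_eq)
      finally show ?thesis
        using N(1)[of n] by (simp add: norm_divide power2_eq_square field_simps)
    qed
    have Nlim: "filterlim (\<lambda>n. real (N n)) at_top sequentially"
    proof (rule filterlim_at_top_mono[OF filterlim_real_sequentially])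
      have "n \<le> N n" for n by (simp add: N_def)
      then show "\<forall>\<^sub>F n in sequentially. real n \<le> real (N n)" by simp
    qed
    show "(\<lambda>n. (1 + z p / N n) ^ N n) \<longlonglongrightarrow> exp (z p)"
    proof (subst Lim_null, rule Lim_null_comparison)
      show "\<forall>\<^sub>F n in sequentially. cmod ((1 + z p / N n) ^ N n - exp (z p)) \<le> 3 * (cmod (z p))\<^sup>2 / N n"
        using filterlim_at_top[THEN iffD1, OF Nlim, rule_format, of "cmod (z p)"]
        by eventually_elim (rule bound)
      show "(\<lambda>n. 3 * (cmod (z p))\<^sup>2 / N n) \<longlonglongrightarrow> 0"
        by (intro real_tendsto_divide_at_top[OF tendsto_const] Nlim)
    qed
  qed
qed

text \<open>For a finite measure the compensator is integrable by itself and amounts to a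
  translation, that is, to convolution with a point mass.\<close>

lemma is_charT_levy_finite:
  assumes \<rho>: "finite_measure \<rho>" "sets \<rho> = sets Tb"
  shows "is_charT (\<lambda>p. exp (\<integral>s. levy_D p s \<partial>\<rho>))"
proof -
  define m where "m = (\<chi> j. - (\<integral>s. Im (s $ j) \<partial>\<rho>))"
  have "exp (\<integral>s. levy_D p s \<partial>\<rho>) = exp (\<integral>s. monom_T s p - 1 \<partial>\<rho>) * monom_T (\<chi> j. cis (m $ j)) p" for p
  proof -
    have i: "integrable \<rho> (\<lambda>s. monom_T s p - 1)" "integrable \<rho> (\<lambda>s. ivec p \<bullet> imv s)"
      "integrable \<rho> (\<lambda>s. Im (s $ j))" for j
      by (intro integrable_T_continuous \<rho> continuous_intros continuous_on_monom_T)+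
    have "(\<integral>s. levy_D p s \<partial>\<rho>) = (\<integral>s. monom_T s p - 1 \<partial>\<rho>) - \<i> * of_real (\<integral>s. ivec p \<bullet> imv s \<partial>\<rho>)"
      unfolding levy_D_def using i by simp
    also have "(\<integral>s. ivec p \<bullet> imv s \<partial>\<rho>) = - (ivec p \<bullet> m)"
      using i(3) by (simp add: inner_vec_def imv_def m_def sum_negf)
    finally show ?thesis
      by (simp add: monom_T_cis_vec exp_add) (simp add: cis_conv_exp)
  qed
  then show ?thesis
    using is_charT_mult[OF is_charT_poisson[OF \<rho>] is_charT_dirac[OF cis_vec_torus]] by simp
qed

text \<open>Restricting to \<open>qT \<ge> 1 / (n + 1)\<close> leaves a finite measure, because the
  indicator is at most n + 1 times \<open>qT\<close>. Dominated convergence restores the full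
  exponent: the only point never included is \<open>ones\<close>, which has measure zero.\<close>

lemma is_charT_levy:
  assumes "levy_measure_T (\<rho> :: (complex ^ 'd) measure)"
  shows "is_charT (\<lambda>p. exp (\<integral>s. levy_D p s \<partial>\<rho>))"
proof -
  have s\<rho>: "sets \<rho> = sets Tb" and z: "emeasure \<rho> {ones} = 0" and iq: "integrable \<rho> qT"
    using assms by (auto simp: levy_measure_T_iff)
  define I where "I n s = (indicator {s \<in> torus. 1 / real (Suc n) \<le> qT s} s :: real)" for n and s :: "complex ^ 'd"
  define R where "R n = density \<rho> (\<lambda>s. ennreal (I n s))" for n
  have cq: "qT \<in> borel_measurable Tb"
    by (intro borel_measurable_Tb continuous_intros)
  have "{s \<in> space Tb. 1 / real (Suc n) \<le> qT s} \<in> sets Tb" for n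
    using cq by measurable
  then have mI: "I n \<in> borel_measurable Tb" for n
    unfolding I_def by (intro borel_measurable_indicator) simp
  have mI': "I n \<in> borel_measurable \<rho>" for n
    by (rule measurable_T[OF s\<rho> mI])
  have I01: "0 \<le> I n s" "I n s \<le> 1" for n s
    by (auto simp: I_def indicator_def)
  have iI: "integrable \<rho> (I n)" for n
  proof (rule integrable_qT_bound[OF s\<rho> iq mI])
    show "norm (I n s) \<le> real (Suc n) * qT s" if "s \<in> torus" for s
      using qT_nonneg[OF that] by (auto simp: I_def indicator_def field_simps)
  qed
  have fR: "finite_measure (R n)" for n
  proof (rule finite_measureI)
    have "emeasure (R n) (space (R n)) = (\<integral>\<^sup>+s. ennreal (I n s) \<partial>\<rho>)"
      unfolding R_def using mI' by (subst emeasure_density) (auto intro!: nn_integral_cong)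
    then show "emeasure (R n) (space (R n)) \<noteq> \<infinity>"
      using integrableD(2)[OF iI] by simp
  qed
  have sR: "sets (R n) = sets Tb" for n
    by (simp add: R_def s\<rho>)
  show ?thesis
  proof (rule is_charT_limit[where \<phi>s = "\<lambda>n p. exp (\<integral>s. levy_D p s \<partial>R n)"])
    show "is_charT (\<lambda>p. exp (\<integral>s. levy_D p s \<partial>R n))" for n
      by (rule is_charT_levy_finite[OF fR sR])
    fix p
    have mD: "levy_D p \<in> borel_measurable \<rho>"
      by (intro borel_measurable_T s\<rho> continuous_on_levy_D)
    have "(\<lambda>n. \<integral>s. I n s *\<^sub>R levy_D p s \<partial>\<rho>) \<longlonglongrightarrow> (\<integral>s. levy_D p s \<partial>\<rho>)"
    proof (rule integral_dominated_convergence[where w = "\<lambda>s. cmod (levy_D p s)"])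
      show "(\<lambda>s. I n s *\<^sub>R levy_D p s) \<in> borel_measurable \<rho>" for n
        using mI' mD by measurable
      show "integrable \<rho> (\<lambda>s. cmod (levy_D p s))"
        by (intro integrable_norm integrable_levy_D s\<rho> iq)
      show "AE s in \<rho>. cmod (I n s *\<^sub>R levy_D p s) \<le> cmod (levy_D p s)" for n
        using I01 by (intro AE_I2) (simp add: mult_left_le_one_le)
      have "AE s in \<rho>. s \<noteq> ones"
        using z by (intro AE_I[where N = "{ones}"]) (auto simp: s\<rho>)
      moreover have "AE s in \<rho>. s \<in> torus"
        by (intro AE_I2) (simp add: space_T[OF s\<rho>])
      ultimately show "AE s in \<rho>. (\<lambda>n. I n s *\<^sub>R levy_D p s) \<longlonglongrightarrow> levy_D p s"
      proof eventually_elim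
        case (elim s)
        have "qT s > 0" using elim qT_pos by blast
        then obtain m where m: "1 / real (Suc m) < qT s"
          using reals_Archimedean[of "qT s"] by (auto simp: inverse_eq_divide)
        have "I n s *\<^sub>R levy_D p s = levy_D p s" if "n \<ge> m" for n
        proof -
          have "1 / real (Suc n) \<le> 1 / real (Suc m)"
            using that by (simp add: field_simps)
          then show ?thesis using m elim by (simp add: I_def)
        qed
        then show ?case
          by (intro tendsto_eventually) (auto simp: eventually_sequentially)
      qed
    qed (rule mD)
    moreover have "(\<integral>s. levy_D p s \<partial>R n) = (\<integral>s. I n s *\<^sub>R levy_D p s \<partial>\<rho>)" for n
      unfolding R_def using I01 by (intro integral_density mD mI') simp
    ultimately show "(\<lambda>n. exp (\<integral>s. levy_D p s \<partial>R n)) \<longlonglongrightarrow> exp (\<integral>s. levy_D p s \<partial>\<rho>)"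
      by (intro tendsto_exp) simp
  qed
qed

lemma levy_exponent_T_alt:
  "levy_exponent_T \<gamma> A \<rho> p = monom_T \<gamma> p *
     (exp (- (1/2) * complex_of_real ((A *v ivec p) \<bullet> ivec p)) * exp (\<integral>s. levy_D p s \<partial>\<rho>))"
  by (simp only: levy_exponent_T_def levy_D_def exp_add)

text \<open>Injectivity of \<open>charT\<close> makes the definite description in
  \<open>mult_ID\<close> well defined.\<close>

lemma mult_ID_spec:
  assumes "levy_triplet_T \<gamma> A \<rho>"
  shows "prob_T (mult_ID \<gamma> A \<rho>)" "charT (mult_ID \<gamma> A \<rho>) p = levy_exponent_T \<gamma> A \<rho> p"
proof -
  have "is_charT (levy_exponent_T \<gamma> A \<rho>)"
    unfolding levy_exponent_T_alt[abs_def] using assms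
    by (intro is_charT_mult is_charT_dirac is_charT_normal is_charT_levy) (auto simp: levy_triplet_T_def)
  then obtain \<nu> where \<nu>: "prob_T \<nu>" "\<And>p. charT \<nu> p = levy_exponent_T \<gamma> A \<rho> p"
    unfolding is_charT_def by blast
  have "mult_ID \<gamma> A \<rho> = \<nu>"
    unfolding mult_ID_def
  proof (rule the_equality)
    show "sets \<nu> = sets Tb \<and> prob_space \<nu> \<and> (\<forall>p. charT \<nu> p = levy_exponent_T \<gamma> A \<rho> p)"
      using \<nu> by (simp add: prob_T_def)
  next
    fix \<mu> assume "sets \<mu> = sets Tb \<and> prob_space \<mu> \<and> (\<forall>p. charT \<mu> p = levy_exponent_T \<gamma> A \<rho> p)"
    then show "\<mu> = \<nu>"
      using \<nu> by (intro charT_inj) (simp_all add: prob_T_def)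
  qed
  then show "prob_T (mult_ID \<gamma> A \<rho>)" "charT (mult_ID \<gamma> A \<rho>) p = levy_exponent_T \<gamma> A \<rho> p"
    using \<nu> by simp_all
qed

text \<open>Equality of laws is equality of the exponentials only: the exponents themselves may
  differ by multiples of \<open>2 * pi * \<i>\<close>.\<close>

lemma levy_class_iff:
  fixes \<rho> :: "(complex ^ 'd) measure"
  assumes "levy_measure_T \<rho>"
  shows "\<tau> \<in> levy_class \<rho> \<longleftrightarrow> levy_measure_T \<tau> \<and>
    (\<forall>p. exp (\<integral>s. levy_D p s \<partial>\<tau>) = exp (\<integral>s. levy_D p s \<partial>\<rho>))"
proof (cases "levy_measure_T \<tau>")
  case True
  have "(0 :: real ^ 'd ^ 'd) *v x = 0" for x
    by (simp add: matrix_vector_mult_def vec_eq_iff)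
  moreover have "transpose (0 :: real ^ 'd ^ 'd) = 0"
    by (simp add: transpose_def vec_eq_iff)
  ultimately have t: "levy_triplet_T ones (0 :: real ^ 'd ^ 'd) \<sigma>"
    and e: "levy_exponent_T ones (0 :: real ^ 'd ^ 'd) \<sigma> p = exp (\<integral>s. levy_D p s \<partial>\<sigma>)"
    if "levy_measure_T \<sigma>" for \<sigma> p
    using that by (simp_all add: levy_triplet_T_def levy_exponent_T_alt)
  have "mult_ID ones (0 :: real ^ 'd ^ 'd) \<rho> = mult_ID ones 0 \<tau> \<longleftrightarrow>
    (\<forall>p. charT (mult_ID ones (0 :: real ^ 'd ^ 'd) \<rho>) p = charT (mult_ID ones (0 :: real ^ 'd ^ 'd) \<tau>) p)"
    using charT_inj[OF mult_ID_spec(1)[OF t[OF assms]] mult_ID_spec(1)[OF t[OF True]]] by metis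
  then show ?thesis
    using True by (auto simp: levy_class_def mult_ID_spec(2)[OF t[OF assms]] mult_ID_spec(2)[OF t[OF True]]
        e[OF assms] e[OF True])
qed (simp add: levy_class_def)

section \<open>Centering by truncated means\<close>

text \<open>The angle of \<open>bvec\<close>, kept as a real number before any reduction modulo 2
  pi.\<close>

definition tmean :: "real \<Rightarrow> (complex ^ 'd) measure \<Rightarrow> 'd \<Rightarrow> real" where
  "tmean \<theta> \<nu> j = (\<integral>s. indicator (U_T \<theta>) s * Arg (s $ j) \<partial>\<nu>)"

definition shift :: "real \<Rightarrow> (complex ^ 'd) measure \<Rightarrow> complex ^ 'd \<Rightarrow> complex ^ 'd" where
  "shift \<theta> \<nu> s = (\<chi> j. s $ j / bvec \<theta> \<nu> $ j)"

lemma bvec_nth: "bvec \<theta> \<nu> $ j = cis (tmean \<theta> \<nu> j)"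
  by (simp add: bvec_def tmean_def)

lemma bvec_torus: "bvec \<theta> \<nu> \<in> torus"
  by (simp add: torus_def bvec_nth)

lemma shift_torus: "s \<in> torus \<Longrightarrow> shift \<theta> \<nu> s \<in> torus"
  by (simp add: torus_def shift_def norm_divide bvec_nth)

lemma shift_nth_cis: "s \<in> torus \<Longrightarrow> shift \<theta> \<nu> s $ j = cis (Arg (s $ j) - tmean \<theta> \<nu> j)"
  by (simp add: shift_def bvec_nth cis_divide[symmetric] cis_Arg_torus)

lemma continuous_on_shift: "continuous_on A (shift \<theta> \<nu>)"
  unfolding shift_def by (intro continuous_intros) (simp add: bvec_nth)

lemma measurable_shift: "shift \<theta> \<nu> \<in> measurable Tb Tb"
proof (rule measurable_to_Tb)
  show "(\<lambda>s. shift \<theta> \<nu> s $ j) \<in> borel_measurable Tb" for j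
    by (intro borel_measurable_Tb continuous_intros continuous_on_shift)
qed (simp add: shift_torus)

lemma centered_eq: "centered \<theta> \<nu> = distr \<nu> Tb (shift \<theta> \<nu>)"
  by (simp add: centered_def shift_def[abs_def])

lemma prob_T_centered: "prob_T \<nu> \<Longrightarrow> prob_T (centered \<theta> \<nu>)"
  unfolding centered_eq
  by (intro prob_T_distr prob_T_prob measurable_T[OF prob_T_sets measurable_shift])

lemma integral_centered:
  fixes f :: "complex ^ 'd \<Rightarrow> 'b::{banach, second_countable_topology}"
  assumes "prob_T \<nu>" "continuous_on torus f"
  shows "(\<integral>s. f s \<partial>centered \<theta> \<nu>) = (\<integral>s. f (shift \<theta> \<nu> s) \<partial>\<nu>)"
  unfolding centered_eq
  by (intro integral_distr measurable_T[OF prob_T_sets measurable_shift] assms borel_measurable_Tb)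

lemma charT_centered:
  assumes "prob_T \<nu>"
  shows "charT \<nu> p = monom_T (bvec \<theta> \<nu>) p * charT (centered \<theta> \<nu>) p"
proof -
  have "charT (centered \<theta> \<nu>) p = (\<integral>s. monom_T (shift \<theta> \<nu> s) p \<partial>\<nu>)"
    unfolding charT_def by (rule integral_centered[OF assms continuous_on_monom_T])
  then have "monom_T (bvec \<theta> \<nu>) p * charT (centered \<theta> \<nu>) p =
      (\<integral>s. monom_T (bvec \<theta> \<nu> * shift \<theta> \<nu> s) p \<partial>\<nu>)"
    by (simp add: monom_T_mult)
  moreover have "bvec \<theta> \<nu> * shift \<theta> \<nu> s = s" for s
    by (simp add: vec_eq_iff shift_def bvec_nth)
  ultimately show ?thesis by (simp add: charT_def)
qed

lemma integrable_indicator_T: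
  assumes "finite_measure M" "sets M = sets Tb" "B \<in> sets Tb"
  shows "integrable M (\<lambda>s. indicator B s :: real)"
  using assms(3)
  by (intro integrable_T_bounded[OF assms(1,2), of _ 1] borel_measurable_indicator) (auto simp: indicator_def)

lemma borel_measurable_argv [measurable]: "argv \<in> borel_measurable borel"
proof (subst borel_measurable_euclidean_space, intro ballI)
  fix i :: "real ^ 'a" assume "i \<in> Basis"
  then obtain j u where "i = axis j u" by (auto simp: Basis_vec_def)
  then show "(\<lambda>x. argv x \<bullet> i) \<in> borel_measurable borel"
    by (simp add: inner_axis argv_def)
qed

lemma measurable_id_Tb: "(\<lambda>s. s) \<in> measurable Tb borel"
  by (intro borel_measurable_Tb continuous_intros)

lemma argv_sets [simp]: "{s \<in> torus. \<epsilon> \<le> norm (argv s)} \<in> sets Tb"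
proof -
  have "{s. \<epsilon> \<le> norm (argv s)} \<in> sets (borel :: (complex ^ 'a) measure)"
    by measurable
  then have "{s. \<epsilon> \<le> norm (argv s)} \<inter> torus \<in> sets (borel :: (complex ^ 'a) measure)"
    using borel_closed[OF closed_torus] by blast
  then show ?thesis by (simp add: sets_Tb_iff Int_def conj_commute)
qed

lemma U_T_sets [simp]: "U_T \<epsilon> \<in> sets Tb"
proof -
  have "U_T \<epsilon> = torus - {s \<in> torus. \<epsilon> \<le> norm (argv s)}" by (auto simp: U_T_def)
  then show ?thesis using sets.Diff[OF torus_in_sets_Tb argv_sets] by metis
qed

lemma borel_measurable_Arg_nth_Tb: "(\<lambda>s. Arg (s $ j)) \<in> borel_measurable Tb"
  by (rule measurable_compose[OF measurable_id_Tb]) measurable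

lemma measure_ge_eq_integral:
  assumes "prob_T \<nu>"
  shows "measure \<nu> {s \<in> torus. \<epsilon> \<le> norm (argv s)} = (\<integral>s. indicator {s \<in> torus. \<epsilon> \<le> norm (argv s)} s \<partial>\<nu>)"
  using argv_sets[of \<epsilon>] prob_T_sets[OF assms] sets.sets_into_space[of _ \<nu>] by (simp add: Int_absorb2)

lemma abs_Arg_le_norm: "\<bar>Arg (s $ j)\<bar> \<le> norm (argv s)"
  using component_le_norm_cart[of "argv s" j] by (simp add: argv_def)

text \<open>Below \<epsilon> the angle itself is at most \<epsilon>; beyond it, truncation at
  \<theta> < 1 keeps the integrand below 1, so the tail contributes at most its mass.\<close>

lemma tmean_small:
  assumes \<nu>: "prob_T \<nu>" and \<theta>: "0 < \<theta>" "\<theta> < 1" and "0 < \<epsilon>"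
  shows "\<bar>tmean \<theta> \<nu> j\<bar> \<le> \<epsilon> + measure \<nu> {s \<in> torus. \<epsilon> \<le> norm (argv s)}"
proof -
  interpret prob_space \<nu> by (rule prob_T_prob[OF \<nu>])
  note s\<nu> = prob_T_sets[OF \<nu>]
  let ?I = "\<lambda>s. indicator {s \<in> torus. \<epsilon> \<le> norm (argv s)} s :: real"
  have i: "integrable \<nu> ?I"
    by (intro integrable_indicator_T prob_T_finite \<nu> s\<nu> argv_sets)
  have "\<bar>tmean \<theta> \<nu> j\<bar> \<le> (\<integral>s. \<bar>indicator (U_T \<theta>) s * Arg (s $ j)\<bar> \<partial>\<nu>)"
    unfolding tmean_def by (rule integral_abs_bound)
  also have "\<dots> \<le> (\<integral>s. \<epsilon> + ?I s \<partial>\<nu>)"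
  proof (rule integral_mono)
    show "integrable \<nu> (\<lambda>s. \<bar>indicator (U_T \<theta>) s * Arg (s $ j)\<bar>)"
    proof (rule integrable_T_bounded[OF prob_T_finite[OF \<nu>] s\<nu>, of _ 4])
      show "(\<lambda>s. \<bar>indicator (U_T \<theta>) s * Arg (s $ j)\<bar>) \<in> borel_measurable Tb"
        using borel_measurable_Arg_nth_Tb U_T_sets by measurable
      show "norm \<bar>indicator (U_T \<theta>) s * Arg (s $ j)\<bar> \<le> 4" for s
        using Arg_bounded[of "s $ j"] pi_less_4 by (auto simp: indicator_def)
    qed
    show "integrable \<nu> (\<lambda>s. \<epsilon> + ?I s)" using i by simp
    fix s assume "s \<in> space \<nu>"
    then have s: "s \<in> torus" by (simp add: space_T[OF s\<nu>])
    show "\<bar>indicator (U_T \<theta>) s * Arg (s $ j)\<bar> \<le> \<epsilon> + ?I s"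
      using s abs_Arg_le_norm[of s j] \<theta> \<open>0 < \<epsilon>\<close> by (auto simp: indicator_def U_T_def)
  qed
  also have "\<dots> = \<epsilon> + measure \<nu> {s \<in> torus. \<epsilon> \<le> norm (argv s)}"
    using i by (simp add: measure_ge_eq_integral[OF \<nu>] prob_space del: Bochner_Integration.integral_indicator)
  finally show ?thesis .
qed

lemma qT_shift:
  assumes "s \<in> torus"
  shows "qT (shift \<theta> \<nu> s) = (\<Sum>j\<in>UNIV. 1 - cos (Arg (s $ j) - tmean \<theta> \<nu> j))"
  by (simp add: qT_def shift_nth_cis[OF assms])

text \<open>Where the angle is below \<epsilon>, the shifted angle is at most 2 \<epsilon> and 1 -
  cos of it at most \<open>2 * \<epsilon>\<^sup>2\<close>; elsewhere 1 - cos is at most 2.\<close>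

lemma integral_qT_centered_small:
  fixes \<nu> :: "(complex ^ 'd) measure"
  assumes \<nu>: "prob_T \<nu>" and \<epsilon>: "0 < \<epsilon>" and m: "\<And>j. \<bar>tmean \<theta> \<nu> j\<bar> \<le> \<epsilon>"
  shows "(\<integral>s. qT s \<partial>centered \<theta> \<nu>) \<le>
    real CARD('d) * (2 * \<epsilon>\<^sup>2 + 2 * measure \<nu> {s \<in> torus. \<epsilon> \<le> norm (argv s)})"
proof -
  interpret prob_space \<nu> by (rule prob_T_prob[OF \<nu>])
  note s\<nu> = prob_T_sets[OF \<nu>]
  let ?I = "\<lambda>s. indicator {s \<in> torus. \<epsilon> \<le> norm (argv s)} s :: real"
  have i: "integrable \<nu> ?I"
    by (intro integrable_indicator_T prob_T_finite \<nu> s\<nu> argv_sets)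
  have "(\<integral>s. qT s \<partial>centered \<theta> \<nu>) = (\<integral>s. qT (shift \<theta> \<nu> s) \<partial>\<nu>)"
    by (intro integral_centered \<nu> continuous_intros)
  also have "\<dots> \<le> (\<integral>s. real CARD('d) * (2 * \<epsilon>\<^sup>2 + 2 * ?I s) \<partial>\<nu>)"
  proof (rule integral_mono)
    show "integrable \<nu> (\<lambda>s. qT (shift \<theta> \<nu> s))"
      by (intro integrable_T_continuous prob_T_finite \<nu> s\<nu> continuous_intros continuous_on_shift)
    show "integrable \<nu> (\<lambda>s. real CARD('d) * (2 * \<epsilon>\<^sup>2 + 2 * ?I s))"
      using i by simp
    fix s assume "s \<in> space \<nu>"
    then have s: "s \<in> torus" by (simp add: space_T[OF s\<nu>])
    have "1 - cos (Arg (s $ j) - tmean \<theta> \<nu> j) \<le> 2 * \<epsilon>\<^sup>2 + 2 * ?I s" for j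
    proof (cases "\<epsilon> \<le> norm (argv s)")
      case True
      have "- 1 \<le> cos (Arg (s $ j) - tmean \<theta> \<nu> j)" by (rule cos_ge_minus_one)
      moreover have "?I s = 1" using True s by simp
      ultimately show ?thesis using zero_le_power2[of \<epsilon>] by linarith
    next
      case False
      then have "\<bar>Arg (s $ j) - tmean \<theta> \<nu> j\<bar> \<le> 2 * \<epsilon>"
        using abs_Arg_le_norm[of s j] m[of j] by linarith
      then have "(Arg (s $ j) - tmean \<theta> \<nu> j)\<^sup>2 \<le> (2 * \<epsilon>)\<^sup>2"
        by (rule power2_le_iff_abs_le[THEN iffD2, rotated]) (use \<epsilon> in auto)
      then show ?thesis
        using one_minus_cos_le[of "Arg (s $ j) - tmean \<theta> \<nu> j"] False by (simp add: power_mult_distrib)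
    qed
    then show "qT (shift \<theta> \<nu> s) \<le> real CARD('d) * (2 * \<epsilon>\<^sup>2 + 2 * ?I s)"
      unfolding qT_shift[OF s] using sum_bounded_above[of "UNIV :: 'd set" _ "2 * \<epsilon>\<^sup>2 + 2 * ?I s"] by simp
  qed
  also have "\<dots> = real CARD('d) * (2 * \<epsilon>\<^sup>2 + 2 * measure \<nu> {s \<in> torus. \<epsilon> \<le> norm (argv s)})"
    using i by (simp add: measure_ge_eq_integral[OF \<nu>] prob_space del: Bochner_Integration.integral_indicator)
  finally show ?thesis .
qed

section \<open>First moments after centering\<close>

text \<open>A shift by up to h may carry an angle beyond pi; the overshoot is reflected to
  \<open>2 * pi - \<bar>y\<bar>\<close>, still at distance at least h from 0.\<close>

lemma one_minus_cos_off_zero: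
  assumes "0 < h" "h \<le> 1" "h \<le> \<bar>y\<bar>" "\<bar>y\<bar> \<le> pi + h"
  shows "h\<^sup>2 / 12 \<le> 1 - cos y"
proof -
  have h: "h \<le> pi / 2" using assms(2) pi_gt3 by simp
  have "cos y \<le> cos h"
  proof (cases "\<bar>y\<bar> \<le> pi")
    case True
    then have "cos \<bar>y\<bar> \<le> cos h" using assms by (intro cos_monotone_0_pi_le) auto
    then show ?thesis by simp
  next
    case False
    then have "cos (2 * pi - \<bar>y\<bar>) \<le> cos h" using assms h by (intro cos_monotone_0_pi_le) auto
    then show ?thesis by (simp add: cos_diff)
  qed
  then show ?thesis using one_minus_cos_ge[of h] assms h pi_gt_zero by linarith
qed

text \<open>The key estimate for the centered measures: because the truncated mean is removed, the mean
  of \<open>Im s\<close> is controlled by the second-order quantity \<open>qT\<close>.\<close>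

lemma integral_Im_centered:
  fixes \<nu> :: "(complex ^ 'd) measure"
  assumes \<nu>: "prob_T \<nu>" and \<theta>: "0 < \<theta>" "\<theta> < 1"
  defines "h \<equiv> \<theta> / (2 * real CARD('d))"
  assumes m: "\<And>j. \<bar>tmean \<theta> \<nu> j\<bar> \<le> h"
  shows "\<bar>\<integral>s. Im (s $ j) \<partial>centered \<theta> \<nu>\<bar> \<le> (4 + 24 / h\<^sup>2) * (\<integral>s. qT s \<partial>centered \<theta> \<nu>)"
proof -
  interpret prob_space \<nu> by (rule prob_T_prob[OF \<nu>])
  note s\<nu> = prob_T_sets[OF \<nu>]
  have card: "1 \<le> real CARD('d)" by (simp add: Suc_leI)
  have "0 < h" using \<theta> card by (simp add: h_def)
  moreover have "h * 1 \<le> h * (2 * real CARD('d))"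
    using card \<open>0 < h\<close> by (intro mult_left_mono) linarith+
  moreover have "h * (2 * real CARD('d)) = \<theta>" using card by (simp add: h_def)
  ultimately have h: "0 < h" "h \<le> 1" "h \<le> \<theta>" using \<theta> by auto
  let ?y = "\<lambda>s. Arg (s $ j) - tmean \<theta> \<nu> j" and ?U = "\<lambda>s. indicator (U_T \<theta>) s :: real"
  let ?q = "\<lambda>s. qT (shift \<theta> \<nu> s)"
  have q0: "0 \<le> ?q s" if "s \<in> torus" for s by (intro qT_nonneg shift_torus that)
  have qi: "1 - cos (Arg (s $ i) - tmean \<theta> \<nu> i) \<le> ?q s" if "s \<in> torus" for s i
    using component_le_qT[OF shift_torus[OF that], of \<theta> \<nu> i] by (simp add: shift_nth_cis[OF that])
  \<comment> \<open>Outside \<open>U_T \<theta>\<close> some coordinate has angle at least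
    \<theta>/d = 2 h. Removing a mean of size at most h leaves it at least h away from 0, so
    \<open>qT\<close> of the shifted point is at least \<open>h\<^sup>2 / 12\<close>.\<close>
  have out: "1 - ?U s \<le> 12 / h\<^sup>2 * ?q s" if s: "s \<in> torus" for s
  proof (cases "s \<in> U_T \<theta>")
    case True
    then show ?thesis using q0[OF s] by simp
  next
    case False
    then have "\<theta> \<le> norm (argv s)" using s by (simp add: U_T_def)
    also have "\<dots> \<le> (\<Sum>i\<in>UNIV. \<bar>Arg (s $ i)\<bar>)"
      using norm_le_l1_cart[of "argv s"] by (simp add: argv_def)
    finally have sum: "\<theta> \<le> (\<Sum>i\<in>UNIV. \<bar>Arg (s $ i)\<bar>)" .
    have "\<exists>i. 2 * h \<le> \<bar>Arg (s $ i)\<bar>"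
    proof (rule ccontr)
      assume "\<nexists>i. 2 * h \<le> \<bar>Arg (s $ i)\<bar>"
      then have "(\<Sum>i\<in>UNIV. \<bar>Arg (s $ i)\<bar>) < (\<Sum>i\<in>(UNIV :: 'd set). 2 * h)"
        by (intro sum_strict_mono) (auto simp: not_le)
      also have "\<dots> = \<theta>" using card by (simp add: h_def)
      finally show False using sum by simp
    qed
    then obtain i where i: "2 * h \<le> \<bar>Arg (s $ i)\<bar>" by blast
    have "\<bar>Arg (s $ i)\<bar> \<le> pi" using Arg_bounded[of "s $ i"] by auto
    then have "h\<^sup>2 / 12 \<le> 1 - cos (Arg (s $ i) - tmean \<theta> \<nu> i)"
      using i m[of i] h by (intro one_minus_cos_off_zero) auto
    then have "h\<^sup>2 / 12 \<le> ?q s" using qi[OF s, of i] by linarith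
    then show ?thesis using False h by (simp add: field_simps)
  qed
  have iU: "integrable \<nu> ?U"
    by (intro integrable_indicator_T prob_T_finite \<nu> s\<nu> U_T_sets)
  have iUA: "integrable \<nu> (\<lambda>s. ?U s * Arg (s $ j))"
  proof (rule integrable_T_bounded[OF prob_T_finite[OF \<nu>] s\<nu>, of _ 4])
    show "(\<lambda>s. ?U s * Arg (s $ j)) \<in> borel_measurable Tb"
      using borel_measurable_Arg_nth_Tb U_T_sets by measurable
    show "norm (?U s * Arg (s $ j)) \<le> 4" for s
      using Arg_bounded[of "s $ j"] pi_less_4 by (auto simp: indicator_def)
  qed
  have iUy: "integrable \<nu> (\<lambda>s. ?U s * ?y s)"
    using iU iUA by (simp add: right_diff_distrib)
  have iq: "integrable \<nu> ?q"
    by (intro integrable_T_continuous prob_T_finite \<nu> s\<nu> continuous_intros continuous_on_shift)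
  have iIm: "integrable \<nu> (\<lambda>s. Im (shift \<theta> \<nu> s $ j))"
    by (intro integrable_T_continuous prob_T_finite \<nu> s\<nu> continuous_intros continuous_on_shift)
  \<comment> \<open>Inside \<open>U_T \<theta>\<close> this is \<open>sin y - y\<close>, cubic,
    hence quadratic because y is at most 2; outside, Im is at most 1 and \<open>out\<close> pays for
    the set.\<close>
  have R: "\<bar>Im (shift \<theta> \<nu> s $ j) - ?U s * ?y s\<bar> \<le> (4 + 12 / h\<^sup>2) * ?q s" if s: "s \<in> torus" for s
  proof (cases "s \<in> U_T \<theta>")
    case True
    have y: "\<bar>?y s\<bar> \<le> 2"
      using True abs_Arg_le_norm[of s j] m[of j] h \<theta> by (auto simp: U_T_def)
    have "\<bar>sin (?y s) - ?y s\<bar> \<le> \<bar>?y s\<bar> ^ 3 / 6" by (rule abs_sin_diff_le)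
    also have "\<dots> = (\<bar>?y s\<bar> / 6) * (?y s)\<^sup>2"
      by (simp add: power2_eq_square eval_nat_numeral abs_mult_self_eq mult.assoc)
    also have "\<dots> \<le> (1 / 3) * (?y s)\<^sup>2" using y by (intro mult_right_mono) auto
    also have "\<dots> \<le> 4 * (1 - cos (?y s))"
      using one_minus_cos_ge[of "?y s"] y pi_gt3 by auto
    also have "\<dots> \<le> 4 * ?q s" using qi[OF s, of j] by simp
    also have "\<dots> \<le> (4 + 12 / h\<^sup>2) * ?q s" using q0[OF s] by (intro mult_right_mono) auto
    finally show ?thesis using True by (simp add: shift_nth_cis[OF s])
  next
    case False
    have "\<bar>Im (shift \<theta> \<nu> s $ j)\<bar> \<le> 1 - ?U s"
      using False by (simp add: shift_nth_cis[OF s])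
    also have "\<dots> \<le> 12 / h\<^sup>2 * ?q s" by (rule out[OF s])
    also have "\<dots> \<le> (4 + 12 / h\<^sup>2) * ?q s" using q0[OF s] by (intro mult_right_mono) auto
    finally show ?thesis using False by simp
  qed
  define a where "a = (\<integral>s. ?q s \<partial>\<nu>)"
  have a: "(\<integral>s. qT s \<partial>centered \<theta> \<nu>) = a"
    unfolding a_def by (intro integral_centered \<nu> continuous_intros)
  have "\<bar>(\<integral>s. Im (shift \<theta> \<nu> s $ j) \<partial>\<nu>) - (\<integral>s. ?U s * ?y s \<partial>\<nu>)\<bar> \<le> (4 + 12 / h\<^sup>2) * a"
  proof -
    have "\<bar>(\<integral>s. Im (shift \<theta> \<nu> s $ j) \<partial>\<nu>) - (\<integral>s. ?U s * ?y s \<partial>\<nu>)\<bar> =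
        \<bar>\<integral>s. Im (shift \<theta> \<nu> s $ j) - ?U s * ?y s \<partial>\<nu>\<bar>"
      using iIm iUy by simp
    also have "\<dots> \<le> (\<integral>s. \<bar>Im (shift \<theta> \<nu> s $ j) - ?U s * ?y s\<bar> \<partial>\<nu>)"
      by (rule integral_abs_bound)
    also have "\<dots> \<le> (\<integral>s. (4 + 12 / h\<^sup>2) * ?q s \<partial>\<nu>)"
      using iIm iUy iq R by (intro integral_mono) (auto simp: space_T[OF s\<nu>])
    finally show ?thesis by (simp add: a_def)
  qed
  moreover have "\<bar>\<integral>s. ?U s * ?y s \<partial>\<nu>\<bar> \<le> 12 / h\<^sup>2 * a"
  proof -
    \<comment> \<open>Here the centering acts: the integral of Arg over \<open>U_T \<theta>\<close>
      is \<open>tmean\<close> itself, so only \<open>tmean\<close> times the mass outside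
      survives.\<close>
    have "(\<integral>s. ?U s * ?y s \<partial>\<nu>) = tmean \<theta> \<nu> j - (\<integral>s. ?U s \<partial>\<nu>) * tmean \<theta> \<nu> j"
      using iU iUA by (simp add: right_diff_distrib tmean_def del: Bochner_Integration.integral_indicator)
    also have "\<dots> = tmean \<theta> \<nu> j * (\<integral>s. 1 - ?U s \<partial>\<nu>)"
      using iU by (simp add: prob_space algebra_simps del: Bochner_Integration.integral_indicator)
    finally have "\<bar>\<integral>s. ?U s * ?y s \<partial>\<nu>\<bar> = \<bar>tmean \<theta> \<nu> j\<bar> * \<bar>\<integral>s. 1 - ?U s \<partial>\<nu>\<bar>"
      by (simp add: abs_mult)
    also have "\<dots> \<le> 1 * (\<integral>s. 12 / h\<^sup>2 * ?q s \<partial>\<nu>)"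
    proof (rule mult_mono)
      show "\<bar>tmean \<theta> \<nu> j\<bar> \<le> 1" using m[of j] h by linarith
      have "0 \<le> (\<integral>s. 1 - ?U s \<partial>\<nu>)"
        by (intro integral_nonneg_AE AE_I2) (simp add: indicator_def)
      moreover have "(\<integral>s. 1 - ?U s \<partial>\<nu>) \<le> (\<integral>s. 12 / h\<^sup>2 * ?q s \<partial>\<nu>)"
        using iU iq out by (intro integral_mono) (auto simp: space_T[OF s\<nu>])
      ultimately show "\<bar>\<integral>s. 1 - ?U s \<partial>\<nu>\<bar> \<le> (\<integral>s. 12 / h\<^sup>2 * ?q s \<partial>\<nu>)" by simp
    qed auto
    finally show ?thesis by (simp add: a_def)
  qed
  moreover have "(\<integral>s. Im (s $ j) \<partial>centered \<theta> \<nu>) = (\<integral>s. Im (shift \<theta> \<nu> s $ j) \<partial>\<nu>)"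
    by (intro integral_centered \<nu> continuous_intros)
  \<comment> \<open>Two contributions of 12: one from replacing Im by the truncated angle, one from
    the mean of that angle.\<close>
  moreover have "(4 + 24 / h\<^sup>2) * a = (4 + 12 / h\<^sup>2) * a + 12 / h\<^sup>2 * a"
    by (simp add: algebra_simps add_divide_distrib[symmetric])
  ultimately show ?thesis unfolding a by linarith
qed

text \<open>The drift splits off because the measure is finite. It is the part that
  \<open>integral_Im_centered\<close> controls and that \<open>gamma_n\<close> collects.\<close>

lemma charT_minus_1:
  assumes "prob_T \<nu>"
  shows "charT \<nu> p - 1 = (\<integral>s. levy_D p s \<partial>\<nu>) + \<i> * of_real (ivec p \<bullet> (\<chi> j. \<integral>s. Im (s $ j) \<partial>\<nu>))"
proof -
  interpret prob_space \<nu> by (rule prob_T_prob[OF assms])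
  have i: "integrable \<nu> (\<lambda>s. monom_T s p)" "integrable \<nu> (\<lambda>s. ivec p \<bullet> imv s)"
    "integrable \<nu> (\<lambda>s. Im (s $ j))" for j
    by (intro integrable_T_continuous prob_T_finite prob_T_sets assms continuous_intros continuous_on_monom_T)+
  have "(\<integral>s. levy_D p s \<partial>\<nu>) = charT \<nu> p - 1 - \<i> * of_real (\<integral>s. ivec p \<bullet> imv s \<partial>\<nu>)"
    unfolding levy_D_def charT_def using i by (simp add: prob_space)
  also have "(\<integral>s. ivec p \<bullet> imv s \<partial>\<nu>) = ivec p \<bullet> (\<chi> j. \<integral>s. Im (s $ j) \<partial>\<nu>)"
    using i(3) by (simp add: inner_vec_def imv_def)
  finally show ?thesis by simp
qed

text \<open>The point is uniformity: C depends on p, \<theta> and the dimension, but not on the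
  measure, so it serves the whole array.\<close>

lemma charT_centered_bound:
  fixes p :: "int ^ 'd"
  assumes \<theta>: "0 < \<theta>" "\<theta> < 1"
  obtains C where "C \<ge> 0" "\<And>\<nu>. prob_T \<nu> \<Longrightarrow> (\<And>j. \<bar>tmean \<theta> \<nu> j\<bar> \<le> \<theta> / (2 * real CARD('d))) \<Longrightarrow>
    cmod (charT (centered \<theta> \<nu>) p - 1) \<le> C * (\<integral>s. qT s \<partial>centered \<theta> \<nu>)"
proof -
  define h where "h = \<theta> / (2 * real CARD('d))"
  define C1 where "C1 = 12 * ((norm (ivec p))\<^sup>2 + norm (ivec p))"
  define C2 where "C2 = (\<Sum>j\<in>UNIV. \<bar>ivec p $ j\<bar> * (4 + 24 / h\<^sup>2))"
  show thesis
  proof (rule that[of "C1 + C2"])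
    show "0 \<le> C1 + C2"
      unfolding C1_def C2_def by (intro add_nonneg_nonneg sum_nonneg mult_nonneg_nonneg) auto
    fix \<nu> :: "(complex ^ 'd) measure"
    assume \<nu>: "prob_T \<nu>" and m: "\<And>j. \<bar>tmean \<theta> \<nu> j\<bar> \<le> \<theta> / (2 * real CARD('d))"
    let ?c = "centered \<theta> \<nu>"
    note pc = prob_T_centered[OF \<nu>, of \<theta>]
    define a where "a = (\<integral>s. qT s \<partial>?c)"
    have "cmod (\<integral>s. levy_D p s \<partial>?c) \<le> (\<integral>s. cmod (levy_D p s) \<partial>?c)"
      by (rule integral_norm_bound)
    also have "\<dots> \<le> (\<integral>s. C1 * qT s \<partial>?c)"
    proof (rule integral_mono)
      show "integrable ?c (\<lambda>s. cmod (levy_D p s))" "integrable ?c (\<lambda>s. C1 * qT s)"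
        by (intro integrable_T_continuous prob_T_finite prob_T_sets pc continuous_intros continuous_on_levy_D)+
      show "cmod (levy_D p s) \<le> C1 * qT s" if "s \<in> space ?c" for s
        using levy_D_bound that unfolding C1_def space_T[OF prob_T_sets[OF pc]] by blast
    qed
    also have "\<dots> = C1 * a" by (simp add: a_def)
    finally have 1: "cmod (\<integral>s. levy_D p s \<partial>?c) \<le> C1 * a" .
    have "\<bar>ivec p \<bullet> (\<chi> j. \<integral>s. Im (s $ j) \<partial>?c)\<bar> \<le> (\<Sum>j\<in>UNIV. \<bar>ivec p $ j\<bar> * \<bar>\<integral>s. Im (s $ j) \<partial>?c\<bar>)"
      unfolding inner_vec_def by (rule order_trans[OF sum_abs]) (simp add: abs_mult)
    also have "\<dots> \<le> (\<Sum>j\<in>UNIV. \<bar>ivec p $ j\<bar> * ((4 + 24 / h\<^sup>2) * a))"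
      unfolding a_def h_def
      by (intro sum_mono mult_left_mono integral_Im_centered[OF \<nu> \<theta> m]) simp
    also have "\<dots> = C2 * a" by (simp add: C2_def sum_distrib_right mult.assoc)
    finally have 2: "\<bar>ivec p \<bullet> (\<chi> j. \<integral>s. Im (s $ j) \<partial>?c)\<bar> \<le> C2 * a" .
    have "cmod (charT ?c p - 1) \<le> cmod (\<integral>s. levy_D p s \<partial>?c) + \<bar>ivec p \<bullet> (\<chi> j. \<integral>s. Im (s $ j) \<partial>?c)\<bar>"
      unfolding charT_minus_1[OF pc] by (rule order_trans[OF norm_triangle_ineq]) (simp add: norm_mult)
    then show "cmod (charT ?c p - 1) \<le> (C1 + C2) * (\<integral>s. qT s \<partial>?c)"
      using 1 2 by (simp add: a_def algebra_simps)
  qed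
qed

lemma tendsto_of_norm_le:
  fixes f :: "nat \<Rightarrow> 'a::real_normed_vector"
  assumes "\<And>e. e > 0 \<Longrightarrow> \<forall>\<^sub>F n in sequentially. norm (f n) \<le> e"
  shows "f \<longlonglongrightarrow> 0"
proof (rule tendstoI)
  fix e :: real assume "e > 0"
  then have "\<forall>\<^sub>F n in sequentially. norm (f n) \<le> e / 2" by (intro assms) simp
  then show "\<forall>\<^sub>F n in sequentially. dist (f n) 0 < e"
    by eventually_elim (use \<open>e > 0\<close> in simp)
qed

section \<open>The accompanying infinitely divisible laws\<close>

lemma infinitesimal_prob_T: "infinitesimal_T \<nu> kn \<Longrightarrow> k \<in> {1..kn n} \<Longrightarrow> prob_T (\<nu> n k)"
  by (auto simp: infinitesimal_T_def)

lemma infinitesimal_tail: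
  assumes "infinitesimal_T \<nu> kn" "0 < \<epsilon>" "0 < \<delta>"
  shows "\<forall>\<^sub>F n in sequentially. \<forall>k\<in>{1..kn n}. measure (\<nu> n k) {s \<in> torus. \<epsilon> \<le> norm (argv s)} < \<delta>"
proof -
  let ?m = "\<lambda>n k. measure (\<nu> n k) {s \<in> torus. \<epsilon> \<le> norm (argv s)}"
  have "(\<lambda>n. Max (?m n ` {1..kn n})) \<longlonglongrightarrow> 0"
    using assms by (simp add: infinitesimal_T_def)
  then have "\<forall>\<^sub>F n in sequentially. Max (?m n ` {1..kn n}) < \<delta>"
    using assms(3) by (rule order_tendstoD)
  then show ?thesis
  proof eventually_elim
    case (elim n)
    have "?m n k \<le> Max (?m n ` {1..kn n})" if "k \<in> {1..kn n}" for k
      using that by (intro Max_ge) auto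
    then show ?case using elim by force
  qed
qed

lemma infinitesimal_small:
  fixes \<nu> :: "nat \<Rightarrow> nat \<Rightarrow> (complex ^ 'd) measure"
  assumes inf: "infinitesimal_T \<nu> kn" and \<theta>: "0 < \<theta>" "\<theta> < 1" and \<delta>: "0 < \<delta>"
  shows "\<forall>\<^sub>F n in sequentially. \<forall>k\<in>{1..kn n}.
    (\<forall>j. \<bar>tmean \<theta> (\<nu> n k) j\<bar> \<le> \<delta>) \<and> (\<integral>s. qT s \<partial>centered \<theta> (\<nu> n k)) \<le> \<delta>"
proof -
  define d where "d = real CARD('d)"
  have d: "1 \<le> d" by (simp add: d_def Suc_leI)
  \<comment> \<open>The bound on the integral of \<open>qT\<close> becomes at most
    \<open>4 * d * \<epsilon>\<close>, so the factor 8 leaves room to spare.\<close>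
  define \<epsilon> where "\<epsilon> = min 1 (\<delta> / (8 * d))"
  have \<epsilon>: "0 < \<epsilon>" "\<epsilon> \<le> 1" "d * (8 * \<epsilon>) \<le> \<delta>" "\<epsilon> * 8 \<le> \<delta>"
  proof -
    show "0 < \<epsilon>" "\<epsilon> \<le> 1" using \<delta> d by (auto simp: \<epsilon>_def)
    have "d * (8 * \<epsilon>) \<le> d * (8 * (\<delta> / (8 * d)))"
      using d by (intro mult_left_mono) (auto simp: \<epsilon>_def)
    also have "\<dots> = \<delta>" using d by simp
    finally show 1: "d * (8 * \<epsilon>) \<le> \<delta>" .
    have "1 * (8 * \<epsilon>) \<le> d * (8 * \<epsilon>)" using d \<open>0 < \<epsilon>\<close> by (intro mult_right_mono) auto
    then show "\<epsilon> * 8 \<le> \<delta>" using 1 by simp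
  qed
  \<comment> \<open>\<open>tmean_small\<close> adds a level and a tail mass; half of \<epsilon> is
    allotted to each.\<close>
  define \<epsilon>2 where "\<epsilon>2 = \<epsilon> / 2"
  have "0 < \<epsilon>2" using \<epsilon> by (simp add: \<epsilon>2_def)
  from infinitesimal_tail[OF inf this this] infinitesimal_tail[OF inf \<epsilon>(1) \<epsilon>(1)]
  show ?thesis
  proof eventually_elim
    case (elim n)
    show ?case
    proof (intro ballI)
      fix k assume k: "k \<in> {1..kn n}"
      note p = infinitesimal_prob_T[OF inf k]
      have m: "\<bar>tmean \<theta> (\<nu> n k) j\<bar> \<le> \<epsilon>" for j
        using tmean_small[OF p \<theta> \<open>0 < \<epsilon>2\<close>, of j] elim(1) k by (force simp: \<epsilon>2_def)
      have "(\<integral>s. qT s \<partial>centered \<theta> (\<nu> n k)) \<le>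
          d * (2 * \<epsilon>\<^sup>2 + 2 * measure (\<nu> n k) {s \<in> torus. \<epsilon> \<le> norm (argv s)})"
        unfolding d_def by (rule integral_qT_centered_small[OF p \<epsilon>(1) m])
      also have "\<dots> \<le> d * (2 * \<epsilon> + 2 * \<epsilon>)"
      proof (intro mult_left_mono add_mono)
        show "\<epsilon>\<^sup>2 \<le> \<epsilon>" using \<epsilon> by (simp add: power2_eq_square mult_left_le)
        show "measure (\<nu> n k) {s \<in> torus. \<epsilon> \<le> norm (argv s)} \<le> \<epsilon>" using elim(2) k by force
      qed (use d in auto)
      also have "\<dots> \<le> d * (8 * \<epsilon>)" using d \<epsilon> by (intro mult_left_mono) auto
      also have "\<dots> \<le> \<delta>" by (rule \<epsilon>)
      finally have "(\<integral>s. qT s \<partial>centered \<theta> (\<nu> n k)) \<le> \<delta>" .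
      moreover have "\<epsilon> \<le> \<delta>" using \<epsilon>(1,4) by linarith
      ultimately show "(\<forall>j. \<bar>tmean \<theta> (\<nu> n k) j\<bar> \<le> \<delta>) \<and> (\<integral>s. qT s \<partial>centered \<theta> (\<nu> n k)) \<le> \<delta>"
        using m by (blast intro: order_trans)
    qed
  qed
qed

lemma rho_n_eq: "rho_n \<theta> \<nu> kn n = sum_T {1..kn n} (\<lambda>k. centered \<theta> (\<nu> n k))"
  by (simp add: rho_n_def sum_T_def)

lemma sets_rho_n [simp]: "sets (rho_n \<theta> \<nu> kn n) = sets Tb"
  by (simp add: rho_n_eq)

text \<open>Characteristic function of the accompanying law. An atom of \<open>rho_n\<close> at
  \<open>ones\<close> does not matter, since \<open>levy_D\<close> vanishes there.\<close>

definition acc ::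
  "real \<Rightarrow> (nat \<Rightarrow> nat \<Rightarrow> (complex ^ 'd) measure) \<Rightarrow> (nat \<Rightarrow> nat) \<Rightarrow> (nat \<Rightarrow> complex ^ 'd) \<Rightarrow> nat \<Rightarrow> int ^ 'd \<Rightarrow> complex"
  where "acc \<theta> \<nu> kn \<xi> n p = monom_T (gamma_n \<theta> \<nu> kn \<xi> n) p * exp (\<integral>s. levy_D p s \<partial>rho_n \<theta> \<nu> kn n)"

context
  fixes \<nu> :: "nat \<Rightarrow> nat \<Rightarrow> (complex ^ 'd) measure" and kn :: "nat \<Rightarrow> nat" and \<theta> :: real
  assumes inf: "infinitesimal_T \<nu> kn"
begin

lemma sets_centered: "k \<in> {1..kn n} \<Longrightarrow> sets (centered \<theta> (\<nu> n k)) = sets Tb"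
  by (intro prob_T_sets prob_T_centered infinitesimal_prob_T[OF inf])

lemma finite_measure_rho_n: "finite_measure (rho_n \<theta> \<nu> kn n)"
  unfolding rho_n_eq
  by (intro finite_measure_sum_T sets_centered prob_T_finite prob_T_centered infinitesimal_prob_T[OF inf]) auto

lemma integral_rho_n_real:
  fixes f :: "complex ^ 'd \<Rightarrow> real"
  assumes "continuous_on torus f"
  shows "(\<integral>s. f s \<partial>rho_n \<theta> \<nu> kn n) = (\<Sum>k\<in>{1..kn n}. \<integral>s. f s \<partial>centered \<theta> (\<nu> n k))"
  unfolding rho_n_eq using assms
  by (intro integral_sum_T_real sets_centered borel_measurable_Tb integrable_T_continuous
      prob_T_finite prob_T_centered infinitesimal_prob_T[OF inf]) auto

lemma integral_rho_n:
  fixes f :: "complex ^ 'd \<Rightarrow> complex"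
  assumes "continuous_on torus f"
  shows "(\<integral>s. f s \<partial>rho_n \<theta> \<nu> kn n) = (\<Sum>k\<in>{1..kn n}. \<integral>s. f s \<partial>centered \<theta> (\<nu> n k))"
  unfolding rho_n_eq using assms
  by (intro integral_sum_T sets_centered borel_measurable_Tb integrable_T_continuous
      prob_T_finite prob_T_centered infinitesimal_prob_T[OF inf]) auto

lemma gamma_n_eq:
  "gamma_n \<theta> \<nu> kn \<xi> n = \<xi> n * (\<Prod>k\<in>{1..kn n}. bvec \<theta> (\<nu> n k) *
     (\<chi> j. cis ((\<chi> j. \<integral>s. Im (s $ j) \<partial>centered \<theta> (\<nu> n k)) $ j)))"
proof -
  have "cis (\<Sum>k\<in>I. Arg (bvec \<theta> (\<nu> n k) $ j) + x k) = (\<Prod>k\<in>I. bvec \<theta> (\<nu> n k) $ j * cis (x k))"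
    for I :: "nat set" and x j
    by (induction I rule: infinite_finite_induct)
      (simp_all add: cis_mult[symmetric] cis_Arg_torus bvec_torus)
  then show ?thesis
    by (simp add: vec_eq_iff gamma_n_def prod_vec_nth)
qed

text \<open>Poissonization factor by factor: f is replaced by \<open>exp (f - 1)\<close>. By
  \<open>charT_minus_1\<close>, the drifts stored in \<open>gamma_n\<close> recombine with the
  integrals of \<open>levy_D\<close>.\<close>

lemma acc_eq:
  "acc \<theta> \<nu> kn \<xi> n p = monom_T (\<xi> n) p * (\<Prod>k\<in>{1..kn n}. monom_T (bvec \<theta> (\<nu> n k)) p *
     exp (charT (centered \<theta> (\<nu> n k)) p - 1))"
proof -
  let ?c = "\<lambda>k. centered \<theta> (\<nu> n k)"
  let ?I = "\<lambda>k. \<chi> j. \<integral>s. Im (s $ j) \<partial>?c k"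
  have e1: "exp (\<integral>s. levy_D p s \<partial>rho_n \<theta> \<nu> kn n) = (\<Prod>k\<in>{1..kn n}. exp (\<integral>s. levy_D p s \<partial>?c k))"
    by (simp add: integral_rho_n[OF continuous_on_levy_D] exp_sum)
  have e2: "monom_T (gamma_n \<theta> \<nu> kn \<xi> n) p =
    monom_T (\<xi> n) p * (\<Prod>k\<in>{1..kn n}. monom_T (bvec \<theta> (\<nu> n k)) p * exp (\<i> * of_real (ivec p \<bullet> ?I k)))"
    by (simp only: gamma_n_eq monom_T_mult monom_T_prod monom_T_cis_vec cis_conv_exp[of "ivec p \<bullet> _"])
  have "exp (charT (?c k) p - 1) = exp (\<i> * of_real (ivec p \<bullet> ?I k)) * exp (\<integral>s. levy_D p s \<partial>?c k)"
    if "k \<in> {1..kn n}" for k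
    by (simp add: charT_minus_1[OF prob_T_centered[OF infinitesimal_prob_T[OF inf that]]] exp_add mult.commute)
  then have e3: "(\<Prod>k\<in>{1..kn n}. monom_T (bvec \<theta> (\<nu> n k)) p * exp (charT (?c k) p - 1)) =
    (\<Prod>k\<in>{1..kn n}. (monom_T (bvec \<theta> (\<nu> n k)) p * exp (\<i> * of_real (ivec p \<bullet> ?I k))) * exp (\<integral>s. levy_D p s \<partial>?c k))"
    by (intro prod.cong) (simp_all add: mult.assoc)
  show ?thesis
    unfolding acc_def e1 e2 e3 by (simp only: prod.distrib mult.assoc)
qed

lemma charT_conv_T_centered:
  assumes "\<xi> n \<in> torus"
  shows "charT (conv_T (\<xi> n) (\<nu> n) (kn n)) p =
    monom_T (\<xi> n) p * (\<Prod>k\<in>{1..kn n}. monom_T (bvec \<theta> (\<nu> n k)) p * charT (centered \<theta> (\<nu> n k)) p)"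
proof -
  have "charT (conv_T (\<xi> n) (\<nu> n) (kn n)) p = monom_T (\<xi> n) p * (\<Prod>k\<in>{1..kn n}. charT (\<nu> n k) p)"
    by (intro charT_conv_T assms infinitesimal_prob_T[OF inf])
  also have "(\<Prod>k\<in>{1..kn n}. charT (\<nu> n k) p) =
    (\<Prod>k\<in>{1..kn n}. monom_T (bvec \<theta> (\<nu> n k)) p * charT (centered \<theta> (\<nu> n k)) p)"
    by (intro prod.cong charT_centered infinitesimal_prob_T[OF inf]) auto
  finally show ?thesis .
qed

text \<open>Both products have factors in the unit disc, so they differ by at most the sum of the
  factorwise errors. Each error is quadratic in \<open>f - 1\<close>, hence at most a multiple of
  the squared integral of \<open>qT\<close> over one centered measure. One factor of the square is
  uniformly small, and the others sum to the integral over \<open>rho_n\<close>.\<close>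

lemma accompanying:
  assumes \<theta>: "0 < \<theta>" "\<theta> < 1" and \<xi>: "\<forall>n. \<xi> n \<in> torus"
    and M: "\<forall>\<^sub>F n in sequentially. (\<integral>s. qT s \<partial>rho_n \<theta> \<nu> kn n) \<le> M"
  shows "(\<lambda>n. charT (conv_T (\<xi> n) (\<nu> n) (kn n)) p - acc \<theta> \<nu> kn \<xi> n p) \<longlonglongrightarrow> 0"
proof -
  obtain C where C: "C \<ge> 0" "\<And>\<nu> :: (complex ^ 'd) measure. prob_T \<nu> \<Longrightarrow>
      (\<And>j. \<bar>tmean \<theta> \<nu> j\<bar> \<le> \<theta> / (2 * real CARD('d))) \<Longrightarrow>
      cmod (charT (centered \<theta> \<nu>) p - 1) \<le> C * (\<integral>s. qT s \<partial>centered \<theta> \<nu>)"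
    using charT_centered_bound[OF \<theta>, of p] by metis
  define h where "h = \<theta> / (2 * real CARD('d))"
  have h: "0 < h" using \<theta> by (simp add: h_def)
  define M' where "M' = \<bar>M\<bar> + 1"
  have M': "M' > 0" "M \<le> M'" by (auto simp: M'_def)
  show ?thesis
  proof (rule tendsto_of_norm_le)
    fix e :: real assume e: "e > 0"
    \<comment> \<open>The three bounds serve in turn the centering estimate, the condition
      \<open>cmod (f - 1) \<le> 1\<close> of the exponential estimate, and the final error
      e.\<close>
    define \<delta> where "\<delta> = Min {h, 1 / (C + 1), e / (3 * (C\<^sup>2 + 1) * M')}"
    have \<delta>: "0 < \<delta>" "\<delta> \<le> h" "C * \<delta> \<le> 1" "3 * C\<^sup>2 * \<delta> * M' \<le> e"
    proof -
      show "0 < \<delta>" "\<delta> \<le> h" using e h C(1) M' by (auto simp: \<delta>_def add_nonneg_pos)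
      have "C * \<delta> \<le> (C + 1) * (1 / (C + 1))"
        using C(1) \<open>0 < \<delta>\<close> by (intro mult_mono) (auto simp: \<delta>_def)
      then show "C * \<delta> \<le> 1" using C(1) by simp
      have "3 * C\<^sup>2 * \<delta> * M' \<le> 3 * (C\<^sup>2 + 1) * (e / (3 * (C\<^sup>2 + 1) * M')) * M'"
        using M' \<open>0 < \<delta>\<close> by (intro mult_right_mono mult_mono) (auto simp: \<delta>_def)
      also have "\<dots> = e" using M' zero_le_power2[of C] by (simp add: field_simps add_nonneg_eq_0_iff)
      finally show "3 * C\<^sup>2 * \<delta> * M' \<le> e" .
    qed
    show "\<forall>\<^sub>F n in sequentially. cmod (charT (conv_T (\<xi> n) (\<nu> n) (kn n)) p - acc \<theta> \<nu> kn \<xi> n p) \<le> e"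
      using infinitesimal_small[OF inf \<theta> \<delta>(1)] M
    proof eventually_elim
      case (elim n)
      let ?b = "\<lambda>k. monom_T (bvec \<theta> (\<nu> n k)) p" and ?f = "\<lambda>k. charT (centered \<theta> (\<nu> n k)) p"
      let ?a = "\<lambda>k. \<integral>s. qT s \<partial>centered \<theta> (\<nu> n k)"
      have pc: "prob_T (centered \<theta> (\<nu> n k))" if "k \<in> {1..kn n}" for k
        using that by (intro prob_T_centered infinitesimal_prob_T[OF inf])
      have f1: "cmod (?f k) \<le> 1" if "k \<in> {1..kn n}" for k
        by (rule norm_charT_le[OF pc[OF that]])
      have a0: "0 \<le> ?a k" if "k \<in> {1..kn n}" for k
        using qT_nonneg by (intro integral_nonneg_AE AE_I2) (simp add: space_T[OF prob_T_sets[OF pc[OF that]]])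
      have e1: "cmod (exp (?f k - 1)) \<le> 1" if "k \<in> {1..kn n}" for k
        using f1[OF that] complex_Re_le_cmod[of "?f k"] by simp
      have "cmod (charT (conv_T (\<xi> n) (\<nu> n) (kn n)) p - acc \<theta> \<nu> kn \<xi> n p) =
        cmod (monom_T (\<xi> n) p) * cmod ((\<Prod>k\<in>{1..kn n}. ?b k * ?f k) - (\<Prod>k\<in>{1..kn n}. ?b k * exp (?f k - 1)))"
        unfolding charT_conv_T_centered[of \<xi>, OF \<xi>[rule_format]] acc_eq
        by (simp only: norm_mult[symmetric] right_diff_distrib)
      also have "\<dots> = cmod ((\<Prod>k\<in>{1..kn n}. ?b k * ?f k) - (\<Prod>k\<in>{1..kn n}. ?b k * exp (?f k - 1)))"
        using \<xi> by (simp add: norm_monom_T)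
      also have "\<dots> \<le> (\<Sum>k\<in>{1..kn n}. cmod (?b k * ?f k - ?b k * exp (?f k - 1)))"
        using f1 e1 by (intro norm_prod_diff) (auto simp: norm_mult norm_monom_T[OF bvec_torus])
      also have "\<dots> \<le> (\<Sum>k\<in>{1..kn n}. 3 * C\<^sup>2 * \<delta> * ?a k)"
      proof (rule sum_mono)
        fix k assume k: "k \<in> {1..kn n}"
        have z: "cmod (?f k - 1) \<le> C * ?a k"
          proof (intro C(2) infinitesimal_prob_T[OF inf] k)
          show "\<bar>tmean \<theta> (\<nu> n k) j\<bar> \<le> \<theta> / (2 * real CARD('d))" for j
            using elim(1) k \<delta>(2) unfolding h_def by (blast intro: order_trans)
        qed
        also have "\<dots> \<le> C * \<delta>" using elim(1) k C(1) by (intro mult_left_mono) auto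
        finally have "cmod (?f k - 1) \<le> 1" using \<delta>(3) by linarith
        then have "cmod (exp (?f k - 1) - 1 - (?f k - 1)) \<le> 3 * (cmod (?f k - 1))\<^sup>2"
          by (rule norm_exp_minus_1_minus)
        also have "\<dots> \<le> 3 * (C * ?a k)\<^sup>2" using z by (intro mult_left_mono power_mono) auto
        also have "\<dots> = 3 * C\<^sup>2 * ?a k * ?a k" by (simp add: power2_eq_square)
        also have "\<dots> \<le> 3 * C\<^sup>2 * \<delta> * ?a k"
          using elim(1) k a0[OF k] by (intro mult_right_mono mult_left_mono) auto
        finally have "cmod (?f k - exp (?f k - 1)) \<le> 3 * C\<^sup>2 * \<delta> * ?a k"
          by (simp add: norm_minus_commute)
        then show "cmod (?b k * ?f k - ?b k * exp (?f k - 1)) \<le> 3 * C\<^sup>2 * \<delta> * ?a k"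
          by (simp add: right_diff_distrib[symmetric] norm_mult norm_monom_T[OF bvec_torus])
      qed
      also have "\<dots> = 3 * C\<^sup>2 * \<delta> * (\<integral>s. qT s \<partial>rho_n \<theta> \<nu> kn n)"
        by (subst integral_rho_n_real) (auto simp: sum_distrib_left intro!: continuous_intros)
      also have "\<dots> \<le> 3 * C\<^sup>2 * \<delta> * M'"
        using elim(2) M'(2) \<delta>(1) by (intro mult_left_mono) auto
      also have "\<dots> \<le> e" by (rule \<delta>)
      finally show ?case .
    qed
  qed
qed

end

section \<open>Double limits\<close>

text \<open>An epsilon-delta form of the two iterated limits in the Gaussian condition, n first and
  then \<epsilon>. It passes easily through sums, multiples, subsequences and rescaling of
  \<epsilon>.\<close>

definition DL :: "(real \<Rightarrow> nat \<Rightarrow> real) \<Rightarrow> real \<Rightarrow> bool" where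
  "DL F a \<longleftrightarrow> (\<forall>\<delta>>0. \<exists>\<epsilon>0>0. \<forall>\<epsilon>. 0 < \<epsilon> \<and> \<epsilon> < \<epsilon>0 \<longrightarrow> (\<forall>\<^sub>F n in sequentially. \<bar>F \<epsilon> n - a\<bar> < \<delta>))"

lemma DL_iff:
  "(((\<lambda>\<epsilon>. limsup (\<lambda>n. ereal (F \<epsilon> n))) \<longlongrightarrow> ereal a) (at_right 0) \<and>
    ((\<lambda>\<epsilon>. liminf (\<lambda>n. ereal (F \<epsilon> n))) \<longlongrightarrow> ereal a) (at_right 0)) \<longleftrightarrow> DL F a"
  (is "?L \<and> ?R \<longleftrightarrow> _")
proof
  assume *: "?L \<and> ?R"
  show "DL F a"
    unfolding DL_def
  proof (intro allI impI)
    fix \<delta> :: real assume \<delta>: "\<delta> > 0"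
    have "\<forall>\<^sub>F \<epsilon> in at_right 0. limsup (\<lambda>n. ereal (F \<epsilon> n)) < ereal (a + \<delta>)"
      using * \<delta> by (intro order_tendstoD(2)[where y = "ereal a"]) auto
    moreover have "\<forall>\<^sub>F \<epsilon> in at_right 0. ereal (a - \<delta>) < liminf (\<lambda>n. ereal (F \<epsilon> n))"
      using * \<delta> by (intro order_tendstoD(1)[where y = "ereal a"]) auto
    ultimately have "\<forall>\<^sub>F \<epsilon> in at_right 0. \<forall>\<^sub>F n in sequentially. \<bar>F \<epsilon> n - a\<bar> < \<delta>"
    proof eventually_elim
      case (elim \<epsilon>)
      from Limsup_lessD[OF elim(1)] less_LiminfD[OF elim(2)] show ?case
        by eventually_elim auto
    qed
    then show "\<exists>\<epsilon>0>0. \<forall>\<epsilon>. 0 < \<epsilon> \<and> \<epsilon> < \<epsilon>0 \<longrightarrow> (\<forall>\<^sub>F n in sequentially. \<bar>F \<epsilon> n - a\<bar> < \<delta>)"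
      unfolding eventually_at_right_field by auto
  qed
next
  assume DL: "DL F a"
  have ev: "\<forall>\<^sub>F \<epsilon> in at_right 0. ereal (a - \<delta>) \<le> liminf (\<lambda>n. ereal (F \<epsilon> n)) \<and>
      limsup (\<lambda>n. ereal (F \<epsilon> n)) \<le> ereal (a + \<delta>)" if "\<delta> > 0" for \<delta>
  proof -
    obtain \<epsilon>0 where \<epsilon>0: "\<epsilon>0 > 0" "\<And>\<epsilon>. 0 < \<epsilon> \<Longrightarrow> \<epsilon> < \<epsilon>0 \<Longrightarrow> \<forall>\<^sub>F n in sequentially. \<bar>F \<epsilon> n - a\<bar> < \<delta>"
      using DL \<open>\<delta> > 0\<close> unfolding DL_def by meson
    have "ereal (a - \<delta>) \<le> liminf (\<lambda>n. ereal (F \<epsilon> n)) \<and> limsup (\<lambda>n. ereal (F \<epsilon> n)) \<le> ereal (a + \<delta>)"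
      if "0 < \<epsilon>" "\<epsilon> < \<epsilon>0" for \<epsilon>
    proof
      show "ereal (a - \<delta>) \<le> liminf (\<lambda>n. ereal (F \<epsilon> n))"
        by (rule Liminf_bounded) (use \<epsilon>0(2)[OF that] in eventually_elim, auto)
      show "limsup (\<lambda>n. ereal (F \<epsilon> n)) \<le> ereal (a + \<delta>)"
        by (rule Limsup_bounded) (use \<epsilon>0(2)[OF that] in eventually_elim, auto)
    qed
    then show ?thesis
      unfolding eventually_at_right_field using \<epsilon>0(1) by blast
  qed
  \<comment> \<open>With this, the four order conditions for the two limits reduce to a lower bound
    on liminf and an upper bound on limsup.\<close>
  have le: "liminf (\<lambda>n. ereal (F \<epsilon> n)) \<le> limsup (\<lambda>n. ereal (F \<epsilon> n))" for \<epsilon>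
    by (rule Liminf_le_Limsup) simp
  have lower: "\<forall>\<^sub>F \<epsilon> in at_right 0. y < liminf (\<lambda>n. ereal (F \<epsilon> n))" if y: "y < ereal a" for y
  proof -
    obtain r where r: "y < ereal r" "ereal r < ereal a" using ereal_dense2[OF y] by blast
    then have "a - r > 0" by simp
    from ev[OF this] show ?thesis
      by eventually_elim (use r in auto)
  qed
  have upper: "\<forall>\<^sub>F \<epsilon> in at_right 0. limsup (\<lambda>n. ereal (F \<epsilon> n)) < y" if y: "ereal a < y" for y
  proof -
    obtain r where r: "ereal a < ereal r" "ereal r < y" using ereal_dense2[OF y] by blast
    then have "r - a > 0" by simp
    from ev[OF this] show ?thesis
      by eventually_elim (use r in auto)
  qed
  show "?L \<and> ?R"
  proof (intro conjI order_tendstoI)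
    show "\<forall>\<^sub>F \<epsilon> in at_right 0. y < liminf (\<lambda>n. ereal (F \<epsilon> n))" if "y < ereal a" for y
      by (rule lower[OF that])
    show "\<forall>\<^sub>F \<epsilon> in at_right 0. limsup (\<lambda>n. ereal (F \<epsilon> n)) < y" if "ereal a < y" for y
      by (rule upper[OF that])
    show "\<forall>\<^sub>F \<epsilon> in at_right 0. y < limsup (\<lambda>n. ereal (F \<epsilon> n))" if "y < ereal a" for y
      using lower[OF that] by eventually_elim (use le in \<open>blast intro: less_le_trans\<close>)
    show "\<forall>\<^sub>F \<epsilon> in at_right 0. liminf (\<lambda>n. ereal (F \<epsilon> n)) < y" if "ereal a < y" for y
      using upper[OF that] by eventually_elim (use le in \<open>blast intro: le_less_trans\<close>)
  qed
qed

lemma DL_add: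
  assumes "DL F a" "DL G b"
  shows "DL (\<lambda>\<epsilon> n. F \<epsilon> n + G \<epsilon> n) (a + b)"
  unfolding DL_def
proof (intro allI impI)
  fix \<delta> :: real assume "\<delta> > 0"
  then have \<delta>: "\<delta> / 2 > 0" by simp
  obtain x where x: "x > 0" "\<And>\<epsilon>. 0 < \<epsilon> \<Longrightarrow> \<epsilon> < x \<Longrightarrow> \<forall>\<^sub>F n in sequentially. \<bar>F \<epsilon> n - a\<bar> < \<delta> / 2"
    using assms(1) \<delta> unfolding DL_def by meson
  obtain y where y: "y > 0" "\<And>\<epsilon>. 0 < \<epsilon> \<Longrightarrow> \<epsilon> < y \<Longrightarrow> \<forall>\<^sub>F n in sequentially. \<bar>G \<epsilon> n - b\<bar> < \<delta> / 2"
    using assms(2) \<delta> unfolding DL_def by meson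
  show "\<exists>\<epsilon>0>0. \<forall>\<epsilon>. 0 < \<epsilon> \<and> \<epsilon> < \<epsilon>0 \<longrightarrow> (\<forall>\<^sub>F n in sequentially. \<bar>F \<epsilon> n + G \<epsilon> n - (a + b)\<bar> < \<delta>)"
  proof (intro exI[of _ "min x y"] conjI allI impI)
    fix \<epsilon> assume "0 < \<epsilon> \<and> \<epsilon> < min x y"
    then have "\<forall>\<^sub>F n in sequentially. \<bar>F \<epsilon> n - a\<bar> < \<delta> / 2" "\<forall>\<^sub>F n in sequentially. \<bar>G \<epsilon> n - b\<bar> < \<delta> / 2"
      using x(2)[of \<epsilon>] y(2)[of \<epsilon>] by simp_all
    then show "\<forall>\<^sub>F n in sequentially. \<bar>F \<epsilon> n + G \<epsilon> n - (a + b)\<bar> < \<delta>"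
      by eventually_elim linarith
  qed (use x y in auto)
qed

lemma DL_cmult:
  assumes "DL F a"
  shows "DL (\<lambda>\<epsilon> n. c * F \<epsilon> n) (c * a)"
  unfolding DL_def
proof (intro allI impI)
  fix \<delta> :: real assume "\<delta> > 0"
  then have \<delta>: "\<delta> / (\<bar>c\<bar> + 1) > 0" by simp
  obtain x where x: "x > 0" "\<And>\<epsilon>. 0 < \<epsilon> \<Longrightarrow> \<epsilon> < x \<Longrightarrow> \<forall>\<^sub>F n in sequentially. \<bar>F \<epsilon> n - a\<bar> < \<delta> / (\<bar>c\<bar> + 1)"
    using assms \<delta> unfolding DL_def by meson
  show "\<exists>\<epsilon>0>0. \<forall>\<epsilon>. 0 < \<epsilon> \<and> \<epsilon> < \<epsilon>0 \<longrightarrow> (\<forall>\<^sub>F n in sequentially. \<bar>c * F \<epsilon> n - c * a\<bar> < \<delta>)"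
  proof (intro exI[of _ x] conjI allI impI)
    fix \<epsilon> assume "0 < \<epsilon> \<and> \<epsilon> < x"
    then have "\<forall>\<^sub>F n in sequentially. \<bar>F \<epsilon> n - a\<bar> < \<delta> / (\<bar>c\<bar> + 1)" using x(2)[of \<epsilon>] by simp
    then show "\<forall>\<^sub>F n in sequentially. \<bar>c * F \<epsilon> n - c * a\<bar> < \<delta>"
    proof eventually_elim
      case (elim n)
      have "\<bar>c * F \<epsilon> n - c * a\<bar> = \<bar>c\<bar> * \<bar>F \<epsilon> n - a\<bar>"
        by (simp add: right_diff_distrib[symmetric] abs_mult)
      also have "\<dots> \<le> (\<bar>c\<bar> + 1) * \<bar>F \<epsilon> n - a\<bar>" by (intro mult_right_mono) auto
      also have "\<dots> < \<delta>" using elim by (simp add: field_simps)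
      finally show ?case .
    qed
  qed (use x in auto)
qed

lemma DL_zero: "DL (\<lambda>_ _. 0) 0"
  unfolding DL_def by (auto intro: exI[of _ 1])

lemma DL_sum:
  assumes "\<And>i. i \<in> I \<Longrightarrow> DL (F i) (a i)"
  shows "DL (\<lambda>\<epsilon> n. \<Sum>i\<in>I. F i \<epsilon> n) (\<Sum>i\<in>I. a i)"
  using assms
  by (induction I rule: infinite_finite_induct) (auto intro: DL_zero DL_add)

lemma DL_subseq:
  assumes "DL F a" "strict_mono r"
  shows "DL (\<lambda>\<epsilon> n. F \<epsilon> (r n)) a"
  using assms eventually_subseq[OF assms(2)] unfolding DL_def by meson

text \<open>The iterated limit is blind to a constant factor in \<epsilon>, so neighbourhoods of
  different shape give the same condition.\<close>

lemma DL_squeeze: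
  assumes DL: "DL F a" and c: "0 < c" "0 < c'"
    and le: "\<And>\<epsilon> n. 0 < \<epsilon> \<Longrightarrow> F (c * \<epsilon>) n \<le> G \<epsilon> n" "\<And>\<epsilon> n. 0 < \<epsilon> \<Longrightarrow> G \<epsilon> n \<le> F (c' * \<epsilon>) n"
  shows "DL G a"
  unfolding DL_def
proof (intro allI impI)
  fix \<delta> :: real assume "\<delta> > 0"
  then obtain x where x: "x > 0" "\<And>\<epsilon>. 0 < \<epsilon> \<Longrightarrow> \<epsilon> < x \<Longrightarrow> \<forall>\<^sub>F n in sequentially. \<bar>F \<epsilon> n - a\<bar> < \<delta>"
    using DL unfolding DL_def by meson
  show "\<exists>\<epsilon>0>0. \<forall>\<epsilon>. 0 < \<epsilon> \<and> \<epsilon> < \<epsilon>0 \<longrightarrow> (\<forall>\<^sub>F n in sequentially. \<bar>G \<epsilon> n - a\<bar> < \<delta>)"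
  proof (intro exI[of _ "min (x / c) (x / c')"] conjI allI impI)
    fix \<epsilon> assume e: "0 < \<epsilon> \<and> \<epsilon> < min (x / c) (x / c')"
    then have "\<forall>\<^sub>F n in sequentially. \<bar>F (c * \<epsilon>) n - a\<bar> < \<delta>" "\<forall>\<^sub>F n in sequentially. \<bar>F (c' * \<epsilon>) n - a\<bar> < \<delta>"
      using c x(2)[of "c * \<epsilon>"] x(2)[of "c' * \<epsilon>"] by (simp_all add: field_simps)
    then show "\<forall>\<^sub>F n in sequentially. \<bar>G \<epsilon> n - a\<bar> < \<delta>"
    proof eventually_elim
      case (elim n)
      then show ?case using le[of \<epsilon> n] e by (simp add: abs_less_iff)
    qed
  qed (use x c in auto)
qed

section \<open>Cutoff functions\<close>

text \<open>A continuous substitute for the indicator of \<open>U_T \<epsilon>\<close>: 1 where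
  \<open>qT \<le> \<epsilon>\<^sup>2\<close>, 0 where
  \<open>qT \<ge> 2 * \<epsilon>\<^sup>2\<close>. As a function of \<open>qT\<close> it is also
  invariant under complex conjugation.\<close>

definition cutoff :: "real \<Rightarrow> complex ^ 'd \<Rightarrow> real" where
  "cutoff \<epsilon> s = max 0 (min 1 (2 - qT s / \<epsilon>\<^sup>2))"

lemma cutoff_bounds: "0 \<le> cutoff \<epsilon> s" "cutoff \<epsilon> s \<le> 1"
  by (auto simp: cutoff_def)

lemma continuous_on_cutoff [continuous_intros]: "continuous_on A f \<Longrightarrow> continuous_on A (\<lambda>x. cutoff \<epsilon> (f x))"
  unfolding cutoff_def divide_inverse by (intro continuous_intros)

lemma dist_ones_sq:
  assumes "s \<in> torus"
  shows "(dist s ones)\<^sup>2 = 2 * qT s"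
proof -
  have "(dist s ones)\<^sup>2 = (\<Sum>j\<in>UNIV. (cmod (s $ j - 1))\<^sup>2)"
    by (simp add: dist_norm norm_vec_def L2_set_def sum_nonneg)
  moreover have "(cmod (s $ j - 1))\<^sup>2 = 2 * (1 - Re (s $ j))" for j
    using torusD[OF assms, of j] cmod_power2[of "s $ j"] cmod_power2[of "s $ j - 1"]
    by (simp add: power2_eq_square algebra_simps)
  ultimately show ?thesis by (simp add: qT_def sum_distrib_left)
qed

lemma cutoff_eq_1:
  assumes "0 < \<epsilon>" "qT s \<le> \<epsilon>\<^sup>2"
  shows "cutoff \<epsilon> s = 1"
proof -
  have "qT s / \<epsilon>\<^sup>2 \<le> 1" using assms by (simp add: field_simps)
  then show ?thesis by (simp add: cutoff_def)
qed

lemma cutoff_eq_0: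
  assumes "0 < \<epsilon>" "2 * \<epsilon>\<^sup>2 \<le> qT s"
  shows "cutoff \<epsilon> s = 0"
proof -
  have "2 \<le> qT s / \<epsilon>\<^sup>2" using assms by (simp add: field_simps)
  then show ?thesis by (simp add: cutoff_def)
qed

lemma cutoff_near_ones:
  assumes "0 < \<epsilon>" "s \<in> torus" "dist s ones < \<epsilon>"
  shows "cutoff \<epsilon> s = 1"
proof (rule cutoff_eq_1[OF assms(1)])
  have "(dist s ones)\<^sup>2 \<le> \<epsilon>\<^sup>2" using assms by (intro power_mono) auto
  then show "qT s \<le> \<epsilon>\<^sup>2" using dist_ones_sq[OF assms(2)] qT_nonneg[OF assms(2)] by linarith
qed

lemma indicator_le_cutoff:
  assumes "0 < \<epsilon>" "s \<in> torus"
  shows "indicator (U_T \<epsilon>) s \<le> cutoff \<epsilon> s"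
proof (cases "s \<in> U_T \<epsilon>")
  case True
  then have "(norm (argv s))\<^sup>2 \<le> \<epsilon>\<^sup>2" by (intro power_mono) (auto simp: U_T_def)
  then have "qT s \<le> \<epsilon>\<^sup>2" using qT_le_norm_argv[OF assms(2)] zero_le_power2[of \<epsilon>] by linarith
  then show ?thesis using cutoff_eq_1[OF assms(1), of s] by (simp add: indicator_def)
qed (simp add: cutoff_bounds)

text \<open>The constant 5: the squared angle is at most 12 \<open>qT\<close>, which is below
  \<open>24 * \<epsilon>\<^sup>2\<close> on the support of the cutoff.\<close>

lemma cutoff_norm_argv:
  assumes "0 < \<epsilon>" "s \<in> torus" "cutoff \<epsilon> s \<noteq> 0"
  shows "norm (argv s) < 5 * \<epsilon>"
proof -
  have "qT s < 2 * \<epsilon>\<^sup>2" using cutoff_eq_0[OF assms(1)] assms(3) by (meson not_le)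
  then have "(norm (argv s))\<^sup>2 < 25 * \<epsilon>\<^sup>2"
    using norm_argv_le[OF assms(2)] assms(1) zero_less_power[OF assms(1), of 2] by linarith
  also have "\<dots> = (5 * \<epsilon>)\<^sup>2" by (simp add: power_mult_distrib)
  finally show ?thesis by (rule power_less_imp_less_base) (use assms(1) in simp)
qed

lemma cutoff_le_indicator:
  assumes "0 < \<epsilon>" "s \<in> torus"
  shows "cutoff \<epsilon> s \<le> indicator (U_T (5 * \<epsilon>)) s"
  using cutoff_norm_argv[OF assms] assms(2) cutoff_bounds[of \<epsilon> s]
  by (cases "cutoff \<epsilon> s = 0") (auto simp: U_T_def indicator_def)

lemma cutoff_mono:
  assumes "0 < \<epsilon>" "\<epsilon> \<le> \<epsilon>'" "s \<in> torus"
  shows "cutoff \<epsilon> s \<le> cutoff \<epsilon>' s"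
proof -
  have "\<epsilon>\<^sup>2 \<le> \<epsilon>'\<^sup>2" using assms by (intro power_mono) auto
  then have "qT s / \<epsilon>'\<^sup>2 \<le> qT s / \<epsilon>\<^sup>2"
    using assms qT_nonneg[OF assms(3)] by (intro divide_left_mono) auto
  then show ?thesis by (auto simp: cutoff_def)
qed

lemma abs_cutoff_qT_le:
  assumes "s \<in> torus"
  shows "\<bar>cutoff \<epsilon> s * qT s\<bar> \<le> qT s"
proof -
  have "cutoff \<epsilon> s * qT s \<le> 1 * qT s"
    by (intro mult_right_mono cutoff_bounds qT_nonneg assms)
  then show ?thesis using cutoff_bounds[of \<epsilon> s] qT_nonneg[OF assms] by simp
qed

lemma cutoff_qT_tendsto:
  assumes "s \<in> torus"
  shows "(\<lambda>m. cutoff (1 / real (Suc m)) s * qT s) \<longlonglongrightarrow> 0"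
proof (cases "qT s = 0")
  case False
  then have q: "0 < qT s" using qT_nonneg[OF assms] by simp
  then obtain m where m: "1 / real (Suc m) < qT s / 2"
    using reals_Archimedean[of "qT s / 2"] by (auto simp: inverse_eq_divide)
  have "cutoff (1 / real (Suc n)) s * qT s = 0" if "n \<ge> m" for n
  proof -
    have "1 / real (Suc n) \<le> 1 / real (Suc m)" using that by (simp add: field_simps)
    moreover have "(1 / real (Suc n))\<^sup>2 \<le> 1 / real (Suc n)"
      using mult_left_le[of "1 / real (Suc n)" "1 / real (Suc n)"] by (simp add: power2_eq_square)
    ultimately have "2 * (1 / real (Suc n))\<^sup>2 \<le> qT s" using m by linarith
    then show ?thesis by (subst cutoff_eq_0) auto
  qed
  then show ?thesis by (intro tendsto_eventually) (auto simp: eventually_sequentially)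
qed simp

text \<open>Dominated convergence along radii 1/(m + 1), then monotonicity of the cutoff to reach
  all smaller radii. No mass of \<open>qT \<tau>\<close> sits at \<open>ones\<close>, where
  \<open>qT\<close> vanishes.\<close>

lemma integral_cutoff_qT_small:
  fixes \<tau> :: "(complex ^ 'd) measure"
  assumes "sets \<tau> = sets Tb" "integrable \<tau> qT" "0 < \<delta>"
  shows "\<exists>\<epsilon>0>0. \<forall>\<epsilon>. 0 < \<epsilon> \<and> \<epsilon> < \<epsilon>0 \<longrightarrow> (\<integral>s. cutoff \<epsilon> s * qT s \<partial>\<tau>) < \<delta>"
proof -
  have i: "integrable \<tau> (\<lambda>s. cutoff \<epsilon> s * qT s)" for \<epsilon>
    by (intro integrable_qT_bound[OF assms(1,2), of _ 1] borel_measurable_Tb continuous_intros)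
      (simp add: abs_cutoff_qT_le)
  have "(\<lambda>m. \<integral>s. cutoff (1 / real (Suc m)) s * qT s \<partial>\<tau>) \<longlonglongrightarrow> (\<integral>s. 0 \<partial>\<tau>)"
  proof (rule integral_dominated_convergence[where w = qT])
    show "(\<lambda>s. cutoff (1 / real (Suc m)) s * qT s) \<in> borel_measurable \<tau>" for m
      by (intro borel_measurable_T assms continuous_intros)
    show "AE s in \<tau>. norm (cutoff (1 / real (Suc m)) s * qT s) \<le> qT s" for m
      by (intro AE_I2) (simp add: space_T[OF assms(1)] abs_cutoff_qT_le)
    show "AE s in \<tau>. (\<lambda>m. cutoff (1 / real (Suc m)) s * qT s) \<longlonglongrightarrow> 0"
      using cutoff_qT_tendsto by (intro AE_I2) (auto simp: space_T[OF assms(1)])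
  qed (use assms in auto)
  then have "\<forall>\<^sub>F m in sequentially. (\<integral>s. cutoff (1 / real (Suc m)) s * qT s \<partial>\<tau>) < \<delta>"
    using assms(3) by (intro order_tendstoD) auto
  then obtain m where m: "(\<integral>s. cutoff (1 / real (Suc m)) s * qT s \<partial>\<tau>) < \<delta>"
    by (auto simp: eventually_sequentially)
  show ?thesis
  proof (intro exI[of _ "1 / real (Suc m)"] conjI allI impI)
    fix \<epsilon> assume e: "0 < \<epsilon> \<and> \<epsilon> < 1 / real (Suc m)"
    have "(\<integral>s. cutoff \<epsilon> s * qT s \<partial>\<tau>) \<le> (\<integral>s. cutoff (1 / real (Suc m)) s * qT s \<partial>\<tau>)"
      using e qT_nonneg
      by (intro integral_mono i mult_right_mono cutoff_mono) (auto simp: space_T[OF assms(1)])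
    then show "(\<integral>s. cutoff \<epsilon> s * qT s \<partial>\<tau>) < \<delta>" using m by simp
  qed simp
qed

section \<open>Vague convergence away from the neutral element\<close>

definition vague :: "(nat \<Rightarrow> (complex ^ 'd) measure) \<Rightarrow> (complex ^ 'd) measure \<Rightarrow> bool" where
  "vague R \<tau> \<longleftrightarrow> (\<forall>f :: complex ^ 'd \<Rightarrow> real. continuous_on torus f \<longrightarrow>
     (\<exists>\<delta>>0. \<forall>s\<in>torus. dist s ones < \<delta> \<longrightarrow> f s = 0) \<longrightarrow> (\<lambda>n. \<integral>s. f s \<partial>R n) \<longlonglongrightarrow> (\<integral>s. f s \<partial>\<tau>))"

text \<open>A test function vanishes at \<open>ones\<close>, so removing the atom there leaves its
  integral unchanged; compactness of the torus makes it bounded.\<close>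

lemma Mtilde_conv_iff_vague:
  fixes R :: "nat \<Rightarrow> (complex ^ 'd) measure"
  assumes "\<And>n. sets (R n) = sets Tb"
  shows "Mtilde_conv (\<lambda>n. density (R n) (indicator (torus - {ones}))) \<tau> \<longleftrightarrow> vague R \<tau>"
proof -
  have b: "bounded (f ` torus)" if "continuous_on torus f" for f :: "complex ^ 'd \<Rightarrow> real"
    using that compact_torus by (intro compact_imp_bounded compact_continuous_image)
  have int: "(\<integral>s. f s \<partial>density (R n) (indicator (torus - {ones}))) = (\<integral>s. f s \<partial>R n)"
    if f: "continuous_on torus f" "f ones = 0" for f :: "complex ^ 'd \<Rightarrow> real" and n
  proof -
    have m: "(\<lambda>s. indicator (torus - {ones}) s :: real) \<in> borel_measurable (R n)"
    proof (rule borel_measurable_indicator)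
      show "torus - {ones} \<in> sets (R n)"
        unfolding assms by (rule sets.Diff) auto
    qed
    have "density (R n) (indicator (torus - {ones})) = density (R n) (\<lambda>s. ennreal (indicator (torus - {ones}) s))"
      by (simp add: ennreal_indicator)
    then have "(\<integral>s. f s \<partial>density (R n) (indicator (torus - {ones}))) =
        (\<integral>s. indicator (torus - {ones}) s *\<^sub>R f s \<partial>R n)"
      using borel_measurable_T[OF assms f(1)] m by (simp add: integral_density)
    also have "\<dots> = (\<integral>s. f s \<partial>R n)"
      using f(2) by (intro integral_T_cong assms) (auto simp: indicator_def)
    finally show ?thesis .
  qed
  have z: "f ones = 0" if "\<exists>\<delta>>0. \<forall>s\<in>torus. dist s ones < \<delta> \<longrightarrow> f s = 0" for f :: "complex ^ 'd \<Rightarrow> real"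
    using that by force
  show ?thesis
    unfolding Mtilde_conv_def vague_def
  proof (intro iff_allI iffI impI)
    fix f :: "complex ^ 'd \<Rightarrow> real"
    assume *: "continuous_on torus f \<and> bounded (f ` torus) \<and> (\<exists>\<delta>>0. \<forall>s\<in>torus. dist s ones < \<delta> \<longrightarrow> f s = 0) \<longrightarrow>
        (\<lambda>n. \<integral>s. f s \<partial>density (R n) (indicator (torus - {ones}))) \<longlonglongrightarrow> (\<integral>s. f s \<partial>\<tau>)"
      and f: "continuous_on torus f" "\<exists>\<delta>>0. \<forall>s\<in>torus. dist s ones < \<delta> \<longrightarrow> f s = 0"
    then show "(\<lambda>n. \<integral>s. f s \<partial>R n) \<longlonglongrightarrow> (\<integral>s. f s \<partial>\<tau>)"
      using int[OF f(1) z[OF f(2)]] b[OF f(1)] by simp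
  next
    fix f :: "complex ^ 'd \<Rightarrow> real"
    assume *: "continuous_on torus f \<longrightarrow> (\<exists>\<delta>>0. \<forall>s\<in>torus. dist s ones < \<delta> \<longrightarrow> f s = 0) \<longrightarrow>
        (\<lambda>n. \<integral>s. f s \<partial>R n) \<longlonglongrightarrow> (\<integral>s. f s \<partial>\<tau>)"
      and f: "continuous_on torus f \<and> bounded (f ` torus) \<and> (\<exists>\<delta>>0. \<forall>s\<in>torus. dist s ones < \<delta> \<longrightarrow> f s = 0)"
    then show "(\<lambda>n. \<integral>s. f s \<partial>density (R n) (indicator (torus - {ones}))) \<longlonglongrightarrow> (\<integral>s. f s \<partial>\<tau>)"
      using int[of f] z[of f] by simp
  qed
qed

lemma vague_cutoff:
  fixes f :: "complex ^ 'd \<Rightarrow> real"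
  assumes "vague R \<tau>" "0 < \<epsilon>" "continuous_on torus f"
  shows "(\<lambda>n. \<integral>s. (1 - cutoff \<epsilon> s) * f s \<partial>R n) \<longlonglongrightarrow> (\<integral>s. (1 - cutoff \<epsilon> s) * f s \<partial>\<tau>)"
proof -
  have "continuous_on torus (\<lambda>s. (1 - cutoff \<epsilon> s) * f s)"
    by (intro continuous_intros assms)
  moreover have "\<exists>\<delta>>0. \<forall>s\<in>torus. dist s ones < \<delta> \<longrightarrow> (1 - cutoff \<epsilon> s) * f s = 0"
    using cutoff_near_ones[OF assms(2)] assms(2) by (intro exI[of _ \<epsilon>]) auto
  ultimately show ?thesis using assms(1) by (simp add: vague_def)
qed

text \<open>\<open>1 - cutoff \<epsilon>\<close> lives on a closed set at distance \<epsilon> from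
  \<open>ones\<close>, where \<tau> is finite.\<close>

lemma integrable_Mtilde_cutoff:
  fixes f :: "complex ^ 'd \<Rightarrow> real"
  assumes \<tau>: "\<tau> \<in> Mtilde" and "0 < \<epsilon>" "continuous_on torus f"
  shows "integrable \<tau> (\<lambda>s. (1 - cutoff \<epsilon> s) * f s)"
proof -
  have s\<tau>: "sets \<tau> = sets Tb" using \<tau> by (simp add: Mtilde_def)
  define B :: "(complex ^ 'd) set" where "B = {s \<in> torus. \<epsilon> \<le> dist s ones}"
  have "closed B"
  proof -
    have "B = torus \<inter> {s. \<epsilon> \<le> dist s ones}" by (auto simp: B_def)
    also have "closed \<dots>"
      by (intro closed_Int closed_torus closed_Collect_le continuous_intros)
    finally show ?thesis .
  qed
  then have B: "B \<in> sets Tb" by (auto simp: sets_Tb_iff B_def)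
  have "emeasure \<tau> B < \<infinity>"
    using \<tau> B \<open>0 < \<epsilon>\<close> unfolding Mtilde_def by (auto simp: B_def)
  then have iB: "integrable \<tau> (\<lambda>s. indicator B s :: real)"
    using B s\<tau> by (simp add: integrable_indicator_iff)
  have c: "continuous_on torus (\<lambda>s. (1 - cutoff \<epsilon> s) * f s)"
    by (intro continuous_intros assms)
  obtain b where b: "b > 0" "\<And>s. s \<in> torus \<Longrightarrow> norm ((1 - cutoff \<epsilon> s) * f s) \<le> b"
    using continuous_on_torus_bounded[OF c] by blast
  show ?thesis
  proof (rule Bochner_Integration.integrable_bound[OF integrable_mult_right[OF iB, of b]])
    show "(\<lambda>s. (1 - cutoff \<epsilon> s) * f s) \<in> borel_measurable \<tau>"
      by (rule borel_measurable_T[OF s\<tau> c])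
    show "AE s in \<tau>. norm ((1 - cutoff \<epsilon> s) * f s) \<le> norm (b * indicator B s)"
    proof (rule AE_I2)
      fix s assume "s \<in> space \<tau>"
      then have s: "s \<in> torus" by (simp add: space_T[OF s\<tau>])
      show "norm ((1 - cutoff \<epsilon> s) * f s) \<le> norm (b * indicator B s)"
      proof (cases "s \<in> B")
        case True
        then show ?thesis using b(2)[OF s] b(1) by simp
      next
        case False
        then have "cutoff \<epsilon> s = 1" using s by (intro cutoff_near_ones assms) (auto simp: B_def)
        then show ?thesis by simp
      qed
    qed
  qed
qed

text \<open>Fatou: each outer integral of \<open>qT\<close> passes to the vague limit and stays
  below M, and the outer integrands tend to \<open>qT\<close>. This is what turns a limit point into
  a Levy measure.\<close>

lemma integrable_qT_of_vague:
  assumes \<tau>: "\<tau> \<in> Mtilde" and R: "\<And>n. finite_measure (R n)" "\<And>n. sets (R n) = sets Tb"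
    and v: "vague R \<tau>" and M: "\<forall>\<^sub>F n in sequentially. (\<integral>s. qT s \<partial>R n) \<le> M"
  shows "integrable \<tau> qT"
proof -
  have s\<tau>: "sets \<tau> = sets Tb" using \<tau> by (simp add: Mtilde_def)
  have M0: "0 \<le> M"
  proof -
    obtain n where "(\<integral>s. qT s \<partial>R n) \<le> M"
      using M by (auto simp: eventually_sequentially)
    moreover have "0 \<le> (\<integral>s. qT s \<partial>R n)"
      using qT_nonneg by (intro integral_nonneg_AE AE_I2) (simp add: space_T[OF R(2)])
    ultimately show ?thesis by linarith
  qed
  define f where "f m s = (1 - cutoff (1 / real (Suc m)) s) * qT s" for m and s :: "complex ^ 'a"
  have f0: "0 \<le> f m s" if "s \<in> torus" for m s
    unfolding f_def using qT_nonneg[OF that] cutoff_bounds(2) by (intro mult_nonneg_nonneg) auto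
  have fq: "f m s \<le> qT s" if "s \<in> torus" for m s
    using qT_nonneg[OF that] cutoff_bounds[of "1 / real (Suc m)" s]
    by (simp add: f_def mult_left_le_one_le)
  have cq: "continuous_on torus qT" by (intro continuous_intros)
  have cf: "continuous_on torus (f m)" for m
    unfolding f_def by (intro continuous_intros)
  have le: "(\<integral>s. f m s \<partial>\<tau>) \<le> M" for m
  proof (rule tendsto_upperbound)
    show "(\<lambda>n. \<integral>s. f m s \<partial>R n) \<longlonglongrightarrow> (\<integral>s. f m s \<partial>\<tau>)"
      unfolding f_def by (rule vague_cutoff[OF v _ cq]) simp
    show "\<forall>\<^sub>F n in sequentially. (\<integral>s. f m s \<partial>R n) \<le> M"
      using M
    proof eventually_elim
      case (elim n)
      have "(\<integral>s. f m s \<partial>R n) \<le> (\<integral>s. qT s \<partial>R n)"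
        using fq by (intro integral_mono integrable_T_continuous R cf cq) (simp add: space_T[OF R(2)])
      then show ?case using elim by simp
    qed
  qed simp
  have "(\<integral>\<^sup>+s. ennreal (qT s) \<partial>\<tau>) = (\<integral>\<^sup>+s. liminf (\<lambda>m. ennreal (f m s)) \<partial>\<tau>)"
  proof (rule nn_integral_cong)
    fix s assume "s \<in> space \<tau>"
    then have s: "s \<in> torus" by (simp add: space_T[OF s\<tau>])
    have "(\<lambda>m. qT s - cutoff (1 / real (Suc m)) s * qT s) \<longlonglongrightarrow> qT s - 0"
      by (intro tendsto_intros cutoff_qT_tendsto s)
    then have "(\<lambda>m. f m s) \<longlonglongrightarrow> qT s" by (simp add: f_def left_diff_distrib)
    then have "(\<lambda>m. ennreal (f m s)) \<longlonglongrightarrow> ennreal (qT s)" by (rule tendsto_ennrealI)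
    then show "ennreal (qT s) = liminf (\<lambda>m. ennreal (f m s))"
      by (intro lim_imp_Liminf[symmetric]) auto
  qed
  also have "\<dots> \<le> liminf (\<lambda>m. \<integral>\<^sup>+s. ennreal (f m s) \<partial>\<tau>)"
    using borel_measurable_T[OF s\<tau> cf] by (intro nn_integral_liminf) simp
  also have "\<dots> \<le> ennreal M"
  proof -
    have "(\<integral>\<^sup>+s. ennreal (f m s) \<partial>\<tau>) \<le> ennreal M" for m
    proof -
      have "integrable \<tau> (f m)"
        unfolding f_def by (rule integrable_Mtilde_cutoff[OF \<tau> _ cq]) simp
      then have "(\<integral>\<^sup>+s. ennreal (f m s) \<partial>\<tau>) = ennreal (\<integral>s. f m s \<partial>\<tau>)"
        using f0 by (intro nn_integral_eq_integral AE_I2) (auto simp: space_T[OF s\<tau>])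
      then show ?thesis using le[of m] by (simp add: ennreal_leI)
    qed
    then show ?thesis
      by (intro Liminf_le) auto
  qed
  finally have "(\<integral>\<^sup>+s. ennreal (qT s) \<partial>\<tau>) < \<infinity>" by (simp add: le_less_trans)
  moreover have "(\<integral>\<^sup>+s. ennreal (norm (qT s)) \<partial>\<tau>) = (\<integral>\<^sup>+s. ennreal (qT s) \<partial>\<tau>)"
    by (intro nn_integral_cong) (simp add: space_T[OF s\<tau>] qT_nonneg)
  ultimately show ?thesis
    using borel_measurable_T[OF s\<tau> cq] by (simp add: integrable_iff_bounded)
qed

section \<open>Convergence of the Levy exponents\<close>

text \<open>Near \<open>ones\<close> the Levy integrand is \<open>- sqf p s / 2\<close> up to third
  order.\<close>

definition sqf :: "int ^ 'd \<Rightarrow> complex ^ 'd \<Rightarrow> real" where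
  "sqf p s = (ivec p \<bullet> imv s)\<^sup>2"

lemma continuous_on_sqf [continuous_intros]: "continuous_on A f \<Longrightarrow> continuous_on A (\<lambda>x. sqf p (f x))"
  unfolding sqf_def by (intro continuous_intros)

text \<open>The outer part of the exponent converges vaguely. The inner part is
  \<open>- sqf p / 2\<close> up to an error of order \<epsilon> times the integral of
  \<open>qT\<close>, so it contributes - Q/2, while the inner part of \<tau> itself vanishes with
  \<epsilon>. Thus Q is the second-order mass that concentrates at the neutral element.\<close>

lemma integral_levy_D_conv:
  assumes R: "\<And>n. finite_measure (R n)" "\<And>n. sets (R n) = sets Tb"
    and \<tau>: "sets \<tau> = sets Tb" "integrable \<tau> qT"
    and v: "vague R \<tau>" and M: "\<forall>\<^sub>F n in sequentially. (\<integral>s. qT s \<partial>R n) \<le> M"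
    and DL: "DL (\<lambda>\<epsilon> n. \<integral>s. cutoff \<epsilon> s * sqf p s \<partial>R n) Q"
  shows "(\<lambda>n. \<integral>s. levy_D p s \<partial>R n) \<longlonglongrightarrow> - of_real Q / 2 + (\<integral>s. levy_D p s \<partial>\<tau>)"
proof (rule tendsto_approx)
  fix e :: real assume e: "e > 0"
  define C1 where "C1 = 12 * ((norm (ivec p))\<^sup>2 + norm (ivec p))"
  define C2 where "C2 = 12 * (norm (ivec p) ^ 3 + (norm (ivec p))\<^sup>2 + norm (ivec p))"
  have C: "0 \<le> C1" "0 \<le> C2" by (simp_all add: C1_def C2_def)
  define M' where "M' = \<bar>M\<bar> + 1"
  have M': "0 < M'" "M \<le> M'" by (auto simp: M'_def)
  obtain x where x: "x > 0" "\<And>\<epsilon>. 0 < \<epsilon> \<Longrightarrow> \<epsilon> < x \<Longrightarrow>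
      \<forall>\<^sub>F n in sequentially. \<bar>(\<integral>s. cutoff \<epsilon> s * sqf p s \<partial>R n) - Q\<bar> < e"
    using DL e unfolding DL_def by meson
  obtain y where y: "y > 0" "\<And>\<epsilon>. 0 < \<epsilon> \<Longrightarrow> \<epsilon> < y \<Longrightarrow> (\<integral>s. cutoff \<epsilon> s * qT s \<partial>\<tau>) < e / (C1 + 1)"
    using integral_cutoff_qT_small[OF \<tau>, of "e / (C1 + 1)"] e C(1) by (auto simp: add_nonneg_pos)
  \<comment> \<open>Solved from \<open>(C2 + 1) * (5 * z) * M' = e / 2\<close>, the bound for the
    third-order error.\<close>
  define z where "z = e / (10 * (C2 + 1) * M')"
  have z: "z > 0" using e C(2) M' by (simp add: z_def add_nonneg_pos)
  \<comment> \<open>The entry 1/5 keeps the angle below 1 on the support of the cutoff, as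
    \<open>levy_D_quadratic\<close> requires.\<close>
  define \<epsilon> where "\<epsilon> = Min {x, y, z, 1/5} / 2"
  have \<epsilon>: "0 < \<epsilon>" "\<epsilon> < x" "\<epsilon> < y" "\<epsilon> \<le> z" "5 * \<epsilon> \<le> 1"
    using x(1) y(1) z by (auto simp: \<epsilon>_def min_def)
  let ?c = "cutoff \<epsilon>" and ?D = "levy_D p"
  have cD: "continuous_on torus ?D" by (rule continuous_on_levy_D)
  have cpt: "(\<integral>s. complex_of_real (1 - ?c s) * ?D s \<partial>N) =
      Complex (\<integral>s. (1 - ?c s) * Re (?D s) \<partial>N) (\<integral>s. (1 - ?c s) * Im (?D s) \<partial>N)"
    if "integrable N (\<lambda>s. complex_of_real (1 - ?c s) * ?D s)" for N
  proof (rule complex_eqI)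
    show "Re (\<integral>s. complex_of_real (1 - ?c s) * ?D s \<partial>N) = Re (Complex (\<integral>s. (1 - ?c s) * Re (?D s) \<partial>N) (\<integral>s. (1 - ?c s) * Im (?D s) \<partial>N))"
      by (subst integral_Re[OF that, symmetric]) simp
    show "Im (\<integral>s. complex_of_real (1 - ?c s) * ?D s \<partial>N) = Im (Complex (\<integral>s. (1 - ?c s) * Re (?D s) \<partial>N) (\<integral>s. (1 - ?c s) * Im (?D s) \<partial>N))"
      by (subst integral_Im[OF that, symmetric]) simp
  qed
  have iR: "integrable (R n) f" if "continuous_on torus f" for f :: "complex ^ 'a \<Rightarrow> 'b::{banach, second_countable_topology}" and n
    by (intro integrable_T_continuous R that)
  have iR1: "integrable (R n) (\<lambda>s. complex_of_real (1 - ?c s) * ?D s)"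
    and iR2: "integrable (R n) (\<lambda>s. complex_of_real (?c s) * ?D s)" for n
    by (intro iR continuous_intros cD)+
  have i\<tau>: "integrable \<tau> ?D" by (rule integrable_levy_D[OF \<tau>])
  have b1: "cmod (complex_of_real (1 - ?c s) * ?D s) \<le> C1 * qT s"
    and b2: "cmod (complex_of_real (?c s) * ?D s) \<le> C1 * (?c s * qT s)" if "s \<in> torus" for s
  proof -
    have D: "cmod (?D s) \<le> C1 * qT s" unfolding C1_def by (rule levy_D_bound[OF that])
    have "(1 - ?c s) * cmod (?D s) \<le> 1 * (C1 * qT s)"
      using D cutoff_bounds[of \<epsilon> s] by (intro mult_mono) auto
    then show "cmod (complex_of_real (1 - ?c s) * ?D s) \<le> C1 * qT s"
      using cutoff_bounds[of \<epsilon> s] by (simp add: norm_mult del: of_real_diff)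
    have "?c s * cmod (?D s) \<le> ?c s * (C1 * qT s)"
      using D cutoff_bounds[of \<epsilon> s] by (intro mult_left_mono) auto
    then show "cmod (complex_of_real (?c s) * ?D s) \<le> C1 * (?c s * qT s)"
      using cutoff_bounds[of \<epsilon> s] by (simp add: norm_mult mult_ac)
  qed
  have i\<tau>1: "integrable \<tau> (\<lambda>s. complex_of_real (1 - ?c s) * ?D s)"
    using b1 by (intro integrable_qT_bound[OF \<tau>] borel_measurable_Tb continuous_intros cD)
  have i\<tau>2: "integrable \<tau> (\<lambda>s. complex_of_real (?c s) * ?D s)"
    using Bochner_Integration.integrable_diff[OF i\<tau> i\<tau>1] by (simp add: algebra_simps)
  \<comment> \<open>The comparison sequence keeps the outer part and replaces the inner one by its
    limiting value.\<close>
  let ?Jn = "\<lambda>n. (\<integral>s. complex_of_real (1 - ?c s) * ?D s \<partial>R n) - of_real Q / 2"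
  let ?J = "(\<integral>s. complex_of_real (1 - ?c s) * ?D s \<partial>\<tau>) - of_real Q / 2"
  show "\<exists>J Jn. Jn \<longlonglongrightarrow> J \<and> (\<forall>\<^sub>F n in sequentially. norm ((\<integral>s. levy_D p s \<partial>R n) - Jn n) \<le> e) \<and>
      norm (- of_real Q / 2 + (\<integral>s. levy_D p s \<partial>\<tau>) - J) \<le> e"
  proof (intro exI[of _ ?J] exI[of _ ?Jn] conjI)
    show "?Jn \<longlonglongrightarrow> ?J"
      unfolding cpt[OF iR1] cpt[OF i\<tau>1]
      by (intro tendsto_intros tendsto_Complex vague_cutoff[OF v \<epsilon>(1)] continuous_intros cD)
    have split: "(\<integral>s. ?D s \<partial>N) = (\<integral>s. complex_of_real (1 - ?c s) * ?D s \<partial>N) + (\<integral>s. complex_of_real (?c s) * ?D s \<partial>N)"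
      if "integrable N (\<lambda>s. complex_of_real (1 - ?c s) * ?D s)" "integrable N (\<lambda>s. complex_of_real (?c s) * ?D s)" for N
      by (subst Bochner_Integration.integral_add[OF that, symmetric]) (simp add: algebra_simps)
    have "norm (- of_real Q / 2 + (\<integral>s. ?D s \<partial>\<tau>) - ?J) = norm (\<integral>s. complex_of_real (?c s) * ?D s \<partial>\<tau>)"
      using split[OF i\<tau>1 i\<tau>2] by simp
    also have "\<dots> \<le> (\<integral>s. norm (complex_of_real (?c s) * ?D s) \<partial>\<tau>)"
      by (rule integral_norm_bound)
    also have "\<dots> \<le> (\<integral>s. C1 * (?c s * qT s) \<partial>\<tau>)"
    proof (rule integral_mono)
      show "integrable \<tau> (\<lambda>s. C1 * (?c s * qT s))"
        by (intro integrable_mult_right integrable_qT_bound[OF \<tau>, of _ 1] borel_measurable_Tb continuous_intros)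
          (simp add: abs_cutoff_qT_le)
    qed (use b2 i\<tau>2 in \<open>auto simp: space_T[OF \<tau>(1)]\<close>)
    also have "\<dots> = C1 * (\<integral>s. ?c s * qT s \<partial>\<tau>)" by simp
    also have "\<dots> \<le> C1 * (e / (C1 + 1))"
      using y(2)[OF \<epsilon>(1,3)] C(1) by (intro mult_left_mono) auto
    also have "\<dots> \<le> e" using C(1) e by (simp add: field_simps)
    finally show "norm (- of_real Q / 2 + (\<integral>s. ?D s \<partial>\<tau>) - ?J) \<le> e" .
    show "\<forall>\<^sub>F n in sequentially. norm ((\<integral>s. ?D s \<partial>R n) - ?Jn n) \<le> e"
      using x(2)[OF \<epsilon>(1,2)] M
    proof eventually_elim
      case (elim n)
      let ?S = "\<integral>s. ?c s * sqf p s \<partial>R n"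
      have iE: "integrable (R n) (\<lambda>s. complex_of_real (?c s) * (?D s + of_real (sqf p s) / 2))"
        by (intro iR continuous_intros cD) auto
      have iS: "integrable (R n) (\<lambda>s. complex_of_real (?c s * sqf p s))"
        by (intro iR continuous_intros)
      have "(\<integral>s. complex_of_real (?c s) * ?D s \<partial>R n) =
          (\<integral>s. complex_of_real (?c s) * (?D s + of_real (sqf p s) / 2) - complex_of_real (?c s * sqf p s) / 2 \<partial>R n)"
        by (rule Bochner_Integration.integral_cong) (simp_all add: field_simps)
      also have "\<dots> = (\<integral>s. complex_of_real (?c s) * (?D s + of_real (sqf p s) / 2) \<partial>R n) - of_real ?S / 2"
        using iE iS by (subst Bochner_Integration.integral_diff) (auto simp del: of_real_mult)
      finally have cD_eq: "(\<integral>s. complex_of_real (?c s) * ?D s \<partial>R n) =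
          (\<integral>s. complex_of_real (?c s) * (?D s + of_real (sqf p s) / 2) \<partial>R n) - of_real ?S / 2" .
      have eq: "(\<integral>s. ?D s \<partial>R n) - ?Jn n =
          (\<integral>s. complex_of_real (?c s) * (?D s + of_real (sqf p s) / 2) \<partial>R n) + of_real (Q - ?S) / 2"
        unfolding split[OF iR1[of n] iR2[of n]] cD_eq by (simp add: diff_divide_distrib)
      have "norm (\<integral>s. complex_of_real (?c s) * (?D s + of_real (sqf p s) / 2) \<partial>R n) \<le>
          (\<integral>s. norm (complex_of_real (?c s) * (?D s + of_real (sqf p s) / 2)) \<partial>R n)"
        by (rule integral_norm_bound)
      also have "\<dots> \<le> (\<integral>s. C2 * (5 * \<epsilon>) * qT s \<partial>R n)"
      proof (rule integral_mono)
        show "integrable (R n) (\<lambda>s. norm (complex_of_real (?c s) * (?D s + of_real (sqf p s) / 2)))"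
          by (intro integrable_norm iE)
        show "integrable (R n) (\<lambda>s. C2 * (5 * \<epsilon>) * qT s)"
          by (intro iR continuous_intros)
        fix s assume "s \<in> space (R n)"
        then have s: "s \<in> torus" by (simp add: space_T[OF R(2)])
        show "norm (complex_of_real (?c s) * (?D s + of_real (sqf p s) / 2)) \<le> C2 * (5 * \<epsilon>) * qT s"
        proof (cases "?c s = 0")
          case True
          then show ?thesis using C \<epsilon> qT_nonneg[OF s] by simp
        next
          case False
          then have a: "norm (argv s) < 5 * \<epsilon>" by (rule cutoff_norm_argv[OF \<epsilon>(1) s])
          then have "cmod (?D s + of_real (sqf p s) / 2) \<le> C2 * norm (argv s) * qT s"
            unfolding sqf_def C2_def using \<epsilon> by (intro levy_D_quadratic s) auto
          also have "\<dots> \<le> C2 * (5 * \<epsilon>) * qT s"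
            using a C qT_nonneg[OF s] by (intro mult_right_mono mult_left_mono) auto
          finally have "?c s * cmod (?D s + of_real (sqf p s) / 2) \<le> 1 * (C2 * (5 * \<epsilon>) * qT s)"
            using cutoff_bounds[of \<epsilon> s] by (intro mult_mono) auto
          then show ?thesis using cutoff_bounds[of \<epsilon> s] by (simp add: norm_mult)
        qed
      qed
      also have "\<dots> = C2 * (5 * \<epsilon>) * (\<integral>s. qT s \<partial>R n)" by simp
      also have "\<dots> \<le> (C2 + 1) * (5 * z) * M'"
      proof (rule mult_mono)
        show "C2 * (5 * \<epsilon>) \<le> (C2 + 1) * (5 * z)" using C \<epsilon> z by (intro mult_mono) auto
        show "(\<integral>s. qT s \<partial>R n) \<le> M'" using elim(2) M'(2) by simp
        show "0 \<le> (\<integral>s. qT s \<partial>R n)"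
          using qT_nonneg by (intro integral_nonneg_AE AE_I2) (simp add: space_T[OF R(2)])
      qed (use C z in auto)
      also have "\<dots> = e / 2" using C M' by (simp add: z_def field_simps add_nonneg_eq_0_iff)
      finally have 1: "norm (\<integral>s. complex_of_real (?c s) * (?D s + of_real (sqf p s) / 2) \<partial>R n) \<le> e / 2" .
      have "norm (complex_of_real (Q - ?S) / 2) \<le> e / 2"
        using elim(1) by (simp add: norm_divide abs_minus_commute del: of_real_diff)
      with 1 show ?case
        unfolding eq using norm_triangle_ineq[of "\<integral>s. complex_of_real (?c s) * (?D s + of_real (sqf p s) / 2) \<partial>R n" "of_real (Q - ?S) / 2"]
        by linarith
    qed
  qed
qed

section \<open>The Gaussian condition for quadratic forms\<close>

lemma integrable_indicator_times:
  fixes f :: "complex ^ 'd \<Rightarrow> real"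
  assumes "finite_measure M" "sets M = sets Tb" "continuous_on torus f"
  shows "integrable M (\<lambda>s. indicator (U_T \<epsilon>) s * f s)"
proof -
  obtain b where b: "b > 0" "\<And>s. s \<in> torus \<Longrightarrow> norm (f s) \<le> b"
    using continuous_on_torus_bounded[OF assms(3)] by blast
  show ?thesis
  proof (rule integrable_T_bounded[OF assms(1,2), of _ b])
    have "(\<lambda>s. indicator (U_T \<epsilon>) s :: real) \<in> borel_measurable Tb"
      by (intro borel_measurable_indicator U_T_sets)
    then show "(\<lambda>s. indicator (U_T \<epsilon>) s * f s) \<in> borel_measurable Tb"
      by (rule borel_measurable_times[OF _ borel_measurable_Tb[OF assms(3)]])
    show "norm (indicator (U_T \<epsilon>) s * f s) \<le> b" if "s \<in> torus" for s
      using b(1) b(2)[OF that] by (auto simp: indicator_def)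
  qed
qed

lemma ivec_inner_imv: "ivec p \<bullet> imv s = (\<Sum>j\<in>UNIV. real_of_int (p $ j) * Im (s $ j))"
  by (simp add: inner_vec_def ivec_def imv_def)

lemma sqf_expand:
  "sqf p s = (\<Sum>j\<in>UNIV. \<Sum>l\<in>UNIV. (real_of_int (p $ j) * real_of_int (p $ l)) * (Im (s $ j) * Im (s $ l)))"
  unfolding sqf_def ivec_inner_imv power2_eq_square sum_product by (simp add: mult_ac)

lemma quadratic_form_expand:
  "(A *v ivec p) \<bullet> ivec p = (\<Sum>j\<in>UNIV. \<Sum>l\<in>UNIV. (real_of_int (p $ j) * real_of_int (p $ l)) * A $ j $ l)"
  by (simp add: inner_vec_def ivec_def matrix_vector_mult_def sum_distrib_right sum_distrib_left mult_ac)

text \<open>Polarization with the integer vectors e_j, e_l and e_j + e_l, so integer frequencies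
  determine all mixed entries.\<close>

lemma Im_mult_Im_polar:
  "Im (s $ j) * Im (s $ l) = (1/2) * sqf (axis j 1 + axis l 1) s + (- (1/2)) * sqf (axis j 1) s + (- (1/2)) * sqf (axis l 1) s"
proof -
  have "ivec (axis i 1) \<bullet> imv s = Im (s $ i)" for i
    by (simp add: ivec_axis inner_axis' imv_def)
  then show ?thesis
    by (simp add: sqf_def ivec_add inner_add_left power2_eq_square algebra_simps)
qed

lemma matrix_entry_polar:
  assumes "transpose A = A"
  shows "A $ j $ l = (1/2) * ((A *v ivec (axis j 1 + axis l 1)) \<bullet> ivec (axis j 1 + axis l 1))
     + (- (1/2)) * ((A *v ivec (axis j 1)) \<bullet> ivec (axis j 1)) + (- (1/2)) * ((A *v ivec (axis l 1)) \<bullet> ivec (axis l 1))"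
proof -
  have e: "(A *v axis i 1) \<bullet> axis k 1 = A $ k $ i" for i k
    by (simp add: matrix_vector_mult_basis column_def inner_axis)
  have s: "A $ l $ j = A $ j $ l"
    using assms by (metis transpose_def vec_lambda_beta)
  show ?thesis
    by (simp add: ivec_axis ivec_add matrix_vector_right_distrib inner_add_left inner_add_right e s add_divide_distrib)
qed

text \<open>The squeeze needs an integrand of constant sign. Squares have one, the mixed products Im
  s_j Im s_l do not, which is why the Gaussian condition is first rewritten for quadratic
  forms.\<close>

lemma DL_indicator_iff_cutoff:
  fixes R :: "nat \<Rightarrow> (complex ^ 'd) measure"
  assumes R: "\<And>n. finite_measure (R n)" "\<And>n. sets (R n) = sets Tb"
  shows "DL (\<lambda>\<epsilon> n. \<integral>s. indicator (U_T \<epsilon>) s * sqf p s \<partial>R n) Q \<longleftrightarrow>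
    DL (\<lambda>\<epsilon> n. \<integral>s. cutoff \<epsilon> s * sqf p s \<partial>R n) Q"
proof -
  have iU: "integrable (R n) (\<lambda>s. indicator (U_T \<epsilon>) s * sqf p s)" for n \<epsilon>
    by (intro integrable_indicator_times R continuous_intros)
  have ic: "integrable (R n) (\<lambda>s. cutoff \<epsilon> s * sqf p s)" for n \<epsilon>
    by (intro integrable_T_continuous R continuous_intros)
  have sq: "0 \<le> sqf p s" for s by (simp add: sqf_def)
  have 1: "(\<integral>s. indicator (U_T \<epsilon>) s * sqf p s \<partial>R n) \<le> (\<integral>s. cutoff \<epsilon> s * sqf p s \<partial>R n)" if "0 < \<epsilon>" for \<epsilon> n
    using that by (intro integral_mono iU ic mult_right_mono sq indicator_le_cutoff) (simp_all add: space_T[OF R(2)])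
  have 2: "(\<integral>s. cutoff \<epsilon> s * sqf p s \<partial>R n) \<le> (\<integral>s. indicator (U_T (5 * \<epsilon>)) s * sqf p s \<partial>R n)" if "0 < \<epsilon>" for \<epsilon> n
    using that by (intro integral_mono iU ic mult_right_mono sq cutoff_le_indicator) (simp_all add: space_T[OF R(2)])
  show ?thesis
  proof
    assume "DL (\<lambda>\<epsilon> n. \<integral>s. indicator (U_T \<epsilon>) s * sqf p s \<partial>R n) Q"
    then show "DL (\<lambda>\<epsilon> n. \<integral>s. cutoff \<epsilon> s * sqf p s \<partial>R n) Q"
      by (rule DL_squeeze[where c = 1 and c' = 5]) (use 1 2 in auto)
  next
    assume "DL (\<lambda>\<epsilon> n. \<integral>s. cutoff \<epsilon> s * sqf p s \<partial>R n) Q"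
    then show "DL (\<lambda>\<epsilon> n. \<integral>s. indicator (U_T \<epsilon>) s * sqf p s \<partial>R n) Q"
    proof (rule DL_squeeze[where c = "1/5" and c' = 1])
      show "(\<integral>s. cutoff (1/5 * \<epsilon>) s * sqf p s \<partial>R n) \<le> (\<integral>s. indicator (U_T \<epsilon>) s * sqf p s \<partial>R n)" if "0 < \<epsilon>" for \<epsilon> n
        using 2[of "1/5 * \<epsilon>" n] that by simp
    qed (use 1 in auto)
  qed
qed

text \<open>Expansion of the square in one direction, polarization in the other; symmetry of A makes
  the entries recoverable from the form.\<close>

lemma DL_entries_iff:
  fixes R :: "nat \<Rightarrow> (complex ^ 'd) measure" and A :: "real ^ 'd ^ 'd"
  assumes R: "\<And>n. finite_measure (R n)" "\<And>n. sets (R n) = sets Tb" and A: "transpose A = A"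
  shows "(\<forall>j l. DL (\<lambda>\<epsilon> n. \<integral>s. indicator (U_T \<epsilon>) s * (Im (s $ j) * Im (s $ l)) \<partial>R n) (A $ j $ l)) \<longleftrightarrow>
    (\<forall>p. DL (\<lambda>\<epsilon> n. \<integral>s. cutoff \<epsilon> s * sqf p s \<partial>R n) ((A *v ivec p) \<bullet> ivec p))"
proof -
  have i: "integrable (R n) (\<lambda>s. indicator (U_T \<epsilon>) s * f s)" if "continuous_on torus f" for n \<epsilon> and f :: "complex ^ 'd \<Rightarrow> real"
    by (intro integrable_indicator_times R that)
  have "(\<forall>j l. DL (\<lambda>\<epsilon> n. \<integral>s. indicator (U_T \<epsilon>) s * (Im (s $ j) * Im (s $ l)) \<partial>R n) (A $ j $ l)) \<longleftrightarrow>
    (\<forall>p. DL (\<lambda>\<epsilon> n. \<integral>s. indicator (U_T \<epsilon>) s * sqf p s \<partial>R n) ((A *v ivec p) \<bullet> ivec p))" (is "?L \<longleftrightarrow> ?R")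
  proof
    assume L: ?L
    show ?R
    proof
      fix p
      have "(\<integral>s. indicator (U_T \<epsilon>) s * sqf p s \<partial>R n) =
          (\<Sum>j\<in>UNIV. \<Sum>l\<in>UNIV. (real_of_int (p $ j) * real_of_int (p $ l)) * (\<integral>s. indicator (U_T \<epsilon>) s * (Im (s $ j) * Im (s $ l)) \<partial>R n))" for \<epsilon> n
      proof -
        have ii: "integrable (R n) (\<lambda>s. indicator (U_T \<epsilon>) s * (Im (s $ j) * Im (s $ l)))" for j l
          by (intro i continuous_intros)
        have "(\<integral>s. indicator (U_T \<epsilon>) s * sqf p s \<partial>R n) =
          (\<integral>s. (\<Sum>j\<in>UNIV. \<Sum>l\<in>UNIV. (real_of_int (p $ j) * real_of_int (p $ l)) * (indicator (U_T \<epsilon>) s * (Im (s $ j) * Im (s $ l)))) \<partial>R n)"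
          by (rule Bochner_Integration.integral_cong) (simp_all add: sqf_expand sum_distrib_left mult_ac)
        then show ?thesis using ii by simp
      qed
      then show "DL (\<lambda>\<epsilon> n. \<integral>s. indicator (U_T \<epsilon>) s * sqf p s \<partial>R n) ((A *v ivec p) \<bullet> ivec p)"
        unfolding quadratic_form_expand using L by (simp only:) (intro DL_sum DL_cmult, blast)
    qed
  next
    assume R': ?R
    show ?L
    proof (intro allI)
      fix j l :: 'd
      have "(\<integral>s. indicator (U_T \<epsilon>) s * (Im (s $ j) * Im (s $ l)) \<partial>R n) =
        (1/2) * (\<integral>s. indicator (U_T \<epsilon>) s * sqf (axis j 1 + axis l 1) s \<partial>R n) +
        (- (1/2)) * (\<integral>s. indicator (U_T \<epsilon>) s * sqf (axis j 1) s \<partial>R n) +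
        (- (1/2)) * (\<integral>s. indicator (U_T \<epsilon>) s * sqf (axis l 1) s \<partial>R n)" for \<epsilon> n
      proof -
        have ii: "integrable (R n) (\<lambda>s. indicator (U_T \<epsilon>) s * sqf p s)" for p
          by (intro i continuous_intros)
        have "(\<integral>s. indicator (U_T \<epsilon>) s * (Im (s $ j) * Im (s $ l)) \<partial>R n) =
          (\<integral>s. (1/2) * (indicator (U_T \<epsilon>) s * sqf (axis j 1 + axis l 1) s) +
             (- (1/2)) * (indicator (U_T \<epsilon>) s * sqf (axis j 1) s) + (- (1/2)) * (indicator (U_T \<epsilon>) s * sqf (axis l 1) s) \<partial>R n)"
          by (rule Bochner_Integration.integral_cong) (simp_all add: Im_mult_Im_polar[of _ j l] algebra_simps)
        then show ?thesis using ii by simp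
      qed
      then show "DL (\<lambda>\<epsilon> n. \<integral>s. indicator (U_T \<epsilon>) s * (Im (s $ j) * Im (s $ l)) \<partial>R n) (A $ j $ l)"
        unfolding matrix_entry_polar[OF A, of j l] using R' by (simp only:) (intro DL_add DL_cmult, blast+)
    qed
  qed
  then show ?thesis
    by (simp only: DL_indicator_iff_cutoff[OF R])
qed

section \<open>Relative compactness\<close>

text \<open>The masses of \<open>R n\<close> may be unbounded, but those weighted by
  \<open>qT / M'\<close> are at most 1. Filled up to probability measures they have a weak limit
  \<kappa>, and dividing by the weight off \<open>ones\<close> gives the vague limit.\<close>

lemma vague_compact:
  fixes R :: "nat \<Rightarrow> (complex ^ 'd) measure"
  assumes R: "\<And>n. finite_measure (R n)" "\<And>n. sets (R n) = sets Tb"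
    and M: "\<And>n. (\<integral>s. qT s \<partial>R n) \<le> M"
  shows "\<exists>r \<tau>. strict_mono (r :: nat \<Rightarrow> nat) \<and> \<tau> \<in> Mtilde \<and> vague (\<lambda>n. R (r n)) \<tau>"
proof -
  define M' where "M' = \<bar>M\<bar> + 1"
  have M': "0 < M'" "M \<le> M'" by (auto simp: M'_def)
  have cq: "continuous_on torus (\<lambda>s :: complex ^ 'd. qT s / M')" using M' by (intro continuous_intros) auto
  define K where "K n = density (R n) (\<lambda>s. ennreal (qT s / M'))" for n
  have sK: "sets (K n) = sets Tb" for n by (simp add: K_def R)
  have mq: "(\<lambda>s. qT s / M') \<in> borel_measurable (R n)" for n
    by (rule borel_measurable_T[OF R(2) cq])
  have q0: "AE s in R n. 0 \<le> qT s / M'" for n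
    by (intro AE_I2) (simp add: space_T[OF R(2)] qT_nonneg M'(1) less_imp_le)
  have eK: "emeasure (K n) torus = ennreal ((\<integral>s. qT s \<partial>R n) / M')" for n
  proof -
    have "emeasure (K n) torus = (\<integral>\<^sup>+s. ennreal (qT s / M') \<partial>R n)"
      unfolding K_def using mq R by (subst emeasure_density) (auto simp: space_T[OF R(2)] intro!: nn_integral_cong)
    also have "\<dots> = ennreal (\<integral>s. qT s / M' \<partial>R n)"
      by (intro nn_integral_eq_integral integrable_T_continuous R cq q0)
    finally show ?thesis by simp
  qed
  have fK: "finite_measure (K n)" for n
    using eK by (intro finite_measureI) (simp add: space_T[OF sK])
  have I0: "0 \<le> (\<integral>s. qT s \<partial>R n)" for n
    by (intro integral_nonneg_AE AE_I2) (simp add: space_T[OF R(2)] qT_nonneg)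
  have mK: "measure (K n) torus \<le> 1" for n
    using eK[of n] M[of n] M' I0[of n] by (simp add: measure_def)
  have "\<exists>\<mu>. prob_T \<mu> \<and> (\<forall>f :: complex ^ 'd \<Rightarrow> real. continuous_on torus f \<longrightarrow>
      (\<integral>s. f s \<partial>\<mu>) = (\<integral>s. f s \<partial>K n) + (1 - measure (K n) torus) * f ones)" for n
    by (rule pad_to_prob_T[OF fK[of n] sK[of n] mK[of n]]) blast
  then obtain \<mu> where \<mu>: "\<And>n. prob_T (\<mu> n)" "\<And>n (f :: complex ^ 'd \<Rightarrow> real). continuous_on torus f \<Longrightarrow>
      (\<integral>s. f s \<partial>\<mu> n) = (\<integral>s. f s \<partial>K n) + (1 - measure (K n) torus) * f ones"
    by metis
  obtain r \<kappa> where r: "strict_mono (r :: nat \<Rightarrow> nat)" "prob_T \<kappa>" "weak_conv_T (\<mu> \<circ> r) \<kappa>"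
    using prob_T_compact[of \<mu>] \<mu>(1) by blast
  note s\<kappa> = prob_T_sets[OF r(2)]
  interpret \<kappa>: prob_space \<kappa> by (rule prob_T_prob[OF r(2)])
  \<comment> \<open>The value 0 at \<open>ones\<close> discards the atom that \<kappa> may have
    there, made of the filled-up mass and of weighted mass concentrating at that point.\<close>
  define w where "w s = (if s = ones then 0 else M' / qT s)" for s :: "complex ^ 'd"
  have w0: "0 \<le> w s" if "s \<in> torus" for s using qT_nonneg[OF that] M' by (simp add: w_def)
  have "w \<in> borel_measurable Tb"
  proof -
    have "w = (\<lambda>s. if s \<in> {ones} then 0 else M' / qT s)" by (auto simp: w_def)
    moreover have "qT \<in> borel_measurable Tb" by (intro borel_measurable_Tb continuous_intros)
    ultimately show ?thesis by (simp only:) (intro measurable_If_set borel_measurable_divide, auto)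
  qed
  then have mw: "w \<in> borel_measurable \<kappa>" by (rule measurable_T[OF s\<kappa>])
  have w0': "AE s in \<kappa>. 0 \<le> w s" using w0 by (intro AE_I2) (simp add: space_T[OF s\<kappa>])
  define \<tau> where "\<tau> = density \<kappa> (\<lambda>s. ennreal (w s))"
  have s\<tau>: "sets \<tau> = sets Tb" by (simp add: \<tau>_def s\<kappa>)
  have "\<tau> \<in> Mtilde"
    unfolding Mtilde_def
  proof (intro CollectI conjI ballI impI s\<tau>)
    show "emeasure \<tau> {ones} = 0"
    proof -
      have "emeasure \<tau> {ones} = (\<integral>\<^sup>+s. ennreal (w s) * indicator {ones} s \<partial>\<kappa>)"
        unfolding \<tau>_def using mw s\<kappa> by (subst emeasure_density) auto
      also have "\<dots> = (\<integral>\<^sup>+s. 0 \<partial>\<kappa>)"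
        by (intro nn_integral_cong) (auto simp: w_def indicator_def)
      finally show ?thesis by simp
    qed
    fix B :: "(complex ^ 'd) set" assume B: "B \<in> sets Tb" "\<exists>\<delta>>0. \<forall>s\<in>B. \<delta> \<le> dist s ones"
    then obtain \<delta> where \<delta>: "\<delta> > 0" "\<And>s. s \<in> B \<Longrightarrow> \<delta> \<le> dist s ones" by blast
    have "emeasure \<tau> B = (\<integral>\<^sup>+s. ennreal (w s) * indicator B s \<partial>\<kappa>)"
      unfolding \<tau>_def using mw s\<kappa> B by (subst emeasure_density) auto
    also have "\<dots> \<le> (\<integral>\<^sup>+s. ennreal (2 * M' / \<delta>\<^sup>2) \<partial>\<kappa>)"
    proof (rule nn_integral_mono)
      fix s assume "s \<in> space \<kappa>"
      then have s: "s \<in> torus" by (simp add: space_T[OF s\<kappa>])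
      show "ennreal (w s) * indicator B s \<le> ennreal (2 * M' / \<delta>\<^sup>2)"
      proof (cases "s \<in> B")
        case True
        have "\<delta>\<^sup>2 \<le> (dist s ones)\<^sup>2" using \<delta>(1) \<delta>(2)[OF True] by (intro power_mono) auto
        then have q: "\<delta>\<^sup>2 / 2 \<le> qT s" using dist_ones_sq[OF s] by simp
        have "w s \<le> M' / (\<delta>\<^sup>2 / 2)"
        proof -
          have d: "\<delta>\<^sup>2 / 2 > 0" using \<delta>(1) by simp
          then have "M' / qT s \<le> M' / (\<delta>\<^sup>2 / 2)"
            using q M' by (intro divide_left_mono mult_pos_pos) linarith+
          moreover have "0 \<le> M' / (\<delta>\<^sup>2 / 2)" using d M' by simp
          ultimately show ?thesis by (simp add: w_def)
        qed
        then show ?thesis using True by (simp add: ennreal_leI mult.commute)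
      qed simp
    qed
    also have "\<dots> < \<infinity>" by (simp add: \<kappa>.emeasure_space_1)
    finally show "emeasure \<tau> B < \<infinity>" .
  qed
  moreover have "vague (\<lambda>n. R (r n)) \<tau>"
    unfolding vague_def
  proof (intro allI impI)
    fix f :: "complex ^ 'd \<Rightarrow> real"
    assume f: "continuous_on torus f" "\<exists>\<delta>>0. \<forall>s\<in>torus. dist s ones < \<delta> \<longrightarrow> f s = 0"
    then obtain \<delta> where \<delta>: "\<delta> > 0" "\<And>s. s \<in> torus \<Longrightarrow> dist s ones < \<delta> \<Longrightarrow> f s = 0" by blast
    text \<open>Division by \<open>qT\<close> is harmless since the test function vanishes near the zero of \<open>qT\<close>.\<close>
    define g where "g s = M' * f s / max (qT s) (\<delta>\<^sup>2 / 2)" for s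
    have \<delta>2: "\<delta>\<^sup>2 / 2 > 0" using \<delta>(1) by simp
    have g: "continuous_on torus g"
      unfolding g_def using \<delta>2 by (intro continuous_intros f) (auto simp: max_def)
    have far: "f s \<noteq> 0 \<Longrightarrow> \<delta>\<^sup>2 / 2 \<le> qT s" if "s \<in> torus" for s
    proof -
      assume "f s \<noteq> 0"
      then have "\<delta> \<le> dist s ones" using \<delta>(2)[OF that] by force
      then have "\<delta>\<^sup>2 \<le> (dist s ones)\<^sup>2" using \<delta>(1) by (intro power_mono) auto
      then show ?thesis using dist_ones_sq[OF that] by simp
    qed
    have g1: "qT s / M' * g s = f s" if "s \<in> torus" for s
    proof (cases "f s = 0")
      case False
      then have "\<delta>\<^sup>2 / 2 \<le> qT s" by (rule far[OF that])
      then have "max (qT s) (\<delta>\<^sup>2 / 2) = qT s" "qT s \<noteq> 0" using \<delta>2 by linarith+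
      then show ?thesis using M' by (simp only: g_def) simp
    qed (simp add: g_def)
    have g2: "w s * f s = g s" if "s \<in> torus" for s
    proof (cases "f s = 0")
      case False
      then have "\<delta>\<^sup>2 / 2 \<le> qT s" by (rule far[OF that])
      then have "max (qT s) (\<delta>\<^sup>2 / 2) = qT s" "qT s \<noteq> 0" using \<delta>2 by linarith+
      moreover from this have "s \<noteq> ones" by auto
      ultimately show ?thesis by (simp only: g_def w_def) simp
    qed (simp add: g_def)
    have "g ones = 0" using \<delta> by (simp add: g_def)
    then have "(\<integral>s. g s \<partial>(\<mu> \<circ> r) n) = (\<integral>s. f s \<partial>R (r n))" for n
    proof -
      have "(\<integral>s. g s \<partial>(\<mu> \<circ> r) n) = (\<integral>s. g s \<partial>K (r n))"
        using \<mu>(2)[OF g] \<open>g ones = 0\<close> by simp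
      also have "\<dots> = (\<integral>s. (qT s / M') *\<^sub>R g s \<partial>R (r n))"
        unfolding K_def by (intro integral_density borel_measurable_T R g mq q0)
      also have "\<dots> = (\<integral>s. f s \<partial>R (r n))"
        using g1 by (intro integral_T_cong R) simp
      finally show ?thesis .
    qed
    moreover have "(\<integral>s. g s \<partial>\<kappa>) = (\<integral>s. f s \<partial>\<tau>)"
    proof -
      have "(\<integral>s. f s \<partial>\<tau>) = (\<integral>s. w s *\<^sub>R f s \<partial>\<kappa>)"
        unfolding \<tau>_def by (intro integral_density borel_measurable_T s\<kappa> f mw w0')
      also have "\<dots> = (\<integral>s. g s \<partial>\<kappa>)"
        using g2 by (intro integral_T_cong s\<kappa>) simp
      finally show ?thesis by simp
    qed
    moreover have "(\<lambda>n. \<integral>s. g s \<partial>(\<mu> \<circ> r) n) \<longlonglongrightarrow> (\<integral>s. g s \<partial>\<kappa>)"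
      using r(3) g unfolding weak_conv_T_def by blast
    ultimately show "(\<lambda>n. \<integral>s. f s \<partial>R (r n)) \<longlonglongrightarrow> (\<integral>s. f s \<partial>\<tau>)"
      by simp
  qed
  ultimately show ?thesis using r(1) by blast
qed

section \<open>Sufficiency\<close>

lemma LIMSEQ_subsubseq:
  fixes X :: "nat \<Rightarrow> 'a::metric_space"
  assumes "\<And>r :: nat \<Rightarrow> nat. strict_mono r \<Longrightarrow> \<exists>r' :: nat \<Rightarrow> nat. strict_mono r' \<and> (\<lambda>n. X (r (r' n))) \<longlonglongrightarrow> L"
  shows "X \<longlonglongrightarrow> L"
proof (rule ccontr)
  assume "\<not> X \<longlonglongrightarrow> L"
  then obtain e where e: "e > 0" "infinite {n. \<not> dist (X n) L < e}"
    by (auto simp: tendsto_iff not_eventually INFM_iff_infinite cofinite_eq_sequentially[symmetric])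
  then obtain r :: "nat \<Rightarrow> nat" where r: "\<And>n. \<not> dist (X (r n)) L < e" "strict_mono r"
    using enumerate_in_set enumerate_mono by (fastforce simp: strict_mono_def)
  obtain r' where "(\<lambda>n. X (r (r' n))) \<longlonglongrightarrow> L" using assms[OF r(2)] by blast
  then show False using r(1) e(1) by (auto dest!: tendstoD[OF _ e(1)] simp: eventually_sequentially)
qed

lemma eventually_bounded_imp_bounded:
  fixes X :: "nat \<Rightarrow> real"
  assumes "\<forall>\<^sub>F n in sequentially. X n \<le> M"
  obtains M' where "\<And>n. X n \<le> M'"
proof -
  obtain N where N: "\<And>n. n \<ge> N \<Longrightarrow> X n \<le> M" using assms by (auto simp: eventually_sequentially)
  have "X n \<le> max M (Max (insert M (X ` {..<N})))" for n
  proof (cases "n < N")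
    case True
    then have "X n \<le> Max (insert M (X ` {..<N}))" by (intro Max_ge) auto
    then show ?thesis by simp
  next
    case False
    then show ?thesis using N[of n] by (intro max.coboundedI1) simp
  qed
  then show thesis by (rule that)
qed

lemma infinitesimal_subseq:
  assumes "infinitesimal_T \<nu> kn" "strict_mono r"
  shows "infinitesimal_T (\<lambda>n. \<nu> (r n)) (\<lambda>n. kn (r n))"
  unfolding infinitesimal_T_def
proof (intro conjI allI impI)
  show "strict_mono (\<lambda>n. kn (r n))"
    using assms unfolding infinitesimal_T_def strict_mono_def by blast
  show "\<forall>k\<in>{1..kn (r n)}. prob_T (\<nu> (r n) k)" for n
    using assms(1) unfolding infinitesimal_T_def by blast
  fix \<epsilon> :: real assume "\<epsilon> > 0"
  then have "(\<lambda>n. Max ((\<lambda>k. measure (\<nu> n k) {s \<in> torus. \<epsilon> \<le> norm (argv s)}) ` {1..kn n})) \<longlonglongrightarrow> 0"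
    using assms(1) by (simp add: infinitesimal_T_def)
  from LIMSEQ_subseq_LIMSEQ[OF this assms(2)]
  show "(\<lambda>n. Max ((\<lambda>k. measure (\<nu> (r n) k) {s \<in> torus. \<epsilon> \<le> norm (argv s)}) ` {1..kn (r n)})) \<longlonglongrightarrow> 0"
    by (simp add: o_def)
qed

lemma gamma_n_torus: "\<xi> n \<in> torus \<Longrightarrow> gamma_n \<theta> \<nu> kn \<xi> n \<in> torus"
  by (simp add: torus_def gamma_n_def norm_mult)

lemma tendsto_monom_T:
  assumes "f \<longlonglongrightarrow> l" "l \<in> torus" "\<And>n. f n \<in> torus"
  shows "(\<lambda>n. monom_T (f n) p) \<longlonglongrightarrow> monom_T l p"
  by (rule continuous_on_tendsto_compose[OF continuous_on_monom_T assms(1,2)]) (use assms(3) in simp)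

lemma sqf_axis: "sqf (axis j 1) s = (Im (s $ j))\<^sup>2"
  by (simp add: sqf_def ivec_axis inner_axis' imv_def)

text \<open>On the support of the cutoff angles are at most 1, so cos is nonnegative and 1 - cos
  \<le> (1 - cos)(1 + cos) = sin squared.\<close>

lemma cutoff_qT_le_sqf:
  assumes "0 < \<epsilon>" "\<epsilon> \<le> 1 / 5" "s \<in> torus"
  shows "cutoff \<epsilon> s * qT s \<le> (\<Sum>j\<in>UNIV. cutoff \<epsilon> s * sqf (axis j 1) s)"
proof (cases "cutoff \<epsilon> s = 0")
  case False
  have "qT s \<le> (\<Sum>j\<in>UNIV. sqf (axis j 1) s)"
    unfolding qT_def
  proof (rule sum_mono)
    fix j
    let ?x = "Arg (s $ j)"
    have "norm (argv s) < 5 * \<epsilon>" by (rule cutoff_norm_argv[OF assms(1,3) False])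
    then have "\<bar>?x\<bar> \<le> 1" using abs_Arg_le_norm[of s j] assms(2) by linarith
    then have "0 \<le> cos ?x" using pi_gt3 by (intro cos_ge_zero) auto
    then have "(1 - cos ?x) * 1 \<le> (1 - cos ?x) * (1 + cos ?x)"
      by (intro mult_left_mono) auto
    also have "\<dots> = (sin ?x)\<^sup>2" by (simp add: sin_squared_eq power2_eq_square algebra_simps)
    finally show "1 - Re (s $ j) \<le> sqf (axis j 1) s" by (simp add: sqf_axis torus_Re_Im[OF assms(3)])
  qed
  then have "cutoff \<epsilon> s * qT s \<le> cutoff \<epsilon> s * (\<Sum>j\<in>UNIV. sqf (axis j 1) s)"
    by (intro mult_left_mono cutoff_bounds)
  then show ?thesis by (simp add: sum_distrib_left)
qed (simp add: cutoff_bounds)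

text \<open>At a single small radius, the Gaussian condition at the coordinate vectors bounds the
  inner part of the integral and vague convergence bounds the outer part.\<close>

lemma qT_bound_of_DL_vague:
  fixes R :: "nat \<Rightarrow> (complex ^ 'd) measure"
  assumes R: "\<And>n. finite_measure (R n)" "\<And>n. sets (R n) = sets Tb" and v: "vague R \<tau>"
    and DL: "\<And>p. DL (\<lambda>\<epsilon> n. \<integral>s. cutoff \<epsilon> s * sqf p s \<partial>R n) (Q p)"
  shows "\<exists>M. \<forall>\<^sub>F n in sequentially. (\<integral>s. qT s \<partial>R n) \<le> M"
proof -
  have i: "integrable (R n) f" if "continuous_on torus f" for f :: "complex ^ 'd \<Rightarrow> real" and n
    by (intro integrable_T_continuous R that)
  have "DL (\<lambda>\<epsilon> n. \<Sum>j\<in>UNIV. \<integral>s. cutoff \<epsilon> s * sqf (axis j 1) s \<partial>R n) (\<Sum>j\<in>UNIV. Q (axis j 1))"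
    by (intro DL_sum DL)
  then obtain x where x: "x > 0" "\<And>\<epsilon>. 0 < \<epsilon> \<Longrightarrow> \<epsilon> < x \<Longrightarrow> \<forall>\<^sub>F n in sequentially.
      \<bar>(\<Sum>j\<in>UNIV. \<integral>s. cutoff \<epsilon> s * sqf (axis j 1) s \<partial>R n) - (\<Sum>j\<in>UNIV. Q (axis j 1))\<bar> < 1"
    unfolding DL_def by (meson zero_less_one)
  define \<epsilon> where "\<epsilon> = min (x / 2) (1 / 5)"
  have \<epsilon>: "0 < \<epsilon>" "\<epsilon> < x" "\<epsilon> \<le> 1 / 5" using x(1) by (auto simp: \<epsilon>_def)
  let ?I = "\<integral>s. (1 - cutoff \<epsilon> s) * qT s \<partial>\<tau>"
  have "(\<lambda>n. \<integral>s. (1 - cutoff \<epsilon> s) * qT s \<partial>R n) \<longlonglongrightarrow> ?I"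
    by (rule vague_cutoff[OF v \<epsilon>(1)]) (intro continuous_intros)
  then have "\<forall>\<^sub>F n in sequentially. (\<integral>s. (1 - cutoff \<epsilon> s) * qT s \<partial>R n) < ?I + 1"
    by (rule order_tendstoD) simp
  then have "\<forall>\<^sub>F n in sequentially. (\<integral>s. qT s \<partial>R n) \<le> (\<Sum>j\<in>UNIV. Q (axis j 1)) + 1 + (?I + 1)"
    using x(2)[OF \<epsilon>(1,2)]
  proof eventually_elim
    case (elim n)
    have "(\<integral>s. qT s \<partial>R n) = (\<integral>s. cutoff \<epsilon> s * qT s + (1 - cutoff \<epsilon> s) * qT s \<partial>R n)"
      by (simp add: algebra_simps)
    also have "\<dots> = (\<integral>s. cutoff \<epsilon> s * qT s \<partial>R n) + (\<integral>s. (1 - cutoff \<epsilon> s) * qT s \<partial>R n)"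
      by (intro Bochner_Integration.integral_add i continuous_intros)
    also have "(\<integral>s. cutoff \<epsilon> s * qT s \<partial>R n) \<le> (\<integral>s. (\<Sum>j\<in>UNIV. cutoff \<epsilon> s * sqf (axis j 1) s) \<partial>R n)"
      by (intro integral_mono i continuous_intros cutoff_qT_le_sqf \<epsilon>) (simp add: space_T[OF R(2)])
    also have "\<dots> = (\<Sum>j\<in>UNIV. \<integral>s. cutoff \<epsilon> s * sqf (axis j 1) s \<partial>R n)"
      by (intro Bochner_Integration.integral_sum i continuous_intros)
    finally show ?case using elim by linarith
  qed
  then show ?thesis by blast
qed

text \<open>Different subsequences may produce different measures \<tau>, but all of them lie in
  \<open>levy_class \<rho>\<close> and have the same exponential of the exponent; so the limit is
  the same along each, and the whole sequence converges.\<close>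

lemma sufficiency:
  fixes \<gamma> :: "complex ^ 'd" and A :: "real ^ 'd ^ 'd" and \<rho> :: "(complex ^ 'd) measure"
  assumes \<theta>: "0 < \<theta>" "\<theta> < 1" and t: "levy_triplet_T \<gamma> A \<rho>" and inf: "infinitesimal_T \<nu> kn"
    and \<xi>: "\<forall>n. \<xi> n \<in> torus"
    and \<gamma>: "gamma_n \<theta> \<nu> kn \<xi> \<longlonglongrightarrow> \<gamma>"
    and DL: "\<And>p. DL (\<lambda>\<epsilon> n. \<integral>s. cutoff \<epsilon> s * sqf p s \<partial>rho_n \<theta> \<nu> kn n) ((A *v ivec p) \<bullet> ivec p)"
    and cpt: "\<And>r :: nat \<Rightarrow> nat. strict_mono r \<Longrightarrow> \<exists>(r' :: nat \<Rightarrow> nat) \<tau>. strict_mono r' \<and> \<tau> \<in> Mtilde \<and>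
      vague (\<lambda>n. rho_n \<theta> \<nu> kn (r (r' n))) \<tau>"
    and lim: "\<And>r \<tau>. strict_mono (r :: nat \<Rightarrow> nat) \<Longrightarrow> \<tau> \<in> Mtilde \<Longrightarrow> vague (\<lambda>n. rho_n \<theta> \<nu> kn (r n)) \<tau> \<Longrightarrow> \<tau> \<in> levy_class \<rho>"
  shows "(\<lambda>n. charT (conv_T (\<xi> n) (\<nu> n) (kn n)) p) \<longlonglongrightarrow> levy_exponent_T \<gamma> A \<rho> p"
proof (rule LIMSEQ_subsubseq)
  fix r0 :: "nat \<Rightarrow> nat" assume r0: "strict_mono r0"
  from cpt[OF this] obtain r' \<tau> where r': "strict_mono (r' :: nat \<Rightarrow> nat)" "\<tau> \<in> Mtilde"
    "vague (\<lambda>n. rho_n \<theta> \<nu> kn (r0 (r' n))) \<tau>" by blast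
  define r where "r n = r0 (r' n)" for n
  have r: "strict_mono r"
    unfolding r_def using strict_mono_o[OF r0 r'(1)] by (simp add: o_def)
  note v = r'(3)[folded r_def]
  have \<rho>: "levy_measure_T \<rho>" and \<gamma>T: "\<gamma> \<in> torus" using t by (auto simp: levy_triplet_T_def)
  have \<tau>: "levy_measure_T \<tau>" "\<And>p. exp (\<integral>s. levy_D p s \<partial>\<tau>) = exp (\<integral>s. levy_D p s \<partial>\<rho>)"
    using lim[OF r r'(2) v] levy_class_iff[OF \<rho>, of \<tau>] by auto
  have s\<tau>: "sets \<tau> = sets Tb" "integrable \<tau> qT" using \<tau>(1) by (auto simp: levy_measure_T_iff)
  \<comment> \<open>The rows along r form an infinitesimal array whose \<open>rho_n\<close> and
    \<open>gamma_n\<close> are the original ones along r, so results on full sequences apply to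
    it.\<close>
  define \<nu>' kn' \<xi>' where "\<nu>' = (\<lambda>n. \<nu> (r n))" and "kn' = (\<lambda>n. kn (r n))" and "\<xi>' = (\<lambda>n. \<xi> (r n))"
  have inf': "infinitesimal_T \<nu>' kn'"
    unfolding \<nu>'_def kn'_def by (rule infinitesimal_subseq[OF inf r])
  have R: "rho_n \<theta> \<nu> kn (r n) = rho_n \<theta> \<nu>' kn' n" for n
    by (simp add: rho_n_def \<nu>'_def kn'_def)
  have G: "gamma_n \<theta> \<nu> kn \<xi> (r n) = gamma_n \<theta> \<nu>' kn' \<xi>' n" for n
    by (simp add: gamma_n_def \<nu>'_def kn'_def \<xi>'_def)
  note fR = finite_measure_rho_n[OF inf'] and sR = sets_rho_n
  have v': "vague (\<lambda>n. rho_n \<theta> \<nu>' kn' n) \<tau>" using v by (simp add: R)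
  have DL': "DL (\<lambda>\<epsilon> n. \<integral>s. cutoff \<epsilon> s * sqf p s \<partial>rho_n \<theta> \<nu>' kn' n) ((A *v ivec p) \<bullet> ivec p)" for p
    using DL_subseq[OF DL[of p] r] by (simp add: R)
  obtain M where M: "\<forall>\<^sub>F n in sequentially. (\<integral>s. qT s \<partial>rho_n \<theta> \<nu>' kn' n) \<le> M"
    using qT_bound_of_DL_vague[OF fR sR v' DL'] by blast
  have "(\<lambda>n. \<integral>s. levy_D p s \<partial>rho_n \<theta> \<nu>' kn' n) \<longlonglongrightarrow>
      - of_real ((A *v ivec p) \<bullet> ivec p) / 2 + (\<integral>s. levy_D p s \<partial>\<tau>)"
    by (rule integral_levy_D_conv[OF fR sR s\<tau> v' M DL'])
  moreover have "(\<lambda>n. monom_T (gamma_n \<theta> \<nu>' kn' \<xi>' n) p) \<longlonglongrightarrow> monom_T \<gamma> p"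
  proof (rule tendsto_monom_T[OF _ \<gamma>T])
    show "gamma_n \<theta> \<nu>' kn' \<xi>' \<longlonglongrightarrow> \<gamma>"
      using LIMSEQ_subseq_LIMSEQ[OF \<gamma> r] by (simp add: o_def G)
    show "gamma_n \<theta> \<nu>' kn' \<xi>' n \<in> torus" for n
      using \<xi> by (intro gamma_n_torus) (simp add: \<xi>'_def)
  qed
  ultimately have "(\<lambda>n. acc \<theta> \<nu>' kn' \<xi>' n p) \<longlonglongrightarrow>
      monom_T \<gamma> p * exp (- of_real ((A *v ivec p) \<bullet> ivec p) / 2 + (\<integral>s. levy_D p s \<partial>\<tau>))"
    unfolding acc_def by (intro tendsto_mult tendsto_exp)
  also have "monom_T \<gamma> p * exp (- of_real ((A *v ivec p) \<bullet> ivec p) / 2 + (\<integral>s. levy_D p s \<partial>\<tau>)) = levy_exponent_T \<gamma> A \<rho> p"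
    unfolding levy_exponent_T_alt exp_add \<tau>(2) by simp
  finally have "(\<lambda>n. (charT (conv_T (\<xi>' n) (\<nu>' n) (kn' n)) p - acc \<theta> \<nu>' kn' \<xi>' n p) + acc \<theta> \<nu>' kn' \<xi>' n p)
      \<longlonglongrightarrow> 0 + levy_exponent_T \<gamma> A \<rho> p"
    using \<xi> by (intro tendsto_add accompanying[OF inf' \<theta> _ M]) (auto simp: \<xi>'_def)
  then have "(\<lambda>n. charT (conv_T (\<xi> (r0 (r' n))) (\<nu> (r0 (r' n))) (kn (r0 (r' n)))) p) \<longlonglongrightarrow> levy_exponent_T \<gamma> A \<rho> p"
    by (simp add: \<xi>'_def \<nu>'_def kn'_def r_def)
  then show "\<exists>r'. strict_mono r' \<and> (\<lambda>n. charT (conv_T (\<xi> (r0 (r' n))) (\<nu> (r0 (r' n))) (kn (r0 (r' n)))) p)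
      \<longlonglongrightarrow> levy_exponent_T \<gamma> A \<rho> p"
    using r'(1) by blast
qed

section \<open>Necessity\<close>

text \<open>Minus the real part of the Levy integrand: its integral is minus the logarithm of the
  modulus of the exponential, a single-valued quantity.\<close>

definition defect :: "int ^ 'd \<Rightarrow> complex ^ 'd \<Rightarrow> real" where
  "defect p s = 1 - Re (monom_T s p)"

lemma Re_levy_D: "Re (levy_D p s) = - defect p s"
  by (simp add: levy_D_def defect_def)

lemma continuous_on_defect: "continuous_on torus (defect p)"
  unfolding defect_def by (intro continuous_intros continuous_on_monom_T)

lemma Re_integral_levy_D:
  assumes "integrable M (levy_D p)"
  shows "Re (\<integral>s. levy_D p s \<partial>M) = - (\<integral>s. defect p s \<partial>M)"
  by (subst integral_Re[OF assms, symmetric]) (simp add: Re_levy_D)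

lemma integrable_defect:
  assumes "sets \<rho> = sets Tb" "integrable \<rho> qT"
  shows "integrable \<rho> (defect p)"
  using integrable_Re[OF integrable_levy_D[OF assms, of p]] by (simp add: Re_levy_D)

lemma levy_D_axis: "levy_D (axis j 1) s = of_real (Re (s $ j) - 1)"
  by (simp add: levy_D_def ivec_axis inner_axis' imv_def complex_eq_iff)

lemma norm_exp_levy_D:
  assumes "integrable M (levy_D p)"
  shows "cmod (exp (\<integral>s. levy_D p s \<partial>M)) = exp (- (\<integral>s. defect p s \<partial>M))"
  by (simp add: Re_integral_levy_D[OF assms])

lemma norm_levy_exponent_T:
  assumes "levy_triplet_T \<gamma> A \<rho>"
  shows "cmod (levy_exponent_T \<gamma> A \<rho> p) = exp (- ((A *v ivec p) \<bullet> ivec p / 2 + (\<integral>s. defect p s \<partial>\<rho>)))"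
proof -
  have \<rho>: "levy_measure_T \<rho>" and "\<gamma> \<in> torus"
    using assms by (auto simp: levy_triplet_T_def)
  moreover have "sets \<rho> = sets Tb" "integrable \<rho> qT"
    using \<rho> by (auto simp: levy_measure_T_iff)
  ultimately show ?thesis
    by (simp add: levy_exponent_T_alt norm_mult norm_monom_T Re_integral_levy_D integrable_levy_D exp_add[symmetric])
qed

text \<open>Re-expressing the weight \<open>Re s\<^sup>p Im s\<^sub>j Im s\<^sub>l\<close> as a second difference of \<open>defect\<close>: this is
  how convergence of the moduli of the characteristic functions alone determines the Gaussian part,
  for the whole sequence and before any subsequence is extracted.\<close>

lemma second_difference_defect:
  assumes "s \<in> torus"
  shows "Re (monom_T s p) * (Im (s $ j) * Im (s $ l)) =
    (1/4) * (defect (p + axis j 1 + axis l 1) s + defect (p - axis j 1 - axis l 1) s -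
      defect (p + axis j 1 - axis l 1) s - defect (p - axis j 1 + axis l 1) s)"
  using assms
  by (simp add: defect_def monom_T_add monom_T_diff algebra_simps)

text \<open>The same mixed difference on the Gaussian side. For a quadratic form it is independent
  of p, which is how an atom at the neutral element shows up.\<close>

lemma second_difference_quadratic:
  fixes A :: "real ^ 'd ^ 'd"
  assumes "transpose A = A"
  defines "Q \<equiv> \<lambda>p. (A *v ivec p) \<bullet> ivec p / 2"
  shows "(1/4) * (Q (p + axis j 1 + axis l 1) + Q (p - axis j 1 - axis l 1) -
      Q (p + axis j 1 - axis l 1) - Q (p - axis j 1 + axis l 1)) = A $ j $ l"
proof -
  have e: "(A *v axis i 1) \<bullet> axis k 1 = A $ k $ i" for i k
    by (simp add: matrix_vector_mult_basis column_def inner_axis)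
  have s: "A $ l $ j = A $ j $ l"
    using assms(1) by (metis transpose_def vec_lambda_beta)
  show ?thesis
    unfolding Q_def
    by (simp add: ivec_axis ivec_add ivec_diff matrix_vector_right_distrib matrix_vector_mult_diff_distrib
        inner_add_left inner_add_right inner_diff_left inner_diff_right e s add_divide_distrib diff_divide_distrib)
qed

lemma sqf_le_qT:
  assumes "s \<in> torus"
  shows "sqf p s \<le> 2 * (norm (ivec p))\<^sup>2 * qT s"
proof -
  have "(norm (imv s))\<^sup>2 = (\<Sum>j\<in>UNIV. (Im (s $ j))\<^sup>2)"
    unfolding power2_norm_eq_inner by (simp add: inner_vec_def imv_def power2_eq_square)
  also have "\<dots> \<le> (\<Sum>j\<in>UNIV. 2 * (1 - Re (s $ j)))"
  proof (rule sum_mono)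
    fix j
    let ?x = "Arg (s $ j)"
    have "(sin ?x)\<^sup>2 = (1 - cos ?x) * (1 + cos ?x)"
      by (simp add: sin_squared_eq power2_eq_square algebra_simps)
    also have "\<dots> \<le> (1 - cos ?x) * 2" by (intro mult_left_mono) auto
    finally show "(Im (s $ j))\<^sup>2 \<le> 2 * (1 - Re (s $ j))" by (simp add: torus_Re_Im[OF assms])
  qed
  finally have imv: "(norm (imv s))\<^sup>2 \<le> 2 * qT s" by (simp add: qT_def sum_distrib_left)
  have "sqf p s \<le> (norm (ivec p) * norm (imv s))\<^sup>2"
    unfolding sqf_def using Cauchy_Schwarz_ineq2[of "ivec p" "imv s"]
    by (intro power2_le_iff_abs_le[THEN iffD2]) auto
  also have "\<dots> \<le> (norm (ivec p))\<^sup>2 * (2 * qT s)"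
    unfolding power_mult_distrib using imv by (intro mult_left_mono) auto
  finally show ?thesis by (simp add: mult_ac)
qed

text \<open>Inversion in the group, used to symmetrize test functions.\<close>

definition conj_T :: "complex ^ 'd \<Rightarrow> complex ^ 'd" where
  "conj_T s = (\<chi> j. cnj (s $ j))"

lemma conj_T_torus: "s \<in> torus \<Longrightarrow> conj_T s \<in> torus"
  by (simp add: torus_def conj_T_def)

lemma monom_T_conj: "monom_T (conj_T s) p = cnj (monom_T s p)"
  by (simp add: monom_T_def conj_T_def)

lemma cutoff_conj: "cutoff \<epsilon> (conj_T s) = cutoff \<epsilon> s"
  by (simp add: cutoff_def qT_def conj_T_def)

text \<open>In substance: on even test functions, the measures with density \<open>sqf p\<close>
  over \<open>R n\<close> converge to an atom of mass Q at \<open>ones\<close> plus the density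
  \<open>sqf p\<close> over \<rho>. Testing with the even function \<open>cutoff \<epsilon>\<close>
  and letting \<epsilon> tend to 0 isolates the atom.\<close>

lemma DL_of_defect_tendsto:
  fixes R :: "nat \<Rightarrow> (complex ^ 'd) measure" and A :: "real ^ 'd ^ 'd"
  assumes R: "\<And>n. finite_measure (R n)" "\<And>n. sets (R n) = sets Tb"
    and \<rho>: "sets \<rho> = sets Tb" "integrable \<rho> qT" and A: "transpose A = A"
    and M: "\<And>n. (\<integral>s. qT s \<partial>R n) \<le> M"
    and lim: "\<And>p. (\<lambda>n. \<integral>s. defect p s \<partial>R n) \<longlonglongrightarrow> (A *v ivec p) \<bullet> ivec p / 2 + (\<integral>s. defect p s \<partial>\<rho>)"
  shows "DL (\<lambda>\<epsilon> n. \<integral>s. cutoff \<epsilon> s * sqf p s \<partial>R n) ((A *v ivec p) \<bullet> ivec p)"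
proof -
  let ?Q = "\<lambda>p. (A *v ivec p) \<bullet> ivec p"
  define C where "C = 2 * (norm (ivec p))\<^sup>2"
  have C: "0 \<le> C" by (simp add: C_def)
  have sq: "0 \<le> sqf p s" for s by (simp add: sqf_def)
  have sqC: "sqf p s \<le> C * qT s" if "s \<in> torus" for s unfolding C_def by (rule sqf_le_qT[OF that])
  have iR: "integrable (R n) f" if "continuous_on torus f" for f :: "complex ^ 'd \<Rightarrow> real" and n
    by (intro integrable_T_continuous R that)
  have i\<rho>: "integrable \<rho> (\<lambda>s. f s * sqf p s)" if fc: "continuous_on torus f" for f :: "complex ^ 'd \<Rightarrow> real"
  proof -
    obtain b where b: "b > 0" "\<And>s. s \<in> torus \<Longrightarrow> norm (f s) \<le> b"
      using continuous_on_torus_bounded[OF fc] by blast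
    show ?thesis
    proof (rule integrable_qT_bound[OF \<rho>, of _ "b * C"])
      show "(\<lambda>s. f s * sqf p s) \<in> borel_measurable Tb"
        by (intro borel_measurable_Tb continuous_intros fc)
      show "norm (f s * sqf p s) \<le> b * C * qT s" if "s \<in> torus" for s
        using mult_mono[OF b(2)[OF that] sqC[OF that]] b(1) sq by (simp add: abs_mult mult.assoc)
    qed
  qed
  \<comment> \<open>Second differences of the assumed limits. The Gaussian contribution Q carries no
    dependence on m, as for an atom at \<open>ones\<close>, where every character is 1.\<close>
  have base: "(\<lambda>n. \<integral>s. Re (monom_T s m) * sqf p s \<partial>R n) \<longlonglongrightarrow> ?Q p + (\<integral>s. Re (monom_T s m) * sqf p s \<partial>\<rho>)" for m
  proof -
    let ?c = "\<lambda>j l. real_of_int (p $ j) * real_of_int (p $ l)"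
    let ?a = "\<lambda>j l. m + axis j 1 + axis l 1" and ?b = "\<lambda>j l. m - axis j 1 - axis l 1"
      and ?d = "\<lambda>j l. m + axis j 1 - axis l 1" and ?e = "\<lambda>j l. m - axis j 1 + axis l 1"
    have eq: "(\<integral>s. Re (monom_T s m) * sqf p s \<partial>N) = (\<Sum>j\<in>UNIV. \<Sum>l\<in>UNIV. ?c j l * ((1/4) *
        ((\<integral>s. defect (?a j l) s \<partial>N) + (\<integral>s. defect (?b j l) s \<partial>N) - (\<integral>s. defect (?d j l) s \<partial>N) - (\<integral>s. defect (?e j l) s \<partial>N))))"
      if N: "sets N = sets Tb" and i: "\<And>q. integrable N (defect q)" for N
    proof -
      have "(\<integral>s. Re (monom_T s m) * sqf p s \<partial>N) = (\<integral>s. (\<Sum>j\<in>UNIV. \<Sum>l\<in>UNIV. ?c j l * ((1/4) *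
          (defect (?a j l) s + defect (?b j l) s - defect (?d j l) s - defect (?e j l) s))) \<partial>N)"
      proof (rule integral_T_cong[OF N])
        fix s :: "complex ^ 'd" assume s: "s \<in> torus"
        have "Re (monom_T s m) * sqf p s = (\<Sum>j\<in>UNIV. \<Sum>l\<in>UNIV. ?c j l * (Re (monom_T s m) * (Im (s $ j) * Im (s $ l))))"
          by (simp add: sqf_expand sum_distrib_left mult_ac)
        then show "Re (monom_T s m) * sqf p s = (\<Sum>j\<in>UNIV. \<Sum>l\<in>UNIV. ?c j l * ((1/4) *
          (defect (?a j l) s + defect (?b j l) s - defect (?d j l) s - defect (?e j l) s)))"
          by (simp only: second_difference_defect[OF s])
      qed
      then show ?thesis using i by simp
    qed
    have Q: "?Q p = (\<Sum>j\<in>UNIV. \<Sum>l\<in>UNIV. ?c j l * ((1/4) * (?Q (?a j l) / 2 + ?Q (?b j l) / 2 - ?Q (?d j l) / 2 - ?Q (?e j l) / 2)))"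
      unfolding quadratic_form_expand[of A p] second_difference_quadratic[OF A] ..
    have i1: "integrable (R n) (defect q)" for n q by (intro iR continuous_on_defect)
    have i2: "integrable \<rho> (defect q)" for q by (rule integrable_defect[OF \<rho>])
    have rhs: "?Q p + (\<integral>s. Re (monom_T s m) * sqf p s \<partial>\<rho>) = (\<Sum>j\<in>UNIV. \<Sum>l\<in>UNIV. ?c j l * ((1/4) *
        ((?Q (?a j l) / 2 + (\<integral>s. defect (?a j l) s \<partial>\<rho>)) + (?Q (?b j l) / 2 + (\<integral>s. defect (?b j l) s \<partial>\<rho>)) -
         (?Q (?d j l) / 2 + (\<integral>s. defect (?d j l) s \<partial>\<rho>)) - (?Q (?e j l) / 2 + (\<integral>s. defect (?e j l) s \<partial>\<rho>)))))"
      unfolding Q eq[OF \<rho>(1) i2] sum.distrib[symmetric] distrib_left[symmetric]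
      by (intro sum.cong refl arg_cong2[where f = "(*)"]) simp
    show ?thesis
      unfolding rhs eq[OF R(2) i1] by (intro tendsto_intros lim)
  qed
  define good where "good h \<longleftrightarrow> continuous_on torus h \<and>
      (\<lambda>n. \<integral>s. h s * sqf p s \<partial>R n) \<longlonglongrightarrow> h ones * ?Q p + (\<integral>s. h s * sqf p s \<partial>\<rho>)" for h :: "complex ^ 'd \<Rightarrow> real"
  \<comment> \<open>Only real parts of characters are controlled by \<open>base\<close>, so a
    trigonometric polynomial becomes admissible after symmetrization.\<close>
  have even: "\<exists>h. good h \<and> (\<forall>s\<in>torus. h s = (g s + g (conj_T s)) / 2)" if "trig g" for g
    using that
  proof (induction rule: trig.induct)
    case (trig_base f c m)
    \<comment> \<open>The term \<open>Im c * Im (monom_T s m)\<close> is odd under conjugation and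
      cancels.\<close>
    let ?h = "\<lambda>s. Re c * Re (monom_T s m)"
    have "good ?h"
      unfolding good_def
    proof
      show "continuous_on torus ?h" by (intro continuous_intros continuous_on_monom_T)
      have "(\<lambda>n. Re c * (\<integral>s. Re (monom_T s m) * sqf p s \<partial>R n)) \<longlonglongrightarrow> Re c * (?Q p + (\<integral>s. Re (monom_T s m) * sqf p s \<partial>\<rho>))"
        by (intro tendsto_intros base)
      then show "(\<lambda>n. \<integral>s. ?h s * sqf p s \<partial>R n) \<longlonglongrightarrow> ?h ones * ?Q p + (\<integral>s. ?h s * sqf p s \<partial>\<rho>)"
        by (simp add: mult.assoc distrib_left)
    qed
    moreover have "?h s = (f s + f (conj_T s)) / 2" if "s \<in> torus" for s
      using trig_base[OF that] trig_base[OF conj_T_torus[OF that]] by (simp add: monom_T_conj)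
    ultimately show ?case by blast
  next
    case (trig_add f g h)
    then obtain hf hg where *: "good hf" "\<And>s. s \<in> torus \<Longrightarrow> hf s = (f s + f (conj_T s)) / 2"
      "good hg" "\<And>s. s \<in> torus \<Longrightarrow> hg s = (g s + g (conj_T s)) / 2" by blast
    let ?h = "\<lambda>s. hf s + hg s"
    have c: "continuous_on torus hf" "continuous_on torus hg" using *(1,3) unfolding good_def by blast+
    have "good ?h"
      unfolding good_def
    proof
      show "continuous_on torus ?h" by (intro continuous_intros c)
      have ir: "integrable (R n) (\<lambda>s. hf s * sqf p s)" "integrable (R n) (\<lambda>s. hg s * sqf p s)" for n
        by (intro iR continuous_intros c)+
      have "(\<lambda>n. (\<integral>s. hf s * sqf p s \<partial>R n) + (\<integral>s. hg s * sqf p s \<partial>R n)) \<longlonglongrightarrow>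
          (hf ones * ?Q p + (\<integral>s. hf s * sqf p s \<partial>\<rho>)) + (hg ones * ?Q p + (\<integral>s. hg s * sqf p s \<partial>\<rho>))"
        using *(1,3) unfolding good_def by (intro tendsto_add) blast+
      then show "(\<lambda>n. \<integral>s. ?h s * sqf p s \<partial>R n) \<longlonglongrightarrow> ?h ones * ?Q p + (\<integral>s. ?h s * sqf p s \<partial>\<rho>)"
        using ir i\<rho>[OF c(1)] i\<rho>[OF c(2)] by (simp add: distrib_right add_ac)
    qed
    moreover have "?h s = (h s + h (conj_T s)) / 2" if "s \<in> torus" for s
      using *(2,4)[OF that] trig_add.hyps(3)[OF that] trig_add.hyps(3)[OF conj_T_torus[OF that]]
      by (simp add: field_simps)
    ultimately show ?case by blast
  qed
  have M0: "0 \<le> M"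
  proof -
    have "0 \<le> (\<integral>s. qT s \<partial>R 0)"
      by (intro integral_nonneg_AE AE_I2) (simp add: space_T[OF R(2)] qT_nonneg)
    then show ?thesis using M[of 0] by linarith
  qed
  \<comment> \<open>Bounds the masses of all measures that see the approximation error: the weighted
    \<open>R n\<close>, the atom at \<open>ones\<close>, and the weighted \<rho>. The summand 1
    makes it positive.\<close>
  define K where "K = C * M + \<bar>?Q p\<bar> + C * (\<integral>s. qT s \<partial>\<rho>) + 1"
  have K: "K > 0"
  proof -
    have "0 \<le> (\<integral>s. qT s \<partial>\<rho>)"
      by (intro integral_nonneg_AE AE_I2) (simp add: space_T[OF \<rho>(1)] qT_nonneg)
    then have "0 \<le> C * M" "0 \<le> C * (\<integral>s. qT s \<partial>\<rho>)" using C M0 by auto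
    then show ?thesis by (simp add: K_def)
  qed
  have cut: "(\<lambda>n. \<integral>s. cutoff \<epsilon> s * sqf p s \<partial>R n) \<longlonglongrightarrow> ?Q p + (\<integral>s. cutoff \<epsilon> s * sqf p s \<partial>\<rho>)" if "\<epsilon> > 0" for \<epsilon>
  proof (rule tendsto_approx)
    fix e0 :: real assume e0: "e0 > 0"
    define e where "e = e0 / K"
    have e: "e > 0" using e0 K by (simp add: e_def)
    have cc: "continuous_on torus (cutoff \<epsilon> :: complex ^ 'd \<Rightarrow> real)" by (intro continuous_intros)
    obtain g :: "complex ^ 'd \<Rightarrow> real" where g: "trig g" "\<And>s. s \<in> torus \<Longrightarrow> \<bar>cutoff \<epsilon> s - g s\<bar> < e"
      using trig_approx[OF cc e] by blast
    obtain h where h: "good h" "\<And>s. s \<in> torus \<Longrightarrow> h s = (g s + g (conj_T s)) / 2"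
      using even[OF g(1)] by blast
    have ch: "continuous_on torus h" using h(1) unfolding good_def by blast
    have d: "\<bar>cutoff \<epsilon> s - h s\<bar> \<le> e" if "s \<in> torus" for s
      using g(2)[OF that] g(2)[OF conj_T_torus[OF that]] h(2)[OF that] by (simp add: cutoff_conj abs_le_iff abs_less_iff field_simps)
    have int: "\<bar>(\<integral>s. cutoff \<epsilon> s * sqf p s \<partial>N) - (\<integral>s. h s * sqf p s \<partial>N)\<bar> \<le> e * (C * (\<integral>s. qT s \<partial>N))"
      if N: "sets N = sets Tb" "integrable N qT"
        and i: "integrable N (\<lambda>s. cutoff \<epsilon> s * sqf p s)" "integrable N (\<lambda>s. h s * sqf p s)" for N
    proof -
      have "(\<integral>s. cutoff \<epsilon> s * sqf p s \<partial>N) - (\<integral>s. h s * sqf p s \<partial>N) = (\<integral>s. cutoff \<epsilon> s * sqf p s - h s * sqf p s \<partial>N)"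
        using i by simp
      also have "\<bar>\<dots>\<bar> \<le> (\<integral>s. \<bar>cutoff \<epsilon> s * sqf p s - h s * sqf p s\<bar> \<partial>N)" by (rule integral_abs_bound)
      also have "\<dots> \<le> (\<integral>s. e * (C * qT s) \<partial>N)"
      proof (rule integral_mono)
        fix s assume "s \<in> space N"
        then have s: "s \<in> torus" by (simp add: space_T[OF N(1)])
        have "\<bar>cutoff \<epsilon> s * sqf p s - h s * sqf p s\<bar> = \<bar>cutoff \<epsilon> s - h s\<bar> * sqf p s"
          using sq[of s] by (simp add: left_diff_distrib[symmetric] abs_mult)
        also have "\<dots> \<le> e * (C * qT s)" using d[OF s] sqC[OF s] sq[of s] e by (intro mult_mono) auto
        finally show "\<bar>cutoff \<epsilon> s * sqf p s - h s * sqf p s\<bar> \<le> e * (C * qT s)" .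
      qed (use i N in auto)
      finally show ?thesis by simp
    qed
    let ?J = "h ones * ?Q p + (\<integral>s. h s * sqf p s \<partial>\<rho>)"
    show "\<exists>J Jn. Jn \<longlonglongrightarrow> J \<and> (\<forall>\<^sub>F n in sequentially. norm ((\<integral>s. cutoff \<epsilon> s * sqf p s \<partial>R n) - Jn n) \<le> e0) \<and>
        norm (?Q p + (\<integral>s. cutoff \<epsilon> s * sqf p s \<partial>\<rho>) - J) \<le> e0"
    proof (intro exI[of _ ?J] exI[of _ "\<lambda>n. \<integral>s. h s * sqf p s \<partial>R n"] conjI always_eventually allI)
      show "(\<lambda>n. \<integral>s. h s * sqf p s \<partial>R n) \<longlonglongrightarrow> ?J" using h(1) by (simp add: good_def)
      have eK: "e * x \<le> e0" if "x \<le> K" for x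
        using mult_left_mono[OF that, of e] e K by (simp add: e_def)
      have I\<rho>: "0 \<le> C * (\<integral>s. qT s \<partial>\<rho>)"
        using C by (intro mult_nonneg_nonneg integral_nonneg_AE AE_I2) (simp_all add: space_T[OF \<rho>(1)] qT_nonneg)
      have CM: "0 \<le> C * M" using C M0 by simp
      fix n
      have iq: "integrable (R n) qT" by (intro iR continuous_intros)
      have i1: "integrable (R n) (\<lambda>s. cutoff \<epsilon> s * sqf p s)" by (intro iR continuous_intros)
      have i2: "integrable (R n) (\<lambda>s. h s * sqf p s)" by (intro iR continuous_intros ch)
      have "C * (\<integral>s. qT s \<partial>R n) \<le> C * M" using C M by (intro mult_left_mono)
      then have "C * (\<integral>s. qT s \<partial>R n) \<le> K" using I\<rho> by (simp add: K_def)
      then have "e * (C * (\<integral>s. qT s \<partial>R n)) \<le> e0" by (rule eK)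
      with int[OF R(2) iq i1 i2]
      show "norm ((\<integral>s. cutoff \<epsilon> s * sqf p s \<partial>R n) - (\<integral>s. h s * sqf p s \<partial>R n)) \<le> e0" by simp
      have o: "\<bar>1 - h ones\<bar> \<le> e" using d[of ones] by (simp add: cutoff_eq_1[OF \<open>\<epsilon> > 0\<close>])
      have "norm (?Q p + (\<integral>s. cutoff \<epsilon> s * sqf p s \<partial>\<rho>) - ?J) =
          \<bar>(1 - h ones) * ?Q p + ((\<integral>s. cutoff \<epsilon> s * sqf p s \<partial>\<rho>) - (\<integral>s. h s * sqf p s \<partial>\<rho>))\<bar>"
        by (simp add: algebra_simps)
      also have "\<dots> \<le> \<bar>1 - h ones\<bar> * \<bar>?Q p\<bar> + \<bar>(\<integral>s. cutoff \<epsilon> s * sqf p s \<partial>\<rho>) - (\<integral>s. h s * sqf p s \<partial>\<rho>)\<bar>"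
        by (rule order_trans[OF abs_triangle_ineq]) (simp add: abs_mult)
      also have "\<dots> \<le> e * \<bar>?Q p\<bar> + e * (C * (\<integral>s. qT s \<partial>\<rho>))"
        by (intro add_mono mult_right_mono o int[OF \<rho> i\<rho>[OF cc] i\<rho>[OF ch]]) auto
      also have "\<dots> = e * (\<bar>?Q p\<bar> + C * (\<integral>s. qT s \<partial>\<rho>))" by (simp add: distrib_left)
      also have "\<dots> \<le> e0" using CM by (intro eK) (simp add: K_def)
      finally show "norm (?Q p + (\<integral>s. cutoff \<epsilon> s * sqf p s \<partial>\<rho>) - ?J) \<le> e0" .
    qed
  qed
  \<comment> \<open>It remains to make the contribution of \<rho> near \<open>ones\<close> small; it
    is dominated by the integral of \<open>cutoff \<epsilon> s * qT s\<close>.\<close>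
  show ?thesis
    unfolding DL_def
  proof (intro allI impI)
    fix \<delta> :: real assume \<delta>: "\<delta> > 0"
    then have "\<delta> / (2 * (C + 1)) > 0" using C by simp
    from integral_cutoff_qT_small[OF \<rho> this] obtain x where x: "x > 0"
      "\<And>\<epsilon>. 0 < \<epsilon> \<Longrightarrow> \<epsilon> < x \<Longrightarrow> (\<integral>s. cutoff \<epsilon> s * qT s \<partial>\<rho>) < \<delta> / (2 * (C + 1))" by blast
    show "\<exists>\<epsilon>0>0. \<forall>\<epsilon>. 0 < \<epsilon> \<and> \<epsilon> < \<epsilon>0 \<longrightarrow> (\<forall>\<^sub>F n in sequentially. \<bar>(\<integral>s. cutoff \<epsilon> s * sqf p s \<partial>R n) - ?Q p\<bar> < \<delta>)"
    proof (intro exI[of _ x] conjI allI impI)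
      fix \<epsilon> assume \<epsilon>: "0 < \<epsilon> \<and> \<epsilon> < x"
      let ?S = "\<integral>s. cutoff \<epsilon> s * sqf p s \<partial>\<rho>"
      have iS: "integrable \<rho> (\<lambda>s. cutoff \<epsilon> s * sqf p s)" by (intro i\<rho> continuous_intros)
      have iq: "integrable \<rho> (\<lambda>s. C * (cutoff \<epsilon> s * qT s))"
        by (intro integrable_mult_right integrable_qT_bound[OF \<rho>, of _ 1] borel_measurable_Tb continuous_intros)
          (simp add: abs_cutoff_qT_le)
      have S0: "0 \<le> ?S"
        using cutoff_bounds sq by (intro integral_nonneg_AE AE_I2 mult_nonneg_nonneg)
      have "?S \<le> (\<integral>s. C * (cutoff \<epsilon> s * qT s) \<partial>\<rho>)"
      proof (rule integral_mono[OF iS iq])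
        fix s assume "s \<in> space \<rho>"
        then have s: "s \<in> torus" by (simp add: space_T[OF \<rho>(1)])
        have "cutoff \<epsilon> s * sqf p s \<le> cutoff \<epsilon> s * (C * qT s)"
          by (intro mult_left_mono sqC[OF s] cutoff_bounds)
        then show "cutoff \<epsilon> s * sqf p s \<le> C * (cutoff \<epsilon> s * qT s)" by (simp add: mult_ac)
      qed
      also have "\<dots> = C * (\<integral>s. cutoff \<epsilon> s * qT s \<partial>\<rho>)" by simp
      also have "\<dots> \<le> C * (\<delta> / (2 * (C + 1)))"
        using x(2)[of \<epsilon>] \<epsilon> C by (intro mult_left_mono) auto
      also have "\<dots> \<le> \<delta> / 2" using C \<delta> by (simp add: field_simps)
      finally have S: "?S \<le> \<delta> / 2" .
      have "\<forall>\<^sub>F n in sequentially. dist (\<integral>s. cutoff \<epsilon> s * sqf p s \<partial>R n) (?Q p + ?S) < \<delta> / 2"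
        using cut[of \<epsilon>] \<epsilon> \<delta> by (intro tendstoD) auto
      then show "\<forall>\<^sub>F n in sequentially. \<bar>(\<integral>s. cutoff \<epsilon> s * sqf p s \<partial>R n) - ?Q p\<bar> < \<delta>"
      proof eventually_elim
        case (elim n)
        then have "\<bar>(\<integral>s. cutoff \<epsilon> s * sqf p s \<partial>R n) - (?Q p + ?S)\<bar> < \<delta> / 2" by (simp only: dist_real_def)
        then show ?case using S S0 by linarith
      qed
    qed (rule x)
  qed
qed

section \<open>Bounding the integral of \<open>qT\<close> through moduli\<close>

text \<open>With b_j the mean of 1 - Re s_j and a their sum, 1 minus the squared modulus is 2 b_j -
  b_j^2 minus the squared mean of Im s_j. By C the last term is quadratic in a, so the sum over j is
  at least 2 a - a^2 - d C^2 a^2, hence at least a when a is small.\<close>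

lemma one_minus_norm_charT_sq:
  fixes \<nu> :: "(complex ^ 'd) measure"
  assumes \<nu>: "prob_T \<nu>" and C: "\<And>j. \<bar>\<integral>s. Im (s $ j) \<partial>\<nu>\<bar> \<le> C * (\<integral>s. qT s \<partial>\<nu>)"
    and small: "(1 + real CARD('d) * C\<^sup>2) * (\<integral>s. qT s \<partial>\<nu>) \<le> 1"
  shows "(\<integral>s. qT s \<partial>\<nu>) \<le> (\<Sum>j\<in>UNIV. 1 - (cmod (charT \<nu> (axis j 1)))\<^sup>2)"
proof -
  interpret prob_space \<nu> by (rule prob_T_prob[OF \<nu>])
  note s\<nu> = prob_T_sets[OF \<nu>]
  define a where "a = (\<integral>s. qT s \<partial>\<nu>)"
  define b where "b j = (\<integral>s. 1 - Re (s $ j) \<partial>\<nu>)" for j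
  have i: "integrable \<nu> (\<lambda>s. s $ j)" "integrable \<nu> (\<lambda>s. 1 - Re (s $ j))" for j
    by (intro integrable_T_continuous prob_T_finite \<nu> s\<nu> continuous_intros)+
  have ab: "a = (\<Sum>j\<in>UNIV. b j)" unfolding a_def b_def qT_def using i by simp
  have b0: "0 \<le> b j" for j
    unfolding b_def by (intro integral_nonneg_AE AE_I2) (simp add: space_T[OF s\<nu>] Re_le_1_torus)
  have ba: "b j \<le> a" for j
    unfolding ab using b0 by (intro member_le_sum) auto
  have a0: "0 \<le> a" using b0 ba order_trans by blast
  have n: "(cmod (charT \<nu> (axis j 1)))\<^sup>2 = (1 - b j)\<^sup>2 + (\<integral>s. Im (s $ j) \<partial>\<nu>)\<^sup>2" for j
  proof -
    have "charT \<nu> (axis j 1) = (\<integral>s. s $ j \<partial>\<nu>)" by (simp add: charT_def)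
    moreover have "Re (\<integral>s. s $ j \<partial>\<nu>) = 1 - b j"
      using i(1)[of j] by (simp add: b_def prob_space)
    ultimately show ?thesis using i(1)[of j] by (simp add: cmod_power2)
  qed
  have "2 * b j - a * b j - C\<^sup>2 * a\<^sup>2 \<le> 1 - (cmod (charT \<nu> (axis j 1)))\<^sup>2" for j
  proof -
    have "(\<integral>s. Im (s $ j) \<partial>\<nu>)\<^sup>2 \<le> (C * a)\<^sup>2"
      using C[of j] unfolding a_def[symmetric] by (metis abs_ge_zero power2_abs power_mono)
    moreover have "b j * b j \<le> a * b j" by (intro mult_right_mono ba b0)
    ultimately show ?thesis unfolding n by (simp add: power2_eq_square algebra_simps)
  qed
  then have "(\<Sum>j\<in>UNIV. 2 * b j - a * b j - C\<^sup>2 * a\<^sup>2) \<le> (\<Sum>j\<in>UNIV. 1 - (cmod (charT \<nu> (axis j 1)))\<^sup>2)"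
    by (rule sum_mono)
  moreover have "(\<Sum>j\<in>UNIV. 2 * b j - a * b j - C\<^sup>2 * a\<^sup>2) = 2 * a - a * a - real CARD('d) * (C\<^sup>2 * a\<^sup>2)"
    by (simp add: sum_subtractf sum_distrib_left[symmetric] ab[symmetric])
  moreover have "a * ((1 + real CARD('d) * C\<^sup>2) * a) \<le> a * 1"
    using small a0 unfolding a_def[symmetric] by (intro mult_left_mono)
  then have "a * a + real CARD('d) * (C\<^sup>2 * a\<^sup>2) \<le> a"
    by (simp add: power2_eq_square algebra_simps)
  ultimately show ?thesis unfolding a_def[symmetric] by linarith
qed

lemma prod_le_exp_minus_sum:
  fixes x :: "'i \<Rightarrow> real"
  assumes "\<And>k. k \<in> I \<Longrightarrow> 0 \<le> x k"
  shows "(\<Prod>k\<in>I. x k) \<le> exp (- (\<Sum>k\<in>I. 1 - x k))"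
proof (cases "finite I")
  case True
  have "(\<Prod>k\<in>I. x k) \<le> (\<Prod>k\<in>I. exp (- (1 - x k)))"
    using assms exp_ge_add_one_self[of "- (1 - x k)" for k] by (intro prod_mono) (simp add: add.commute)
  also have "\<dots> = exp (- (\<Sum>k\<in>I. 1 - x k))"
    using True by (simp add: exp_sum[symmetric] sum_negf[symmetric])
  finally show ?thesis .
qed simp

text \<open>The squared modulus of the convolution at a coordinate character is at most exp of minus
  the sum of the terms 1 - |f|^2. A nonzero limit keeps it away from 0, so those sums are bounded,
  and they dominate the integral of \<open>qT\<close>.\<close>

lemma qT_bound_of_charT:
  fixes \<nu> :: "nat \<Rightarrow> nat \<Rightarrow> (complex ^ 'd) measure"
  assumes \<theta>: "0 < \<theta>" "\<theta> < 1" and inf: "infinitesimal_T \<nu> kn" and \<xi>: "\<forall>n. \<xi> n \<in> torus"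
    and lim: "\<And>j. (\<lambda>n. charT (conv_T (\<xi> n) (\<nu> n) (kn n)) (axis j 1)) \<longlonglongrightarrow> L j" and L: "\<And>j. L j \<noteq> 0"
  shows "\<exists>M. \<forall>\<^sub>F n in sequentially. (\<integral>s. qT s \<partial>rho_n \<theta> \<nu> kn n) \<le> M"
proof -
  define h where "h = \<theta> / (2 * real CARD('d))"
  define C where "C = 4 + 24 / h\<^sup>2"
  define D where "D = 1 + real CARD('d) * C\<^sup>2"
  have D: "D > 0" unfolding D_def by (intro add_pos_nonneg) auto
  have h: "h > 0" using \<theta> by (simp add: h_def)
  \<comment> \<open>h is the size of \<open>tmean\<close> allowed in
    \<open>integral_Im_centered\<close>; 1 / D meets the smallness condition of
    \<open>one_minus_norm_charT_sq\<close>.\<close>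
  define \<delta> where "\<delta> = min h (1 / D)"
  have \<delta>: "\<delta> > 0" "\<delta> \<le> h" "\<delta> \<le> 1 / D" using h D by (auto simp: \<delta>_def)
  let ?\<Phi> = "\<lambda>n j. charT (conv_T (\<xi> n) (\<nu> n) (kn n)) (axis j 1)"
  have "\<forall>\<^sub>F n in sequentially. (cmod (L j))\<^sup>2 / 2 < (cmod (?\<Phi> n j))\<^sup>2" for j
  proof (rule order_tendstoD)
    show "(\<lambda>n. (cmod (?\<Phi> n j))\<^sup>2) \<longlonglongrightarrow> (cmod (L j))\<^sup>2" by (intro tendsto_intros lim)
    show "(cmod (L j))\<^sup>2 / 2 < (cmod (L j))\<^sup>2" using L[of j] by simp
  qed
  then have "\<forall>\<^sub>F n in sequentially. \<forall>j\<in>UNIV. (cmod (L j))\<^sup>2 / 2 < (cmod (?\<Phi> n j))\<^sup>2"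
    by (intro eventually_ball_finite) auto
  then have "\<forall>\<^sub>F n in sequentially. (\<integral>s. qT s \<partial>rho_n \<theta> \<nu> kn n) \<le> (\<Sum>j\<in>UNIV. - ln ((cmod (L j))\<^sup>2 / 2))"
    using infinitesimal_small[OF inf \<theta> \<delta>(1)]
  proof eventually_elim
    case (elim n)
    let ?c = "\<lambda>k. centered \<theta> (\<nu> n k)"
    have pc: "prob_T (?c k)" if "k \<in> {1..kn n}" for k
      by (rule prob_T_centered[OF infinitesimal_prob_T[OF inf that]])
    have "(\<integral>s. qT s \<partial>rho_n \<theta> \<nu> kn n) = (\<Sum>k\<in>{1..kn n}. \<integral>s. qT s \<partial>?c k)"
      by (intro integral_rho_n_real[OF inf] continuous_intros)
    also have "\<dots> \<le> (\<Sum>k\<in>{1..kn n}. \<Sum>j\<in>UNIV. 1 - (cmod (charT (?c k) (axis j 1)))\<^sup>2)"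
    proof (rule sum_mono)
      fix k assume k: "k \<in> {1..kn n}"
      have tm: "\<bar>tmean \<theta> (\<nu> n k) j\<bar> \<le> \<theta> / (2 * real CARD('d))" for j
        using elim(2) k \<delta>(2) unfolding h_def by (blast intro: order_trans)
      show "(\<integral>s. qT s \<partial>?c k) \<le> (\<Sum>j\<in>UNIV. 1 - (cmod (charT (?c k) (axis j 1)))\<^sup>2)"
      proof (rule one_minus_norm_charT_sq[OF pc[OF k]])
        show "\<bar>\<integral>s. Im (s $ j) \<partial>?c k\<bar> \<le> C * (\<integral>s. qT s \<partial>?c k)" for j
          unfolding C_def h_def by (rule integral_Im_centered[OF infinitesimal_prob_T[OF inf k] \<theta> tm])
        have "(\<integral>s. qT s \<partial>?c k) \<le> 1 / D" using elim(2) k \<delta>(3) by (blast intro: order_trans)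
        then have "D * (\<integral>s. qT s \<partial>?c k) \<le> D * (1 / D)" using D by (intro mult_left_mono) auto
        then show "(1 + real CARD('d) * C\<^sup>2) * (\<integral>s. qT s \<partial>?c k) \<le> 1" using D by (simp add: D_def)
      qed
    qed
    also have "\<dots> = (\<Sum>j\<in>UNIV. \<Sum>k\<in>{1..kn n}. 1 - (cmod (charT (?c k) (axis j 1)))\<^sup>2)"
      by (rule sum.swap)
    also have "\<dots> \<le> (\<Sum>j\<in>UNIV. - ln ((cmod (L j))\<^sup>2 / 2))"
    proof (rule sum_mono)
      fix j
      let ?S = "\<Sum>k\<in>{1..kn n}. 1 - (cmod (charT (?c k) (axis j 1)))\<^sup>2"
      have l0: "(cmod (L j))\<^sup>2 / 2 > 0" using L[of j] by simp
      have "(cmod (L j))\<^sup>2 / 2 < (cmod (?\<Phi> n j))\<^sup>2" using elim(1) by blast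
      also have "\<dots> = (\<Prod>k\<in>{1..kn n}. (cmod (charT (?c k) (axis j 1)))\<^sup>2)"
        unfolding charT_conv_T_centered[where \<theta> = \<theta> and \<xi> = \<xi>, OF inf \<xi>[rule_format]]
        using \<xi> norm_monom_T[OF bvec_torus, of \<theta> _ "axis j 1"] norm_monom_T[of "\<xi> n" "axis j 1"]
        by (simp only: norm_mult prod_norm[symmetric] prod_power_distrib mult_1)
      also have "\<dots> \<le> exp (- ?S)" by (rule prod_le_exp_minus_sum) simp
      finally have "(cmod (L j))\<^sup>2 / 2 \<le> exp (- ?S)" by simp
      then have "ln ((cmod (L j))\<^sup>2 / 2) \<le> ln (exp (- ?S))" using l0 by (subst ln_le_cancel_iff) auto
      then show "?S \<le> - ln ((cmod (L j))\<^sup>2 / 2)" by simp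
    qed
    finally show ?case .
  qed
  then show ?thesis by blast
qed

text \<open>The exponential is never inverted over the complex numbers: \<open>\<gamma>\<close>
  comes from directions, the Gaussian part from real logarithms of moduli, and membership of the
  limit points in the class from cancelling nonzero factors.\<close>

lemma necessity:
  fixes \<gamma> :: "complex ^ 'd" and A :: "real ^ 'd ^ 'd" and \<rho> :: "(complex ^ 'd) measure"
  assumes \<theta>: "0 < \<theta>" "\<theta> < 1" and t: "levy_triplet_T \<gamma> A \<rho>" and inf: "infinitesimal_T \<nu> kn"
    and \<xi>: "\<forall>n. \<xi> n \<in> torus"
    and lim: "\<And>p. (\<lambda>n. charT (conv_T (\<xi> n) (\<nu> n) (kn n)) p) \<longlonglongrightarrow> levy_exponent_T \<gamma> A \<rho> p"
  shows "gamma_n \<theta> \<nu> kn \<xi> \<longlonglongrightarrow> \<gamma>"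
    and "DL (\<lambda>\<epsilon> n. \<integral>s. cutoff \<epsilon> s * sqf p s \<partial>rho_n \<theta> \<nu> kn n) ((A *v ivec p) \<bullet> ivec p)"
    and "strict_mono (r :: nat \<Rightarrow> nat) \<Longrightarrow> \<exists>(r' :: nat \<Rightarrow> nat) \<tau>. strict_mono r' \<and> \<tau> \<in> Mtilde \<and>
      vague (\<lambda>n. rho_n \<theta> \<nu> kn (r (r' n))) \<tau>"
    and "strict_mono r \<Longrightarrow> \<tau> \<in> Mtilde \<Longrightarrow> vague (\<lambda>n. rho_n \<theta> \<nu> kn (r n)) \<tau> \<Longrightarrow> \<tau> \<in> levy_class \<rho>"
proof -
  let ?R = "rho_n \<theta> \<nu> kn"
  let ?E = "levy_exponent_T \<gamma> A \<rho>"
  have \<rho>: "levy_measure_T \<rho>" and \<gamma>T: "\<gamma> \<in> torus" and A: "transpose A = A"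
    using t by (auto simp: levy_triplet_T_def)
  have s\<rho>: "sets \<rho> = sets Tb" "integrable \<rho> qT" using \<rho> by (auto simp: levy_measure_T_iff)
  have E0: "?E p \<noteq> 0" for p
    using norm_levy_exponent_T[OF t, of p] by (metis exp_not_eq_zero norm_zero)
  note fR = finite_measure_rho_n[OF inf, of \<theta>] and sR = sets_rho_n[of \<theta> \<nu> kn]
  obtain M0 where M0: "\<forall>\<^sub>F n in sequentially. (\<integral>s. qT s \<partial>?R n) \<le> M0"
    using qT_bound_of_charT[OF \<theta> inf \<xi> lim E0] by blast
  obtain M where M: "\<And>n. (\<integral>s. qT s \<partial>?R n) \<le> M"
    using eventually_bounded_imp_bounded[OF M0] by metis
  have acc: "(\<lambda>n. acc \<theta> \<nu> kn \<xi> n p) \<longlonglongrightarrow> ?E p" for p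
    using tendsto_diff[OF lim[of p] accompanying[OF inf \<theta> \<xi> M0, of p]] by simp
  have iD: "integrable (?R n) (levy_D p)" for n p
    by (intro integrable_T_continuous fR sR continuous_on_levy_D)
  have g: "gamma_n \<theta> \<nu> kn \<xi> n \<in> torus" for n using \<xi> by (intro gamma_n_torus) blast
  show "gamma_n \<theta> \<nu> kn \<xi> \<longlonglongrightarrow> \<gamma>"
  proof (rule vec_tendstoI)
    fix j :: 'd
    have real: "exp (\<integral>s. levy_D (axis j 1) s \<partial>N) = of_real (exp (\<integral>s. Re (s $ j) - 1 \<partial>N))" for N :: "(complex ^ 'd) measure"
      unfolding levy_D_axis by (simp only: integral_complex_of_real exp_of_real)
    \<comment> \<open>For complex numbers \<open>sgn\<close> divides by the modulus, so it strips
      the positive factor and leaves the coordinate of the shift.\<close>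
    have sg: "sgn (z * of_real (exp x)) = z" if "cmod z = 1" for z :: complex and x
      using that by (simp add: sgn_mult sgn_of_real sgn_eq[of z])
    have "(\<lambda>n. sgn (acc \<theta> \<nu> kn \<xi> n (axis j 1))) \<longlonglongrightarrow> sgn (?E (axis j 1))"
      by (intro tendsto_sgn acc E0)
    moreover have "sgn (acc \<theta> \<nu> kn \<xi> n (axis j 1)) = gamma_n \<theta> \<nu> kn \<xi> n $ j" for n
      unfolding acc_def real monom_T_axis by (rule sg[OF torusD[OF g]])
    moreover have "sgn (?E (axis j 1)) = \<gamma> $ j"
    proof -
      have "?E (axis j 1) = \<gamma> $ j * of_real (exp (- (1/2) * ((A *v ivec (axis j 1)) \<bullet> ivec (axis j 1)) + (\<integral>s. Re (s $ j) - 1 \<partial>\<rho>)))"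
        unfolding levy_exponent_T_alt real monom_T_axis by (simp add: exp_of_real[symmetric] exp_add[symmetric])
      then show ?thesis using sg[OF torusD[OF \<gamma>T]] by simp
    qed
    ultimately show "(\<lambda>n. gamma_n \<theta> \<nu> kn \<xi> n $ j) \<longlonglongrightarrow> \<gamma> $ j" by simp
  qed
  have "(\<lambda>n. \<integral>s. defect p s \<partial>?R n) \<longlonglongrightarrow> (A *v ivec p) \<bullet> ivec p / 2 + (\<integral>s. defect p s \<partial>\<rho>)" for p
  proof -
    \<comment> \<open>Real logarithms are continuous off 0, so this limit holds along the whole
      sequence, with \<rho> itself rather than a subsequential limit on the right.\<close>
    have "(\<lambda>n. - ln (cmod (acc \<theta> \<nu> kn \<xi> n p))) \<longlonglongrightarrow> - ln (cmod (?E p))"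
      using E0[of p] by (intro tendsto_intros acc) auto
    moreover have "- ln (cmod (acc \<theta> \<nu> kn \<xi> n p)) = (\<integral>s. defect p s \<partial>?R n)" for n
      unfolding acc_def norm_mult norm_monom_T[OF g] norm_exp_levy_D[OF iD] by simp
    ultimately show ?thesis by (simp add: norm_levy_exponent_T[OF t] add.commute)
  qed
  from DL_of_defect_tendsto[OF fR sR s\<rho> A M this]
  show DL: "DL (\<lambda>\<epsilon> n. \<integral>s. cutoff \<epsilon> s * sqf p s \<partial>?R n) ((A *v ivec p) \<bullet> ivec p)" for p .
  show "\<exists>(r' :: nat \<Rightarrow> nat) \<tau>. strict_mono r' \<and> \<tau> \<in> Mtilde \<and> vague (\<lambda>n. ?R (r (r' n))) \<tau>"
    if "strict_mono (r :: nat \<Rightarrow> nat)" for r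
    using vague_compact[of "\<lambda>n. ?R (r n)" M] fR sR M by blast
  show "\<tau> \<in> levy_class \<rho>" if r: "strict_mono r" and \<tau>: "\<tau> \<in> Mtilde" and v: "vague (\<lambda>n. ?R (r n)) \<tau>" for r \<tau>
  proof -
    have M': "\<forall>\<^sub>F n in sequentially. (\<integral>s. qT s \<partial>?R (r n)) \<le> M" using M by simp
    have i\<tau>: "integrable \<tau> qT"
      by (rule integrable_qT_of_vague[OF \<tau> _ _ v M']) (simp_all add: fR)
    have s\<tau>: "sets \<tau> = sets Tb" and z\<tau>: "emeasure \<tau> {ones} = 0" using \<tau> by (auto simp: Mtilde_def)
    have L\<tau>: "levy_measure_T \<tau>" using i\<tau> s\<tau> z\<tau> by (simp add: levy_measure_T_iff)
    have "exp (\<integral>s. levy_D p s \<partial>\<tau>) = exp (\<integral>s. levy_D p s \<partial>\<rho>)" for p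
    proof -
      let ?Q = "complex_of_real ((A *v ivec p) \<bullet> ivec p)"
      have "(\<lambda>n. \<integral>s. levy_D p s \<partial>?R (r n)) \<longlonglongrightarrow> - ?Q / 2 + (\<integral>s. levy_D p s \<partial>\<tau>)"
        by (rule integral_levy_D_conv[OF _ _ s\<tau> i\<tau> v M' DL_subseq[OF DL r]]) (simp_all add: fR)
      moreover have "(\<lambda>n. gamma_n \<theta> \<nu> kn \<xi> (r n)) \<longlonglongrightarrow> \<gamma>"
        using LIMSEQ_subseq_LIMSEQ[OF \<open>gamma_n \<theta> \<nu> kn \<xi> \<longlonglongrightarrow> \<gamma>\<close> r] by (simp add: o_def)
      then have "(\<lambda>n. monom_T (gamma_n \<theta> \<nu> kn \<xi> (r n)) p) \<longlonglongrightarrow> monom_T \<gamma> p"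
        by (rule tendsto_monom_T[OF _ \<gamma>T g])
      ultimately have "(\<lambda>n. acc \<theta> \<nu> kn \<xi> (r n) p) \<longlonglongrightarrow> monom_T \<gamma> p * exp (- ?Q / 2 + (\<integral>s. levy_D p s \<partial>\<tau>))"
        unfolding acc_def by (intro tendsto_mult tendsto_exp)
      moreover have "(\<lambda>n. acc \<theta> \<nu> kn \<xi> (r n) p) \<longlonglongrightarrow> ?E p"
        using LIMSEQ_subseq_LIMSEQ[OF acc[of p] r] by (simp add: o_def)
      ultimately have "monom_T \<gamma> p * exp (- ?Q / 2 + (\<integral>s. levy_D p s \<partial>\<tau>)) = ?E p"
        by (rule LIMSEQ_unique)
      \<comment> \<open>Neither the shift nor the Gaussian factor vanishes; cancelling them leaves
        the equality of exponentials that \<open>levy_class_iff\<close> asks for.\<close>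
      then have "(monom_T \<gamma> p * exp (- (1/2) * ?Q)) * exp (\<integral>s. levy_D p s \<partial>\<tau>) =
          (monom_T \<gamma> p * exp (- (1/2) * ?Q)) * exp (\<integral>s. levy_D p s \<partial>\<rho>)"
        by (simp add: levy_exponent_T_alt exp_add[symmetric] mult.assoc)
      moreover have "monom_T \<gamma> p \<noteq> 0" using norm_monom_T[OF \<gamma>T, of p] by auto
      ultimately show ?thesis by simp
    qed
    then show ?thesis using L\<tau> levy_class_iff[OF \<rho>, of \<tau>] by blast
  qed
qed

theorem theorem6p6:
  fixes \<gamma> :: "complex ^ 'd" and A :: "real ^ 'd ^ 'd" and \<rho> :: "(complex ^ 'd) measure"
    and \<nu> :: "nat \<Rightarrow> nat \<Rightarrow> (complex ^ 'd) measure" and kn :: "nat \<Rightarrow> nat"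
    and \<xi> :: "nat \<Rightarrow> complex ^ 'd" and \<theta> :: real
  assumes theta: "0 < \<theta>" "\<theta> < 1"
    and triplet: "levy_triplet_T \<gamma> A \<rho>"
    and array: "infinitesimal_T \<nu> kn"
    and xi: "\<forall>n. \<xi> n \<in> torus"
  shows "weak_conv_T (\<lambda>n. conv_T (\<xi> n) (\<nu> n) (kn n)) (mult_ID \<gamma> A \<rho>) \<longleftrightarrow>
     (gamma_n \<theta> \<nu> kn \<xi> \<longlonglongrightarrow> \<gamma>) \<and>
     (\<forall>j l. ((\<lambda>\<epsilon>. limsup (\<lambda>n. ereal (\<integral>s. indicator (U_T \<epsilon>) s * (Im (s $ j) * Im (s $ l)) \<partial>(rho_n \<theta> \<nu> kn n))))
                \<longlongrightarrow> ereal (A $ j $ l)) (at_right 0) \<and>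
            ((\<lambda>\<epsilon>. liminf (\<lambda>n. ereal (\<integral>s. indicator (U_T \<epsilon>) s * (Im (s $ j) * Im (s $ l)) \<partial>(rho_n \<theta> \<nu> kn n))))
                \<longlongrightarrow> ereal (A $ j $ l)) (at_right 0)) \<and>
     Mtilde_rel_compact (\<lambda>n. density (rho_n \<theta> \<nu> kn n) (indicator (torus - {ones}))) \<and>
     Mtilde_limit_points (\<lambda>n. density (rho_n \<theta> \<nu> kn n) (indicator (torus - {ones}))) \<subseteq> levy_class \<rho>"
proof -
  let ?R = "rho_n \<theta> \<nu> kn"
  have A: "transpose A = A" using triplet by (simp add: levy_triplet_T_def)
  have weak: "weak_conv_T (\<lambda>n. conv_T (\<xi> n) (\<nu> n) (kn n)) (mult_ID \<gamma> A \<rho>) \<longleftrightarrow>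
      (\<forall>p. (\<lambda>n. charT (conv_T (\<xi> n) (\<nu> n) (kn n)) p) \<longlonglongrightarrow> levy_exponent_T \<gamma> A \<rho> p)"
  proof -
    have pc: "prob_T (conv_T (\<xi> n) (\<nu> n) (kn n))" for n
      using xi by (intro prob_T_conv_T infinitesimal_prob_T[OF array]) auto
    note pm = mult_ID_spec(1)[OF triplet]
    let ?\<mu> = "\<lambda>n. conv_T (\<xi> n) (\<nu> n) (kn n)"
    show ?thesis
      using charT_of_weak_conv_T[where \<mu>s = ?\<mu>, OF _ pc pm] weak_conv_T_of_charT[where \<mu>s = ?\<mu>, OF _ pc pm]
      unfolding mult_ID_spec(2)[OF triplet] by blast
  qed
  have gauss: "(\<forall>j l. ((\<lambda>\<epsilon>. limsup (\<lambda>n. ereal (\<integral>s. indicator (U_T \<epsilon>) s * (Im (s $ j) * Im (s $ l)) \<partial>(?R n))))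
                \<longlongrightarrow> ereal (A $ j $ l)) (at_right 0) \<and>
            ((\<lambda>\<epsilon>. liminf (\<lambda>n. ereal (\<integral>s. indicator (U_T \<epsilon>) s * (Im (s $ j) * Im (s $ l)) \<partial>(?R n))))
                \<longlongrightarrow> ereal (A $ j $ l)) (at_right 0)) \<longleftrightarrow>
      (\<forall>p. DL (\<lambda>\<epsilon> n. \<integral>s. cutoff \<epsilon> s * sqf p s \<partial>?R n) ((A *v ivec p) \<bullet> ivec p))"
    unfolding DL_iff by (rule DL_entries_iff[OF finite_measure_rho_n[OF array] sets_rho_n A])
  \<comment> \<open>Stated along an arbitrary r, so that it rewrites both nested subsequences in the
    compactness condition and the subsequences defining limit points.\<close>
  have conv: "Mtilde_conv (\<lambda>n. density (?R (r n)) (indicator (torus - {ones}))) \<tau> \<longleftrightarrow> vague (\<lambda>n. ?R (r n)) \<tau>"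
    for r :: "nat \<Rightarrow> nat" and \<tau>
    by (rule Mtilde_conv_iff_vague) simp
  have cpt: "Mtilde_rel_compact (\<lambda>n. density (?R n) (indicator (torus - {ones}))) \<longleftrightarrow>
      (\<forall>r :: nat \<Rightarrow> nat. strict_mono r \<longrightarrow> (\<exists>(r' :: nat \<Rightarrow> nat) \<tau>. strict_mono r' \<and> \<tau> \<in> Mtilde \<and>
        vague (\<lambda>n. ?R (r (r' n))) \<tau>))"
    unfolding Mtilde_rel_compact_def o_def conv[of "\<lambda>n. _ (_ n)"] ..
  have pts: "Mtilde_limit_points (\<lambda>n. density (?R n) (indicator (torus - {ones}))) \<subseteq> levy_class \<rho> \<longleftrightarrow>
      (\<forall>(r :: nat \<Rightarrow> nat) \<tau>. strict_mono r \<longrightarrow> \<tau> \<in> Mtilde \<longrightarrow> vague (\<lambda>n. ?R (r n)) \<tau> \<longrightarrow> \<tau> \<in> levy_class \<rho>)"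
    unfolding Mtilde_limit_points_def o_def conv by blast
  show ?thesis
    unfolding weak gauss cpt pts
  proof (intro iffI)
    assume lim: "\<forall>p. (\<lambda>n. charT (conv_T (\<xi> n) (\<nu> n) (kn n)) p) \<longlonglongrightarrow> levy_exponent_T \<gamma> A \<rho> p"
    note N = necessity[OF theta triplet array xi lim[rule_format]]
    show "gamma_n \<theta> \<nu> kn \<xi> \<longlonglongrightarrow> \<gamma> \<and>
      (\<forall>p. DL (\<lambda>\<epsilon> n. \<integral>s. cutoff \<epsilon> s * sqf p s \<partial>?R n) ((A *v ivec p) \<bullet> ivec p)) \<and>
      (\<forall>r :: nat \<Rightarrow> nat. strict_mono r \<longrightarrow> (\<exists>(r' :: nat \<Rightarrow> nat) \<tau>. strict_mono r' \<and> \<tau> \<in> Mtilde \<and>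
        vague (\<lambda>n. ?R (r (r' n))) \<tau>)) \<and>
      (\<forall>(r :: nat \<Rightarrow> nat) \<tau>. strict_mono r \<longrightarrow> \<tau> \<in> Mtilde \<longrightarrow> vague (\<lambda>n. ?R (r n)) \<tau> \<longrightarrow> \<tau> \<in> levy_class \<rho>)"
      using N by blast
  next
    assume "gamma_n \<theta> \<nu> kn \<xi> \<longlonglongrightarrow> \<gamma> \<and>
      (\<forall>p. DL (\<lambda>\<epsilon> n. \<integral>s. cutoff \<epsilon> s * sqf p s \<partial>?R n) ((A *v ivec p) \<bullet> ivec p)) \<and>
      (\<forall>r :: nat \<Rightarrow> nat. strict_mono r \<longrightarrow> (\<exists>(r' :: nat \<Rightarrow> nat) \<tau>. strict_mono r' \<and> \<tau> \<in> Mtilde \<and>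
        vague (\<lambda>n. ?R (r (r' n))) \<tau>)) \<and>
      (\<forall>(r :: nat \<Rightarrow> nat) \<tau>. strict_mono r \<longrightarrow> \<tau> \<in> Mtilde \<longrightarrow> vague (\<lambda>n. ?R (r n)) \<tau> \<longrightarrow> \<tau> \<in> levy_class \<rho>)"
    then show "\<forall>p. (\<lambda>n. charT (conv_T (\<xi> n) (\<nu> n) (kn n)) p) \<longlonglongrightarrow> levy_exponent_T \<gamma> A \<rho> p"
      by (intro allI sufficiency[OF theta triplet array xi]) blast+
  qed
qed

end
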